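(* Let $M$ be a fixed $f$-implicit $\alpha$-Fréchet sup-measure with control measure $m$ and angular part $\kappa$, with associated integral $I$, and let $g_1,g_2\in L^\alpha_+(m)$. (i) $I(g_1)$ is $f$-implicit $\alpha$-Fréchet distributed; more precisely, $I(g_1)\sim\Phi^f_{\alpha,\kappa}(\|g_1\|_\alpha)$. (ii) For $a,b\ge0$ we have $I(ag_1\vee bg_2)=aI(g_1)\vee_f bI(g_2)$ a.s. (where $ag_1\vee bg_2$ is the pointwise maximum), which in particular means that $I(g_1)$ and $I(g_2)$ commute under the $\vee_f$-operation (a.s.). (iii) The random vectors $I(g_1)$ and $I(g_2)$ are independent if and only if $g_1g_2=0$ $m$-a.e. (iv) $g_1\le g_2$ $m$-a.e. if and only if $I(g_1)\le_f I(g_2)$ a.s. In addition, $g_1=g_2$ $m$-a.e. if and only if $I(g_1)=I(g_2)$ a.s.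
   Context: Loss function. Let $d\ge 1$ and let $f:\mathbb{R}^d\to[0,\infty)$ be fixed such that $f$ is continuous; $f(x)=0$ if and only if $x=0$; and $f(\lambda x)=\lambda f(x)$ for all $\lambda\ge 0$, $x\in\mathbb{R}^d$. Put $S=\{x\in\mathbb{R}^d: f(x)=1\}$ (a compact set). For $x_1,x_2\in\mathbb{R}^d$ let $x_1\vee_f x_2=x_1$ if $f(x_2)\le f(x_1)$ and $x_1\vee_f x_2=x_2$ if $f(x_1)<f(x_2)$. This operation is associative, and inductively $x_1\vee_f\cdots\vee_f x_k=(x_1\vee_f\cdots\vee_f x_{k-1})\vee_f x_k$. The partial order $\le_f$ on $\mathbb{R}^d$ is defined by: $x\le_f y$ if and only if $f(x)<f(y)$ or $x=y$. Fréchet laws. Fix $\alpha>0$. For $\sigma\ge0$, $\Phi_\alpha(\sigma)$ is the law of a real random variable $Z$ with $\mathbb{P}(Z\le x)=\exp(-\sigma^\alpha x^{-\alpha})$ for $x>0$ and $\mathbb{P}(Z\le x)=0$ for $x<0$ (so $\Phi_\alpha(0)$ is the point mass at $0$, and $\mathbb{P}(Z\le 0)=0$ if $\sigma>0$). Fix a probability measure $\kappa$ on $\mathcal{B}(S)$. An $\mathbb{R}^d$-valued random vector $Y$ has law $\Phi^f_{\alpha,\kappa}(\sigma)$ ($f$-implicit $\alpha$-Fréchet with scale $\sigma\ge 0$ and angular part $\kappa$) if $Y\overset{d}{=}\sigma Z\Theta$ with $Z\sim\Phi_\alpha(1)$ independent of the $S$-valued random vector $\Theta\sim\kappa$. Sup-measure.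 Let $(E,\mathcal{E},m)$ be a $\sigma$-finite measure space, $\mathcal{E}_0=\{A\in\mathcal{E}:m(A)<\infty\}$. On a probability space $(\Omega,\mathcal{A},\mathbb{P})$, $M$ is a map from $\mathcal{E}_0$ to the $\mathbb{R}^d$-valued random vectors such that: ($RM_1$) $M(A_1),\dots,M(A_k)$ are independent for finitely many disjoint $A_1,\dots,A_k\in\mathcal{E}_0$; ($RM_2$) for disjoint $A_1,A_2,\dots\in\mathcal{E}_0$ with $\bigcup_j A_j\in\mathcal{E}_0$, almost surely $M(\bigcup_j A_j)=\lim_{k\to\infty} M(A_1)\vee_f\cdots\vee_f M(A_k)=M(A_{j_0})$ for some random index $j_0$; and $M(A)\sim\Phi^f_{\alpha,\kappa}(m(A)^{1/\alpha})$ for every $A\in\mathcal{E}_0$. Integral. A function $g:E\to[0,\infty)$ is simple if $g=\sum_{j=1}^k\alpha_j\mathbf{1}_{A_j}$ with $k\in\mathbb{N}$, $\alpha_j\ge0$ and disjoint $A_j\in\mathcal{E}_0$; then $I(g):=\alpha_1M(A_1)\vee_f\cdots\vee_f\alpha_kM(A_k)$, which a.s. does not depend on the chosen representation. $L^\alpha_+(m)$ is the set of measurable $g:E\to[0,\infty)$ with $\|g\|_\alpha:=(\int_E g^\alpha\,dm)^{1/\alpha}<\infty$. For $g\in L^\alpha_+(m)$, $I(g)$ is the limit in probability of $I(g_n)$ for any sequence of simple functions $(g_n)$ increasing pointwise to $g$ on $E$; this limit exists and is a.s. independent of the sequence $(g_n)$. *)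

theory Defs
  imports "HOL-Probability.Probability"
begin

definition loss_function :: "(real ^ 'n \<Rightarrow> real) \<Rightarrow> bool" where
  "loss_function f \<longleftrightarrow>
     (\<forall>x. 0 \<le> f x) \<and> continuous_on UNIV f \<and> (\<forall>x. f x = 0 \<longleftrightarrow> x = 0) \<and>
     (\<forall>c x. 0 \<le> c \<longrightarrow> f (c *\<^sub>R x) = c * f x)"

definition unit_level :: "(real ^ 'n \<Rightarrow> real) \<Rightarrow> (real ^ 'n) set" where
  "unit_level f = {x. f x = 1}"

definition vee :: "(real ^ 'n \<Rightarrow> real) \<Rightarrow> real ^ 'n \<Rightarrow> real ^ 'n \<Rightarrow> real ^ 'n" where
  "vee f x y = (if f y \<le> f x then x else y)"

text \<open>The left-bracketed join of \<open>x 0, \<dots>, x k\<close>; note that \<open>k\<close> is the last index, so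
  there are always \<open>k + 1 \<ge> 1\<close> terms.\<close>

primrec vee_upto :: "(real ^ 'n \<Rightarrow> real) \<Rightarrow> (nat \<Rightarrow> real ^ 'n) \<Rightarrow> nat \<Rightarrow> real ^ 'n" where
  "vee_upto f x 0 = x 0"
| "vee_upto f x (Suc k) = vee f (vee_upto f x k) (x (Suc k))"

definition le_loss :: "(real ^ 'n \<Rightarrow> real) \<Rightarrow> real ^ 'n \<Rightarrow> real ^ 'n \<Rightarrow> bool" where
  "le_loss f x y \<longleftrightarrow> f x < f y \<or> x = y"

text \<open>The value at \<open>0\<close> is the one forced by right continuity.\<close>

definition frechet_cdf :: "real \<Rightarrow> real \<Rightarrow> real \<Rightarrow> real" where
  "frechet_cdf \<alpha> \<sigma> x =
     (if x < 0 then 0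
      else if x = 0 then (if \<sigma> = 0 then 1 else 0)
      else exp (- (\<sigma> powr \<alpha> * x powr (- \<alpha>))))"

definition frechet :: "real \<Rightarrow> real \<Rightarrow> real measure" where
  "frechet \<alpha> \<sigma> = interval_measure (frechet_cdf \<alpha> \<sigma>)"

text \<open>The law of \<open>\<sigma> Z \<Theta>\<close> for independent \<open>Z \<sim> frechet \<alpha> 1\<close> and \<open>\<Theta> \<sim> \<kappa>\<close>. The loss function
  enters only through \<open>\<kappa>\<close>, which will be a measure on \<open>unit_level f\<close>.\<close>

definition implicit_frechet :: "real \<Rightarrow> (real ^ 'n) measure \<Rightarrow> real \<Rightarrow> (real ^ 'n) measure" where
  "implicit_frechet \<alpha> \<kappa> \<sigma> =
     distr (frechet \<alpha> 1 \<Otimes>\<^sub>M \<kappa>) borel (\<lambda>(z, \<theta>). (\<sigma> * z) *\<^sub>R \<theta>)"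

definition has_law :: "'w measure \<Rightarrow> ('w \<Rightarrow> real ^ 'n) \<Rightarrow> (real ^ 'n) measure \<Rightarrow> bool" where
  "has_law P Y N \<longleftrightarrow> Y \<in> borel_measurable P \<and> distr P borel Y = N"

definition implicit_sup_measure ::
  "(real ^ 'n \<Rightarrow> real) \<Rightarrow> real \<Rightarrow> (real ^ 'n) measure \<Rightarrow> 'e measure \<Rightarrow> 'w measure \<Rightarrow>
   ('e set \<Rightarrow> 'w \<Rightarrow> real ^ 'n) \<Rightarrow> bool" where
  "implicit_sup_measure f \<alpha> \<kappa> m P M \<longleftrightarrow>
     (\<forall>A\<in>fmeasurable m. M A \<in> borel_measurable P) \<and>
     (\<forall>(A :: nat \<Rightarrow> 'e set) k.
        disjoint_family_on A {..<k} \<and> (\<forall>j<k. A j \<in> fmeasurable m) \<longrightarrow>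
        prob_space.indep_vars P (\<lambda>_. borel) (\<lambda>j. M (A j)) {..<k}) \<and>
     (\<forall>A :: nat \<Rightarrow> 'e set.
        disjoint_family A \<and> (\<forall>j. A j \<in> fmeasurable m) \<and> (\<Union>j. A j) \<in> fmeasurable m \<longrightarrow>
        (\<exists>j0 \<in> P \<rightarrow>\<^sub>M count_space (UNIV :: nat set).
           AE \<omega> in P.
             (\<lambda>k. vee_upto f (\<lambda>j. M (A j) \<omega>) k) \<longlonglongrightarrow> M (\<Union>j. A j) \<omega> \<and>
             M (\<Union>j. A j) \<omega> = M (A (j0 \<omega>)) \<omega>)) \<and>
     (\<forall>A\<in>fmeasurable m. has_law P (M A) (implicit_frechet \<alpha> \<kappa> (measure m A powr (1 / \<alpha>))))"

definition simple_rep ::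
  "'e measure \<Rightarrow> ('e \<Rightarrow> real) \<Rightarrow> nat \<Rightarrow> (nat \<Rightarrow> real) \<Rightarrow> (nat \<Rightarrow> 'e set) \<Rightarrow> bool" where
  "simple_rep m g k a A \<longleftrightarrow>
     (\<forall>j\<le>k. 0 \<le> a j \<and> A j \<in> fmeasurable m) \<and> disjoint_family_on A {..k} \<and>
     (\<forall>x\<in>space m. g x = (\<Sum>j\<le>k. a j * indicator (A j) x))"

definition simple_fun :: "'e measure \<Rightarrow> ('e \<Rightarrow> real) \<Rightarrow> bool" where
  "simple_fun m g \<longleftrightarrow> (\<exists>k a A. simple_rep m g k a A)"

text \<open>Different representations give almost surely equal values; an arbitrary one is chosen.\<close>

definition simple_integral ::
  "(real ^ 'n \<Rightarrow> real) \<Rightarrow> 'e measure \<Rightarrow> ('e set \<Rightarrow> 'w \<Rightarrow> real ^ 'n) \<Rightarrow>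
   ('e \<Rightarrow> real) \<Rightarrow> 'w \<Rightarrow> real ^ 'n" where
  "simple_integral f m M g =
     (case SOME (k, a, A). simple_rep m g k a A of
        (k, a, A) \<Rightarrow> (\<lambda>\<omega>. vee_upto f (\<lambda>j. a j *\<^sub>R M (A j) \<omega>) k))"

definition tendsto_in_prob ::
  "'w measure \<Rightarrow> (nat \<Rightarrow> 'w \<Rightarrow> real ^ 'n) \<Rightarrow> ('w \<Rightarrow> real ^ 'n) \<Rightarrow> bool" where
  "tendsto_in_prob P X Y \<longleftrightarrow>
     (\<forall>\<epsilon>>0. (\<lambda>n. measure P {\<omega> \<in> space P. \<epsilon> < norm (X n \<omega> - Y \<omega>)}) \<longlonglongrightarrow> 0)"

text \<open>The integral is determined up to almost sure equality; an arbitrary version is chosen.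
  For simple \<open>g\<close> it agrees almost surely with \<open>simple_integral\<close> (take a constant sequence).\<close>

definition implicit_integral ::
  "(real ^ 'n \<Rightarrow> real) \<Rightarrow> 'e measure \<Rightarrow> 'w measure \<Rightarrow> ('e set \<Rightarrow> 'w \<Rightarrow> real ^ 'n) \<Rightarrow>
   ('e \<Rightarrow> real) \<Rightarrow> 'w \<Rightarrow> real ^ 'n" where
  "implicit_integral f m P M g =
     (SOME X. X \<in> borel_measurable P \<and>
        (\<forall>h :: nat \<Rightarrow> 'e \<Rightarrow> real.
           (\<forall>n. simple_fun m (h n)) \<and>
           (\<forall>x\<in>space m. incseq (\<lambda>n. h n x) \<and> (\<lambda>n. h n x) \<longlonglongrightarrow> g x) \<longrightarrow>
           tendsto_in_prob P (\<lambda>n. simple_integral f m M (h n)) X))"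

definition L_plus :: "real \<Rightarrow> 'e measure \<Rightarrow> ('e \<Rightarrow> real) set" where
  "L_plus \<alpha> m =
     {g \<in> borel_measurable m. (\<forall>x\<in>space m. 0 \<le> g x) \<and>
        (\<integral>\<^sup>+ x. ennreal (g x powr \<alpha>) \<partial>m) < \<infinity>}"

definition L_norm :: "real \<Rightarrow> 'e measure \<Rightarrow> ('e \<Rightarrow> real) \<Rightarrow> real" where
  "L_norm \<alpha> m g = enn2real (\<integral>\<^sup>+ x. ennreal (g x powr \<alpha>) \<partial>m) powr (1 / \<alpha>)"

lemma frechet_cdf_right_cont:
  assumes "0 < \<alpha>" "0 \<le> \<sigma>"
  shows "continuous (at_right x) (frechet_cdf \<alpha> \<sigma>)"
proof -
  consider "x < 0" | "x = 0" "\<sigma> = 0" | "x = 0" "0 < \<sigma>" | "0 < x"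
    using assms by linarith
  then show ?thesis
  proof cases
    case 1
    have "eventually (\<lambda>y. y < 0) (at_right x)"
      using 1 eventually_at_right_real[of x 0] by (auto elim: eventually_mono)
    then have "eventually (\<lambda>y. frechet_cdf \<alpha> \<sigma> y = 0) (at_right x)"
      by eventually_elim (simp add: frechet_cdf_def)
    then show ?thesis
      using 1 by (simp add: continuous_within frechet_cdf_def tendsto_eventually)
  next
    case 2
    have "eventually (\<lambda>y. 0 < y) (at_right x)"
      using 2 by (simp add: eventually_at_right_less)
    then have "eventually (\<lambda>y. frechet_cdf \<alpha> \<sigma> y = 1) (at_right x)"
      by eventually_elim (use 2 in \<open>simp add: frechet_cdf_def\<close>)
    then show ?thesis
      using 2 by (simp add: continuous_within frechet_cdf_def tendsto_eventually)
  next
    case 3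
    have "0 < \<sigma> powr \<alpha>" using 3 by simp
    then have "((\<lambda>y. exp (- (\<sigma> powr \<alpha> * y powr (- \<alpha>)))) \<longlongrightarrow> 0) (at_right 0)"
      using assms(1) by real_asymp
    moreover have "eventually (\<lambda>y. frechet_cdf \<alpha> \<sigma> y = exp (- (\<sigma> powr \<alpha> * y powr (- \<alpha>)))) (at_right 0)"
      using eventually_at_right_less[of "0::real"]
      by eventually_elim (simp add: frechet_cdf_def)
    ultimately have "(frechet_cdf \<alpha> \<sigma> \<longlongrightarrow> 0) (at_right 0)"
      by (simp add: tendsto_cong)
    then show ?thesis
      using 3 by (simp add: continuous_within frechet_cdf_def)
  next
    case 4
    have "((\<lambda>y. exp (- (\<sigma> powr \<alpha> * y powr (- \<alpha>)))) \<longlongrightarrow> exp (- (\<sigma> powr \<alpha> * x powr (- \<alpha>)))) (at_right x)"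
      using 4 by (intro tendsto_intros) auto
    moreover have "eventually (\<lambda>y. frechet_cdf \<alpha> \<sigma> y = exp (- (\<sigma> powr \<alpha> * y powr (- \<alpha>)))) (at_right x)"
      using eventually_at_right_less[of x]
      by eventually_elim (use 4 in \<open>simp add: frechet_cdf_def\<close>)
    ultimately show ?thesis
      using 4 by (simp add: continuous_within tendsto_cong frechet_cdf_def)
  qed
qed

lemma frechet_cdf_mono:
  assumes "0 < \<alpha>" "x \<le> y"
  shows "frechet_cdf \<alpha> \<sigma> x \<le> frechet_cdf \<alpha> \<sigma> y"
proof (cases "0 < x")
  case True
  then have "y powr (- \<alpha>) \<le> x powr (- \<alpha>)"
    using assms by (intro powr_mono2') auto
  then show ?thesis
    using True assms by (auto simp: frechet_cdf_def intro!: mult_left_mono)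
next
  case False
  then show ?thesis
    using assms by (auto simp: frechet_cdf_def)
qed

lemma frechet_cdf_lim:
  assumes "0 < \<alpha>"
  shows "(frechet_cdf \<alpha> \<sigma> \<longlongrightarrow> 0) at_bot" "(frechet_cdf \<alpha> \<sigma> \<longlongrightarrow> 1) at_top"
proof -
  have "eventually (\<lambda>x. frechet_cdf \<alpha> \<sigma> x = 0) at_bot"
    using eventually_gt_at_bot[of "0::real"]
    by eventually_elim (simp add: frechet_cdf_def)
  then show "(frechet_cdf \<alpha> \<sigma> \<longlongrightarrow> 0) at_bot"
    by (rule tendsto_eventually)
  have "((\<lambda>x. exp (- (\<sigma> powr \<alpha> * x powr (- \<alpha>)))) \<longlongrightarrow> exp (- (\<sigma> powr \<alpha> * 0))) at_top"
    using assms by (intro tendsto_intros tendsto_neg_powr filterlim_ident) auto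
  moreover have "eventually (\<lambda>x. frechet_cdf \<alpha> \<sigma> x = exp (- (\<sigma> powr \<alpha> * x powr (- \<alpha>)))) at_top"
    using eventually_gt_at_top[of "0::real"]
    by eventually_elim (simp add: frechet_cdf_def)
  ultimately show "(frechet_cdf \<alpha> \<sigma> \<longlongrightarrow> 1) at_top"
    by (simp add: tendsto_cong)
qed

lemma
  assumes "0 < \<alpha>" "0 \<le> \<sigma>"
  shows real_distribution_frechet: "real_distribution (frechet \<alpha> \<sigma>)"
    and cdf_frechet: "cdf (frechet \<alpha> \<sigma>) = frechet_cdf \<alpha> \<sigma>"
  unfolding frechet_def
  using assms frechet_cdf_mono frechet_cdf_right_cont frechet_cdf_lim
  by (auto intro!: real_distribution_interval_measure cdf_interval_measure)

end

theory Submission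
  imports Defs
begin

text \<open>
  The \<open>\<alpha>\<close>-th powers of the scales play the role of a mass: an implicit Frechet vector with mass \<open>s\<close> is
  \<open>u powr (- 1 / \<alpha>)\<close> times an independent direction, where \<open>u\<close> is exponential with rate \<open>s\<close>. Two independent
  vectors with positive masses \<open>s\<close> and \<open>t\<close> therefore almost surely have different losses, the first has the larger
  loss with probability \<open>s / (s + t)\<close>, and their join has mass \<open>s + t\<close> (\<open>indep_no_ties\<close>,
  \<open>indep_prob_f_less\<close>, \<open>indep_vee_law\<close>). Since ties between disjoint sets are null, the integral of a simple
  function is the greatest one of finitely many vectors with respect to \<open>le_loss f\<close>, whatever the
  representation (\<open>AE_simple_integral_greatest\<close>). For simple functions the join formula, the law and the
  independence of integrals over disjoint supports follow.

  The passage to the limit needs an argument, because a small change of the integrand may move the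
  maximum to another set and thus change the direction of the vector completely. The key estimate
  \<open>same_dir_prob\<close> says that for simple functions \<open>g \<le> h\<close> the two integrals point in the same direction with
  probability at least the ratio of the masses. With the Borel--Cantelli lemma it yields almost sure
  convergence along subsequences (\<open>convergent_subseq_exists\<close>). It also shows that two different directions
  with nearly equal losses are unlikely (\<open>different_dir_gap_prob\<close>), so no ties appear in the limit and the
  integral is monotone for \<open>le_loss f\<close> (\<open>is_limit_mono\<close>). Monotonicity gives uniqueness of the limit, hence
  a description of the integral as an almost sure limit (\<open>is_limit_implicit_integral\<close>).

  The four claims then follow. The law passes to the limit. The integral of the maximum of two
  functions dominates both integrals and its loss is the larger of the two, so it is their join. The
  remaining equivalences compare masses: the law determines the mass, equality or additivity of masses
  for \<open>g1\<close>, \<open>g2\<close> and their maximum determines the pointwise relation almost everywhere, and independence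
  for disjoint supports is inherited from simple functions.
\<close>

section \<open>The loss function and its partial order\<close>

text \<open>On the two vectors' rays: for nonzero \<open>x\<close> and \<open>y\<close> it says that they are positive multiples of
  each other. The cross-multiplied form is a closed condition on the pair, which matters for limits.\<close>

definition same_dir :: "(real ^ 'n \<Rightarrow> real) \<Rightarrow> real ^ 'n \<Rightarrow> real ^ 'n \<Rightarrow> bool" where
  "same_dir f x y \<longleftrightarrow> f x *\<^sub>R y = f y *\<^sub>R x"

locale loss =
  fixes f :: "real ^ 'n \<Rightarrow> real"
  assumes loss_function: "loss_function f"
begin

lemma f_nonneg [simp]: "0 \<le> f x"
  and f_eq_0_iff [simp]: "f x = 0 \<longleftrightarrow> x = 0"
  and f_scaleR: "0 \<le> c \<Longrightarrow> f (c *\<^sub>R x) = c * f x"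
  and continuous_f: "continuous_on UNIV f"
  using loss_function unfolding loss_function_def by auto

lemma f_0 [simp]: "f 0 = 0"
  by simp

lemma f_pos_iff [simp]: "0 < f x \<longleftrightarrow> x \<noteq> 0"
  using f_nonneg[of x] f_eq_0_iff[of x] by linarith

lemma f_measurable [measurable]: "f \<in> borel_measurable borel"
  using continuous_f by (rule borel_measurable_continuous_onI)

lemma tendsto_f: "(X \<longlongrightarrow> x) F \<Longrightarrow> ((\<lambda>i. f (X i)) \<longlongrightarrow> f x) F"
  using continuous_f by (auto simp: continuous_on_def intro: continuous_on_tendsto_compose[OF continuous_f])

text \<open>By homogeneity it is enough to bound \<open>f\<close> below on the compact unit sphere, where it is
  continuous and positive.\<close>

lemma norm_le_mult_f: obtains K where "0 < K" "\<And>x. norm x \<le> K * f x"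
proof -
  have "\<exists>x\<in>sphere 0 1. \<forall>y\<in>sphere 0 1. f x \<le> f y"
    by (intro continuous_attains_inf continuous_on_subset[OF continuous_f]) auto
  then obtain x0 where x0: "norm x0 = 1" "\<And>y. norm y = 1 \<Longrightarrow> f x0 \<le> f y"
    by auto
  then have pos: "0 < f x0" by auto
  have "norm x \<le> (1 / f x0) * f x" for x
  proof (cases "x = 0")
    case False
    then have "f x0 \<le> f ((1 / norm x) *\<^sub>R x)"
      by (intro x0) auto
    also have "\<dots> = (1 / norm x) * f x"
      by (rule f_scaleR) auto
    finally show ?thesis
      using False pos by (auto simp: field_simps)
  qed auto
  with pos show ?thesis
    by (intro that[of "1 / f x0"]) auto
qed

lemma le_loss_refl [simp]: "le_loss f x x"
  and le_loss_0 [simp]: "le_loss f 0 x"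
  and le_loss_imp_le: "le_loss f x y \<Longrightarrow> f x \<le> f y"
  and le_loss_antisym: "le_loss f x y \<Longrightarrow> le_loss f y x \<Longrightarrow> x = y"
  and le_loss_trans: "le_loss f x y \<Longrightarrow> le_loss f y z \<Longrightarrow> le_loss f x z"
  by (auto simp: le_loss_def)

lemma le_loss_scaleR: "0 \<le> c \<Longrightarrow> le_loss f x y \<Longrightarrow> le_loss f (c *\<^sub>R x) (c *\<^sub>R y)"
  by (cases "c = 0") (auto simp: le_loss_def f_scaleR)

lemma le_loss_scaleR_left: "0 \<le> c \<Longrightarrow> c \<le> d \<Longrightarrow> le_loss f (c *\<^sub>R x) (d *\<^sub>R x)"
  by (cases "x = 0"; cases "c = d") (auto simp: le_loss_def f_scaleR)

lemma f_vee: "f (vee f x y) = max (f x) (f y)"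
  by (auto simp: vee_def)

lemma vee_eq_iff_le_loss: "vee f x y = y \<longleftrightarrow> le_loss f x y"
  by (auto simp: vee_def le_loss_def)

lemma vee_0 [simp]: "vee f x 0 = x"
  by (auto simp: vee_def)

lemma vee_measurable [measurable]:
  assumes [measurable]: "X \<in> borel_measurable N" "Y \<in> borel_measurable N"
  shows "(\<lambda>\<omega>. vee f (X \<omega>) (Y \<omega>)) \<in> borel_measurable N"
  unfolding vee_def by measurable

text \<open>A common upper bound whose loss is that of \<open>x\<close> or \<open>y\<close> coincides with this vector; at a tie it
  coincides with both, so the asymmetric rule of \<open>vee f\<close> makes no difference.\<close>

lemma vee_eqI:
  assumes "le_loss f x w" "le_loss f y w" "f w \<le> max (f x) (f y)"
  shows "vee f x y = w"
  using assms by (auto simp: vee_def le_loss_def max_def split: if_splits)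

lemma vee_commute_if_bounded:
  assumes "le_loss f x w" "le_loss f y w" "f w \<le> max (f x) (f y)"
  shows "vee f x y = vee f y x"
  using vee_eqI[OF assms] vee_eqI[of y w x] assms by (simp add: max.commute)

lemma same_dir_scaleR: "0 \<le> c \<Longrightarrow> same_dir f (c *\<^sub>R x) x" "0 \<le> c \<Longrightarrow> 0 \<le> d \<Longrightarrow> same_dir f (c *\<^sub>R x) (d *\<^sub>R x)"
  by (auto simp: same_dir_def f_scaleR)

lemma same_dir_sym: "same_dir f x y \<longleftrightarrow> same_dir f y x"
  by (auto simp: same_dir_def)

lemma same_dir_eq: "same_dir f x y \<Longrightarrow> f x = f y \<Longrightarrow> x = y"
  using f_eq_0_iff[of x] f_eq_0_iff[of y] by (cases "f y = 0") (auto simp: same_dir_def)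

text \<open>Vectors on a common ray are determined by their losses, so convergence of the losses forces
  convergence of the vectors once the direction has stopped changing.\<close>

lemma same_dir_norm_diff_le:
  assumes "same_dir f x y" and K: "\<And>x. norm x \<le> K * f x"
  shows "norm (x - y) \<le> K * \<bar>f x - f y\<bar>"
proof (cases "y = 0")
  case True
  then show ?thesis using K[of x] by simp
next
  case False
  then have y: "0 < f y" by simp
  have "x = (f x / f y) *\<^sub>R y"
    using assms(1) y by (simp add: same_dir_def) (metis divide_inverse_commute f_eq_0_iff left_inverse scaleR_one scaleR_scaleR)
  then have "x - y = ((f x - f y) / f y) *\<^sub>R y"
    using y by (metis diff_divide_distrib divide_self f_eq_0_iff False scaleR_left_diff_distrib scaleR_one)
  then have "norm (x - y) = \<bar>f x - f y\<bar> / f y * norm y"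
    using y by simp
  also have "\<dots> \<le> \<bar>f x - f y\<bar> / f y * (K * f y)"
    using y by (intro mult_left_mono K) auto
  finally show ?thesis using y False by (simp add: mult.commute)
qed

lemma same_dir_measurable [measurable]:
  assumes [measurable]: "X \<in> borel_measurable N" "Y \<in> borel_measurable N"
  shows "Measurable.pred N (\<lambda>\<omega>. same_dir f (X \<omega>) (Y \<omega>))"
  unfolding same_dir_def by measurable

end

section \<open>Frechet laws\<close>

text \<open>A standard exponential variable raised to the power \<open>- 1 / \<alpha>\<close> is standard Frechet. In the
  exponential coordinate the scale becomes a rate, and maxima become minima of independent
  exponentials, for which the integrals are elementary.\<close>

lemma frechet_eq_distr_exponential:
  assumes "0 < \<alpha>"
  shows "frechet \<alpha> 1 = distr (density lborel (exponential_density 1)) borel (\<lambda>u. u powr (- 1 / \<alpha>))"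
proof -
  let ?E = "density lborel (exponential_density 1)"
  let ?D = "distr ?E borel (\<lambda>u. u powr (- 1 / \<alpha>))"
  interpret E: prob_space ?E
    by (rule prob_space_exponential_density) simp
  have meas [measurable]: "(\<lambda>u::real. u powr (- 1 / \<alpha>)) \<in> borel_measurable lborel"
    by measurable
  have meas' [measurable]: "(\<lambda>u::real. u powr (- 1 / \<alpha>)) \<in> borel_measurable ?E"
    by simp
  have dist: "distributed ?E lborel (\<lambda>u. u) (exponential_density 1)"
    unfolding distributed_def by (simp add: distr_id2)
  have rd: "real_distribution ?D"
    using E.prob_space_distr[OF meas'] by (auto simp: real_distribution_def real_distribution_axioms_def)
  have "cdf ?D x = frechet_cdf \<alpha> 1 x" for x
  proof -
    have ae: "AE u in ?E. 0 < u"
    proof -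
      have "AE u in lborel. u \<noteq> (0::real)"
        by (rule AE_lborel_singleton)
      then show ?thesis
        by (subst AE_density) (auto simp: exponential_density_def elim: AE_mp)
    qed
    have "cdf ?D x = measure ?E {u. u powr (- 1 / \<alpha>) \<le> x}"
      by (simp add: cdf_def measure_distr vimage_def)
    also have "\<dots> = frechet_cdf \<alpha> 1 x"
    proof (cases "0 < x")
      case True
      have *: "u powr (- 1 / \<alpha>) \<le> x \<longleftrightarrow> x powr (- \<alpha>) \<le> u" if "0 < u" for u
      proof -
        have "u powr (- 1 / \<alpha>) \<le> x \<longleftrightarrow> ln (u powr (- 1 / \<alpha>)) \<le> ln x"
          using that True by (intro ln_le_cancel_iff[symmetric]) auto
        also have "\<dots> \<longleftrightarrow> ln (x powr (- \<alpha>)) \<le> ln u"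
          using that True assms by (auto simp add: ln_powr field_simps)
        also have "\<dots> \<longleftrightarrow> x powr (- \<alpha>) \<le> u"
          using that True by (intro ln_le_cancel_iff) auto
        finally show ?thesis .
      qed
      have "measure ?E {u. u powr (- 1 / \<alpha>) \<le> x} = measure ?E {u. x powr (- \<alpha>) < u}"
      proof (rule measure_eq_AE)
        have "AE u in lborel. u \<noteq> x powr (- \<alpha>)"
          by (rule AE_lborel_singleton)
        then have "AE u in ?E. u \<noteq> x powr (- \<alpha>)"
          by (subst AE_density) (auto elim: AE_mp)
        with ae show "AE u in ?E. (u \<in> {u. u powr (- 1 / \<alpha>) \<le> x}) = (u \<in> {u. x powr (- \<alpha>) < u})"
          by eventually_elim (use * in force)
      qed auto
      also have "\<dots> = exp (- (x powr (- \<alpha>)) * 1)"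
        using E.exponential_distributedD_gt[OF dist, of "x powr (- \<alpha>)"] by simp
      finally show ?thesis using True by (simp add: frechet_cdf_def)
    next
      case False
      have "measure ?E {u. u powr (- 1 / \<alpha>) \<le> x} = measure ?E {}"
      proof (rule measure_eq_AE)
        show "AE u in ?E. (u \<in> {u. u powr (- 1 / \<alpha>) \<le> x}) = (u \<in> {})"
          using ae
        proof eventually_elim
          case (elim u)
          then have "0 < u powr (- 1 / \<alpha>)" by simp
          with False have "\<not> u powr (- 1 / \<alpha>) \<le> x" by linarith
          then show ?case by simp
        qed
      qed auto
      then show ?thesis using False by (simp add: frechet_cdf_def)
    qed
    finally show ?thesis .
  qed
  then have "cdf ?D = cdf (frechet \<alpha> 1)"
    using cdf_frechet[OF assms, of 1] by auto
  with rd real_distribution_frechet[OF assms, of 1] show ?thesis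
    by (intro cdf_unique[symmetric]) auto
qed

locale loss_angular = loss f + ang: prob_space \<kappa>
  for f :: "real ^ 'n \<Rightarrow> real" and \<kappa> :: "(real ^ 'n) measure" +
  fixes \<alpha> :: real
  assumes alpha_pos: "0 < \<alpha>"
    and sets_angular: "sets \<kappa> = sets (restrict_space borel (unit_level f))"
begin

text \<open>The law parametrised by the \<open>\<alpha>\<close>-th power of its scale: this is the parameter that adds up
  under joins of independent vectors.\<close>

abbreviation Phi :: "real \<Rightarrow> (real ^ 'n) measure" where
  "Phi s \<equiv> implicit_frechet \<alpha> \<kappa> (s powr (1 / \<alpha>))"

lemma space_angular: "space \<kappa> = unit_level f"
  using sets_eq_imp_space_eq[OF sets_angular] by (simp add: space_restrict_space)

lemma ident_measurable_angular [measurable]: "(\<lambda>x. x) \<in> measurable \<kappa> borel"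
  using measurable_ident_sets[OF sets_angular] by (rule measurable_compose) (simp add: measurable_restrict_space1)

lemma sets_frechet [measurable_cong, simp]: "sets (frechet \<alpha> \<sigma>) = sets borel"
  by (simp add: frechet_def)

lemma prob_space_frechet: "prob_space (frechet \<alpha> 1)"
  using real_distribution_frechet[OF alpha_pos, of 1] by (simp add: real_distribution_def)

lemma scale_measurable [measurable]:
  "(\<lambda>(z, \<theta>). (\<sigma> * z) *\<^sub>R \<theta>) \<in> borel_measurable (frechet \<alpha> 1 \<Otimes>\<^sub>M \<kappa>)"
  by measurable

lemma sets_Phi [measurable_cong, simp]: "sets (implicit_frechet \<alpha> \<kappa> \<sigma>) = sets borel"
  and space_Phi [simp]: "space (implicit_frechet \<alpha> \<kappa> \<sigma>) = UNIV"
  by (simp_all add: implicit_frechet_def)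

lemma prob_space_Phi: "prob_space (implicit_frechet \<alpha> \<kappa> \<sigma>)"
proof -
  interpret F: prob_space "frechet \<alpha> 1" by (rule prob_space_frechet)
  interpret FA: pair_prob_space "frechet \<alpha> 1" \<kappa> ..
  show ?thesis unfolding implicit_frechet_def
    by (intro FA.prob_space_distr scale_measurable)
qed

lemma Phi_0: "implicit_frechet \<alpha> \<kappa> 0 = return borel 0"
proof -
  interpret F: prob_space "frechet \<alpha> 1" by (rule prob_space_frechet)
  interpret FA: pair_prob_space "frechet \<alpha> 1" \<kappa> ..
  have "implicit_frechet \<alpha> \<kappa> 0 = distr (frechet \<alpha> 1 \<Otimes>\<^sub>M \<kappa>) borel (\<lambda>_. 0)"
    unfolding implicit_frechet_def by (intro distr_cong) auto
  also have "\<dots> = return borel 0"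
    by (intro FA.distr_const) auto
  finally show ?thesis .
qed

lemma angular_nn_integral_measurable [measurable]:
  assumes [measurable]: "\<phi> \<in> borel_measurable borel"
  shows "(\<lambda>u::real. \<integral>\<^sup>+\<theta>. \<phi> (u powr (- 1 / \<alpha>) *\<^sub>R \<theta>) \<partial>\<kappa>) \<in> borel_measurable borel"
  by measurable

text \<open>Polar coordinates: under \<open>Phi s\<close> the radius is \<open>u powr (- 1 / \<alpha>)\<close> with \<open>u\<close> exponential of
  rate \<open>s\<close>, independent of the direction \<open>\<theta>\<close>. The scale appears only in the density of \<open>u\<close>.\<close>

lemma nn_integral_Phi:
  assumes s: "0 < s" and [measurable]: "\<phi> \<in> borel_measurable borel"
  shows "(\<integral>\<^sup>+x. \<phi> x \<partial>Phi s) =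
    (\<integral>\<^sup>+u. indicator {0<..} u * ennreal (s * exp (- (s * u))) * (\<integral>\<^sup>+\<theta>. \<phi> (u powr (- 1 / \<alpha>) *\<^sub>R \<theta>) \<partial>\<kappa>) \<partial>lborel)"
proof -
  interpret F: prob_space "frechet \<alpha> 1" by (rule prob_space_frechet)
  interpret FA: pair_prob_space "frechet \<alpha> 1" \<kappa> ..
  let ?\<sigma> = "s powr (1 / \<alpha>)"
  have "(\<integral>\<^sup>+x. \<phi> x \<partial>Phi s) = (\<integral>\<^sup>+z. \<integral>\<^sup>+\<theta>. \<phi> ((?\<sigma> * z) *\<^sub>R \<theta>) \<partial>\<kappa> \<partial>frechet \<alpha> 1)"
    unfolding implicit_frechet_def
    by (simp add: nn_integral_distr case_prod_beta' ang.nn_integral_fst[symmetric])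
  also have "\<dots> = (\<integral>\<^sup>+u. ennreal (exponential_density 1 u) * (\<integral>\<^sup>+\<theta>. \<phi> ((?\<sigma> * u powr (- 1 / \<alpha>)) *\<^sub>R \<theta>) \<partial>\<kappa>) \<partial>lborel)"
    unfolding frechet_eq_distr_exponential[OF alpha_pos]
    by (subst nn_integral_distr) (simp_all add: nn_integral_density)
  also have "\<dots> = s * (\<integral>\<^sup>+u. ennreal (exponential_density 1 (s * u)) * (\<integral>\<^sup>+\<theta>. \<phi> ((?\<sigma> * (s * u) powr (- 1 / \<alpha>)) *\<^sub>R \<theta>) \<partial>\<kappa>) \<partial>lborel)"
    using s by (subst nn_integral_real_affine[where c = s and t = 0]) auto
  also have "\<dots> = (\<integral>\<^sup>+u. ennreal s * (ennreal (exponential_density 1 (s * u)) * (\<integral>\<^sup>+\<theta>. \<phi> ((?\<sigma> * (s * u) powr (- 1 / \<alpha>)) *\<^sub>R \<theta>) \<partial>\<kappa>)) \<partial>lborel)"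
    by (rule nn_integral_cmult[symmetric]) measurable
  also have "\<dots> = (\<integral>\<^sup>+u. indicator {0<..} u * ennreal (s * exp (- (s * u))) * (\<integral>\<^sup>+\<theta>. \<phi> (u powr (- 1 / \<alpha>) *\<^sub>R \<theta>) \<partial>\<kappa>) \<partial>lborel)"
  proof (rule nn_integral_cong_AE)
    have "AE u in lborel. u \<noteq> (0::real)"
      by (rule AE_lborel_singleton)
    then show "AE u in lborel. ennreal s * (ennreal (exponential_density 1 (s * u)) * (\<integral>\<^sup>+\<theta>. \<phi> ((?\<sigma> * (s * u) powr (- 1 / \<alpha>)) *\<^sub>R \<theta>) \<partial>\<kappa>))
      = indicator {0<..} u * ennreal (s * exp (- (s * u))) * (\<integral>\<^sup>+\<theta>. \<phi> (u powr (- 1 / \<alpha>) *\<^sub>R \<theta>) \<partial>\<kappa>)"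
    proof eventually_elim
      case (elim u)
      show ?case
      proof (cases "0 < u")
        case True
        have "?\<sigma> * (s * u) powr (- 1 / \<alpha>) = (s powr (1 / \<alpha>) * s powr (- 1 / \<alpha>)) * u powr (- 1 / \<alpha>)"
          using True s by (simp add: powr_mult)
        also have "s powr (1 / \<alpha>) * s powr (- 1 / \<alpha>) = 1"
          using s by (simp add: powr_add[symmetric])
        finally have "?\<sigma> * (s * u) powr (- 1 / \<alpha>) = u powr (- 1 / \<alpha>)" by simp
        then show ?thesis
          using True s less_asym[OF mult_pos_pos[OF s True]]
          by (auto simp add: exponential_density_def ennreal_mult mult.assoc)
      next
        case False
        with elim have "s * u < 0" using s by (simp add: mult_pos_neg)
        with False show ?thesis by (simp add: exponential_density_def)
      qed
    qed
  qed
  finally show ?thesis .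
qed

end

section \<open>Limits of laws and of independent pairs\<close>

text \<open>The indicator of an open set is the increasing limit of truncated multiples of the distance to
  its complement, and the open sets form an intersection-stable generator.\<close>

lemma finite_measure_eqI_continuous:
  fixes \<mu> \<nu> :: "('a :: {metric_space, second_countable_topology}) measure"
  assumes "finite_measure \<mu>" "finite_measure \<nu>"
    and sets: "sets \<mu> = sets borel" "sets \<nu> = sets borel"
    and eq: "\<And>\<phi> :: 'a \<Rightarrow> real. continuous_on UNIV \<phi> \<Longrightarrow> (\<And>x. 0 \<le> \<phi> x) \<Longrightarrow> (\<And>x. \<phi> x \<le> 1) \<Longrightarrow>
      (\<integral>x. \<phi> x \<partial>\<mu>) = (\<integral>x. \<phi> x \<partial>\<nu>)"
  shows "\<mu> = \<nu>"
proof -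
  interpret \<mu>: finite_measure \<mu> by fact
  interpret \<nu>: finite_measure \<nu> by fact
  have sp: "space \<mu> = UNIV" "space \<nu> = UNIV"
    using sets[THEN sets_eq_imp_space_eq] by auto
  note [measurable_cong] = sets
  have tot: "measure \<mu> UNIV = measure \<nu> UNIV"
    using eq[of "\<lambda>_. 1"] by (simp add: sp)
  have op: "measure \<mu> U = measure \<nu> U" if U: "open U" for U
  proof (cases "U = UNIV")
    case False
    define \<phi> where "\<phi> k x = min 1 (real k * infdist x (- U))" for k x
    have lim: "(\<lambda>k. \<phi> k x) \<longlonglongrightarrow> indicator U x" for x
    proof (cases "x \<in> U")
      case True
      have "infdist x (- U) \<noteq> 0"
        using U False True in_closed_iff_infdist_zero[of "- U" x] by auto
      then have pos: "0 < infdist x (- U)"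
        using infdist_nonneg[of x "- U"] by linarith
      have "eventually (\<lambda>k. \<phi> k x = 1) sequentially"
        using eventually_ge_at_top[of "nat \<lceil>1 / infdist x (- U)\<rceil>"]
      proof eventually_elim
        case (elim k)
        then have "1 / infdist x (- U) \<le> real k" by linarith
        then show ?case using pos by (simp add: \<phi>_def field_simps)
      qed
      then show ?thesis using True by (simp add: tendsto_eventually)
    next
      case False
      then show ?thesis by (simp add: \<phi>_def)
    qed
    have cont: "continuous_on UNIV (\<phi> k)" for k
      unfolding \<phi>_def by (intro continuous_intros)
    then have [measurable]: "\<phi> k \<in> borel_measurable borel" for k
      by (rule borel_measurable_continuous_onI)
    have bnd: "0 \<le> \<phi> k x" "\<phi> k x \<le> 1" for k x
      by (auto simp: \<phi>_def infdist_nonneg)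
    have [measurable]: "U \<in> sets borel" using U by simp
    have "(\<lambda>k. \<integral>x. \<phi> k x \<partial>\<mu>) \<longlonglongrightarrow> (\<integral>x. indicator U x \<partial>\<mu>)"
      using bnd lim by (intro integral_dominated_convergence[where w = "\<lambda>_. 1"]) auto
    moreover have "(\<lambda>k. \<integral>x. \<phi> k x \<partial>\<nu>) \<longlonglongrightarrow> (\<integral>x. indicator U x \<partial>\<nu>)"
      using bnd lim by (intro integral_dominated_convergence[where w = "\<lambda>_. 1"]) auto
    moreover have "(\<integral>x. \<phi> k x \<partial>\<mu>) = (\<integral>x. \<phi> k x \<partial>\<nu>)" for k
      by (intro eq cont bnd)
    ultimately have "(\<integral>x. indicator U x \<partial>\<mu>) = (\<integral>x. indicator U x \<partial>\<nu> :: real)"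
      using LIMSEQ_unique by simp
    then show ?thesis by (simp add: sp)
  qed (simp add: tot)
  show ?thesis
  proof (rule measure_eqI_generator_eq[where E = "{S. open S}" and \<Omega> = UNIV and A = "\<lambda>_. UNIV"])
    show "Int_stable {S :: 'a set. open S}" by (auto simp: Int_stable_def)
    show "emeasure \<mu> X = emeasure \<nu> X" if "X \<in> {S. open S}" for X
      using op[of X] that by (simp add: \<mu>.emeasure_eq_measure \<nu>.emeasure_eq_measure)
    show "sets \<mu> = sigma_sets UNIV {S. open S}" "sets \<nu> = sigma_sets UNIV {S. open S}"
      by (simp_all add: sets borel_def)
    show "\<And>i. emeasure \<mu> UNIV \<noteq> \<infinity>" by simp
  qed auto
qed

lemma (in prob_space) distr_AE_limit_eqI:
  fixes X :: "'a \<Rightarrow> 'b :: {metric_space, second_countable_topology}"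
  assumes [measurable]: "\<And>n. X' n \<in> borel_measurable M" "X \<in> borel_measurable M"
    and lim: "AE \<omega> in M. (\<lambda>n. X' n \<omega>) \<longlonglongrightarrow> X \<omega>"
    and N: "prob_space N" "sets N = sets borel"
    and laws: "\<And>\<phi> :: 'b \<Rightarrow> real. continuous_on UNIV \<phi> \<Longrightarrow> (\<And>x. 0 \<le> \<phi> x) \<Longrightarrow> (\<And>x. \<phi> x \<le> 1) \<Longrightarrow>
      (\<lambda>n. \<integral>\<omega>. \<phi> (X' n \<omega>) \<partial>M) \<longlonglongrightarrow> (\<integral>x. \<phi> x \<partial>N)"
  shows "distr M borel X = N"
proof (rule finite_measure_eqI_continuous)
  fix \<phi> :: "'b \<Rightarrow> real" assume \<phi>: "continuous_on UNIV \<phi>" "\<And>x. 0 \<le> \<phi> x" "\<And>x. \<phi> x \<le> 1"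
  then have [measurable]: "\<phi> \<in> borel_measurable borel"
    by (intro borel_measurable_continuous_onI)
  have "(\<lambda>n. \<integral>\<omega>. \<phi> (X' n \<omega>) \<partial>M) \<longlonglongrightarrow> (\<integral>\<omega>. \<phi> (X \<omega>) \<partial>M)"
  proof (intro integral_dominated_convergence[where w = "\<lambda>_. 1"])
    show "AE \<omega> in M. (\<lambda>n. \<phi> (X' n \<omega>)) \<longlonglongrightarrow> \<phi> (X \<omega>)"
      using lim by eventually_elim (rule continuous_on_tendsto_compose[OF \<phi>(1)], auto)
  qed (use \<phi> in auto)
  with laws[OF \<phi>] have "(\<integral>\<omega>. \<phi> (X \<omega>) \<partial>M) = (\<integral>x. \<phi> x \<partial>N)"
    by (rule LIMSEQ_unique[rotated])
  then show "(\<integral>x. \<phi> x \<partial>distr M borel X) = (\<integral>x. \<phi> x \<partial>N)"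
    by (simp add: integral_distr)
qed (auto simp: N intro!: finite_measure_distr prob_space.finite_measure[OF N(1)])

text \<open>Independence is the identity between the joint law and the product of the marginals. Both sides
  pass to the limit against continuous test functions; for the product one works on two copies of
  the probability space, where the pair of sequences still converges almost everywhere.\<close>

lemma (in prob_space) indep_var_AE_limit:
  fixes X Y :: "'a \<Rightarrow> 'b :: {metric_space, second_countable_topology}"
  assumes ind: "\<And>n. indep_var borel (X' n) borel (Y' n)"
    and [measurable]: "X \<in> borel_measurable M" "Y \<in> borel_measurable M"
    and lim: "AE \<omega> in M. (\<lambda>n. X' n \<omega>) \<longlonglongrightarrow> X \<omega>" "AE \<omega> in M. (\<lambda>n. Y' n \<omega>) \<longlonglongrightarrow> Y \<omega>"
  shows "indep_var borel X borel Y"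
proof -
  have [measurable]: "X' n \<in> borel_measurable M" "Y' n \<in> borel_measurable M" for n
    using indep_var_rv1[OF ind] indep_var_rv2[OF ind] by auto
  let ?N = "distr M borel X \<Otimes>\<^sub>M distr M borel Y"
  interpret X: prob_space "distr M borel X" by (rule prob_space_distr) simp
  interpret Y: prob_space "distr M borel Y" by (rule prob_space_distr) simp
  interpret XY: pair_prob_space "distr M borel X" "distr M borel Y" ..
  interpret MM: pair_prob_space M M ..
  have Nd: "distr M borel U \<Otimes>\<^sub>M distr M borel V = distr (M \<Otimes>\<^sub>M M) (borel \<Otimes>\<^sub>M borel) (\<lambda>(x, y). (U x, V y))"
    if [measurable]: "U \<in> borel_measurable M" "V \<in> borel_measurable M" for U V :: "'a \<Rightarrow> 'b"
    by (intro pair_measure_distr prob_space_imp_sigma_finite prob_space_distr) auto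
  have eqd: "distr M borel (\<lambda>\<omega>. (X \<omega>, Y \<omega>)) = ?N"
  proof (rule distr_AE_limit_eqI[where X' = "\<lambda>n \<omega>. (X' n \<omega>, Y' n \<omega>)"])
    show "AE \<omega> in M. (\<lambda>n. (X' n \<omega>, Y' n \<omega>)) \<longlonglongrightarrow> (X \<omega>, Y \<omega>)"
      using lim by eventually_elim (rule tendsto_Pair)
    show "prob_space ?N" by (rule XY.prob_space_axioms)
    show "sets ?N = sets borel" by (metis borel_prod sets_distr sets_pair_measure_cong)
    fix \<phi> :: "'b \<times> 'b \<Rightarrow> real" assume \<phi>: "continuous_on UNIV \<phi>" "\<And>x. 0 \<le> \<phi> x" "\<And>x. \<phi> x \<le> 1"
    then have \<phi>m [measurable]: "\<phi> \<in> borel_measurable (borel \<Otimes>\<^sub>M borel)"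
      unfolding borel_prod by (intro borel_measurable_continuous_onI)
    have "(\<integral>\<omega>. \<phi> (X' n \<omega>, Y' n \<omega>) \<partial>M) = (\<integral>p. \<phi> (X' n (fst p), Y' n (snd p)) \<partial>(M \<Otimes>\<^sub>M M))" for n
    proof -
      have "(\<integral>\<omega>. \<phi> (X' n \<omega>, Y' n \<omega>) \<partial>M) = (\<integral>z. \<phi> z \<partial>distr M (borel \<Otimes>\<^sub>M borel) (\<lambda>\<omega>. (X' n \<omega>, Y' n \<omega>)))"
        by (subst integral_distr) auto
      also have "\<dots> = (\<integral>z. \<phi> z \<partial>(distr M borel (X' n) \<Otimes>\<^sub>M distr M borel (Y' n)))"
        using ind[of n] by (simp add: indep_var_distribution_eq)
      also have "\<dots> = (\<integral>p. \<phi> (X' n (fst p), Y' n (snd p)) \<partial>(M \<Otimes>\<^sub>M M))"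
        by (subst Nd) (auto simp: integral_distr case_prod_beta')
      finally show ?thesis .
    qed
    moreover have "(\<lambda>n. \<integral>p. \<phi> (X' n (fst p), Y' n (snd p)) \<partial>(M \<Otimes>\<^sub>M M)) \<longlonglongrightarrow> (\<integral>p. \<phi> (X (fst p), Y (snd p)) \<partial>(M \<Otimes>\<^sub>M M))"
    proof (intro integral_dominated_convergence[where w = "\<lambda>_. 1"])
      have "AE p in M \<Otimes>\<^sub>M M. Q (fst p)" "AE p in M \<Otimes>\<^sub>M M. Q (snd p)" if "AE x in M. Q x" for Q
      proof -
        from AE_E[OF that] obtain N where N: "{x \<in> space M. \<not> Q x} \<subseteq> N" "emeasure M N = 0" "N \<in> sets M"
          by auto
        show "AE p in M \<Otimes>\<^sub>M M. Q (fst p)"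
          using N by (intro AE_I[where N = "N \<times> space M"]) (auto simp: space_pair_measure emeasure_pair_measure_Times)
        show "AE p in M \<Otimes>\<^sub>M M. Q (snd p)"
          using N by (intro AE_I[where N = "space M \<times> N"]) (auto simp: space_pair_measure emeasure_pair_measure_Times)
      qed
      from this(1)[OF lim(1)] this(2)[OF lim(2)]
      have "AE p in M \<Otimes>\<^sub>M M. (\<lambda>n. X' n (fst p)) \<longlonglongrightarrow> X (fst p) \<and> (\<lambda>n. Y' n (snd p)) \<longlonglongrightarrow> Y (snd p)"
        by eventually_elim simp
      then show "AE p in M \<Otimes>\<^sub>M M. (\<lambda>n. \<phi> (X' n (fst p), Y' n (snd p))) \<longlonglongrightarrow> \<phi> (X (fst p), Y (snd p))"
        by eventually_elim (rule continuous_on_tendsto_compose[OF \<phi>(1)], auto intro: tendsto_Pair)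
      show "integrable (M \<Otimes>\<^sub>M M) (\<lambda>_. 1 :: real)" by simp
    qed (use \<phi> in auto)
    moreover have "(\<integral>p. \<phi> (X (fst p), Y (snd p)) \<partial>(M \<Otimes>\<^sub>M M)) = (\<integral>z. \<phi> z \<partial>?N)"
      by (subst Nd) (auto simp: integral_distr case_prod_beta')
    ultimately show "(\<lambda>n. \<integral>\<omega>. \<phi> (X' n \<omega>, Y' n \<omega>) \<partial>M) \<longlonglongrightarrow> (\<integral>x. \<phi> x \<partial>?N)"
      by simp
  qed (simp_all add: borel_prod[symmetric])
  then show ?thesis
    by (simp add: indep_var_distribution_eq borel_prod)
qed

lemma (in prob_space) indep_var_cong_AE:
  assumes ind: "indep_var S X T Y"
    and [measurable]: "X' \<in> measurable M S" "Y' \<in> measurable M T"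
    and AE: "AE \<omega> in M. X' \<omega> = X \<omega>" "AE \<omega> in M. Y' \<omega> = Y \<omega>"
  shows "indep_var S X' T Y'"
proof -
  have [measurable]: "X \<in> measurable M S" "Y \<in> measurable M T"
    using indep_var_rv1[OF ind] indep_var_rv2[OF ind] by auto
  have "distr M S X' = distr M S X" "distr M T Y' = distr M T Y"
    using AE by (auto intro!: distr_cong_AE)
  moreover have "distr M (S \<Otimes>\<^sub>M T) (\<lambda>\<omega>. (X' \<omega>, Y' \<omega>)) = distr M (S \<Otimes>\<^sub>M T) (\<lambda>\<omega>. (X \<omega>, Y \<omega>))"
    using AE by (intro distr_cong_AE) auto
  ultimately show ?thesis
    using ind by (simp add: indep_var_distribution_eq)
qed

text \<open>The open-set half of the portmanteau theorem, obtained from Fatou's lemma since membership in an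
  open set persists near the limit.\<close>

lemma (in prob_space) prob_liminf_open_le:
  fixes X :: "'a \<Rightarrow> 'b :: {metric_space, second_countable_topology}"
  assumes [measurable]: "\<And>n. X' n \<in> borel_measurable M" "X \<in> borel_measurable M"
    and lim: "AE \<omega> in M. (\<lambda>n. X' n \<omega>) \<longlonglongrightarrow> X \<omega>"
    and U: "open U"
    and le: "\<And>n. prob {\<omega> \<in> space M. X' n \<omega> \<in> U} \<le> p n" and p: "p \<longlonglongrightarrow> c"
  shows "prob {\<omega> \<in> space M. X \<omega> \<in> U} \<le> c"
proof -
  have [measurable]: "U \<in> sets borel" using U by simp
  have ind: "emeasure M {\<omega> \<in> space M. Z \<omega> \<in> U} = (\<integral>\<^sup>+\<omega>. indicator U (Z \<omega>) \<partial>M)"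
    if [measurable]: "Z \<in> borel_measurable M" for Z
  proof -
    have "(\<integral>\<^sup>+\<omega>. indicator U (Z \<omega>) \<partial>M) = (\<integral>\<^sup>+\<omega>. indicator {\<omega> \<in> space M. Z \<omega> \<in> U} \<omega> \<partial>M)"
      by (intro nn_integral_cong) (auto simp: indicator_def)
    then show ?thesis by simp
  qed
  have "emeasure M {\<omega> \<in> space M. X \<omega> \<in> U} = (\<integral>\<^sup>+\<omega>. indicator U (X \<omega>) \<partial>M)"
    by (rule ind) simp
  also have "\<dots> \<le> (\<integral>\<^sup>+\<omega>. liminf (\<lambda>n. indicator U (X' n \<omega>)) \<partial>M)"
  proof (rule nn_integral_mono_AE)
    show "AE \<omega> in M. (indicator U (X \<omega>) :: ennreal) \<le> liminf (\<lambda>n. indicator U (X' n \<omega>))"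
      using lim
    proof eventually_elim
      case (elim \<omega>)
      show ?case
      proof (cases "X \<omega> \<in> U")
        case True
        have "eventually (\<lambda>n. X' n \<omega> \<in> U) sequentially"
          using topological_tendstoD[OF elim U True] .
        then have "eventually (\<lambda>n. 1 \<le> (indicator U (X' n \<omega>) :: ennreal)) sequentially"
          by eventually_elim simp
        then show ?thesis using True by (simp add: Liminf_bounded)
      qed simp
    qed
  qed
  also have "\<dots> \<le> liminf (\<lambda>n. \<integral>\<^sup>+\<omega>. indicator U (X' n \<omega>) \<partial>M)"
    by (rule nn_integral_liminf) auto
  also have "\<dots> = liminf (\<lambda>n. emeasure M {\<omega> \<in> space M. X' n \<omega> \<in> U})"
    by (simp add: ind)
  also have "\<dots> \<le> liminf (\<lambda>n. ennreal (p n))"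
    using le by (intro Liminf_mono always_eventually allI) (simp add: emeasure_eq_measure ennreal_leI)
  also have "\<dots> = ennreal c"
    using p by (intro lim_imp_Liminf) auto
  finally have "ennreal (prob {\<omega> \<in> space M. X \<omega> \<in> U}) \<le> ennreal c"
    by (simp add: emeasure_eq_measure)
  moreover have "0 \<le> c"
    using le by (intro LIMSEQ_le_const[OF p]) (meson measure_nonneg order_trans)
  ultimately show ?thesis by (simp add: ennreal_le_iff)
qed

section \<open>Joins of independent implicit Frechet vectors\<close>

lemma nn_integral_exp_tail:
  assumes "0 \<le> c" "0 < d"
  shows "(\<integral>\<^sup>+u. indicator {a<..} u * ennreal (c * exp (- (d * u))) \<partial>lborel) = ennreal (c / d * exp (- (d * a)))"
proof -
  have "(\<integral>\<^sup>+u. indicator {a<..} u * ennreal (c * exp (- (d * u))) \<partial>lborel) =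
    (\<integral>\<^sup>+u. ennreal (c * exp (- (d * u))) * indicator {a..} u \<partial>lborel)"
  proof (rule nn_integral_cong_AE)
    have "AE u in lborel. u \<noteq> a" by (rule AE_lborel_singleton)
    then show "AE u in lborel. indicator {a<..} u * ennreal (c * exp (- (d * u))) = ennreal (c * exp (- (d * u))) * indicator {a..} u"
      by eventually_elim (auto simp: indicator_def)
  qed
  also have "\<dots> = 0 - (- (c / d) * exp (- (d * a)))"
  proof (rule nn_integral_FTC_atLeast)
    show "((\<lambda>u. - (c / d) * exp (- (d * u))) \<longlongrightarrow> 0) at_top"
      using assms(2) by real_asymp
    show "((\<lambda>u. - (c / d) * exp (- (d * u))) has_real_derivative c * exp (- (d * u))) (at u)" for u
      using assms(2) by (auto intro!: derivative_eq_intros)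
  qed (use assms in auto)
  finally show ?thesis by simp
qed

context loss_angular
begin

lemma f_angular: "\<theta> \<in> space \<kappa> \<Longrightarrow> f \<theta> = 1"
  by (simp add: space_angular unit_level_def)

lemma emeasure_Phi_f_le:
  assumes "0 \<le> s" "0 < r"
  shows "emeasure (Phi s) {x. f x \<le> r} = ennreal (exp (- (s * r powr (- \<alpha>))))"
proof (cases "s = 0")
  case True
  then show ?thesis using assms by (simp add: Phi_0)
next
  case False
  with assms have s: "0 < s" by simp
  have le: "u powr (- 1 / \<alpha>) \<le> r \<longleftrightarrow> r powr (- \<alpha>) \<le> u" if "0 < u" for u
  proof -
    have "u powr (- 1 / \<alpha>) \<le> r \<longleftrightarrow> ln (u powr (- 1 / \<alpha>)) \<le> ln r"
      using that assms by (intro ln_le_cancel_iff[symmetric]) auto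
    also have "\<dots> \<longleftrightarrow> ln (r powr (- \<alpha>)) \<le> ln u"
      using that assms alpha_pos by (auto simp add: ln_powr field_simps)
    also have "\<dots> \<longleftrightarrow> r powr (- \<alpha>) \<le> u"
      using that assms by (intro ln_le_cancel_iff) auto
    finally show ?thesis .
  qed
  have "emeasure (Phi s) {x. f x \<le> r} = (\<integral>\<^sup>+x. indicator {x. f x \<le> r} x \<partial>Phi s)"
    by simp
  also have "\<dots> = (\<integral>\<^sup>+u. indicator {0<..} u * ennreal (s * exp (- (s * u))) *
      (\<integral>\<^sup>+\<theta>. indicator {x. f x \<le> r} (u powr (- 1 / \<alpha>) *\<^sub>R \<theta>) \<partial>\<kappa>) \<partial>lborel)"
    by (rule nn_integral_Phi[OF s]) simp
  also have "\<dots> = (\<integral>\<^sup>+u. indicator {r powr (- \<alpha>)<..} u * ennreal (s * exp (- (s * u))) \<partial>lborel)"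
  proof (rule nn_integral_cong_AE)
    have "AE u in lborel. u \<noteq> r powr (- \<alpha>)" by (rule AE_lborel_singleton)
    then show "AE u in lborel. indicator {0<..} u * ennreal (s * exp (- (s * u))) *
      (\<integral>\<^sup>+\<theta>. indicator {x. f x \<le> r} (u powr (- 1 / \<alpha>) *\<^sub>R \<theta>) \<partial>\<kappa>)
      = indicator {r powr (- \<alpha>)<..} u * ennreal (s * exp (- (s * u)))"
    proof eventually_elim
      case (elim u)
      have "(\<integral>\<^sup>+\<theta>. indicator {x. f x \<le> r} (u powr (- 1 / \<alpha>) *\<^sub>R \<theta>) \<partial>\<kappa>) =
        (\<integral>\<^sup>+\<theta>. indicator {r powr (- \<alpha>)<..} u \<partial>\<kappa>)" if "0 < u"
        using le[OF that] elim by (intro nn_integral_cong) (auto simp: f_scaleR f_angular indicator_def)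
      then show ?case
        by (cases "0 < u") (auto simp: ang.emeasure_space_1 indicator_def dest: le_less_trans[OF powr_ge_zero])
    qed
  qed
  also have "\<dots> = ennreal (exp (- (s * r powr (- \<alpha>))))"
    using s by (subst nn_integral_exp_tail) auto
  finally show ?thesis .
qed

lemma AE_Phi_nonzero:
  assumes "0 < s"
  shows "AE x in Phi s. x \<noteq> 0"
proof -
  have "emeasure (Phi s) {0} = (\<integral>\<^sup>+x. indicator {0} x \<partial>Phi s)"
    by simp
  also have "\<dots> = (\<integral>\<^sup>+u. indicator {0<..} u * ennreal (s * exp (- (s * u))) *
      (\<integral>\<^sup>+\<theta>. indicator {0} (u powr (- 1 / \<alpha>) *\<^sub>R \<theta>) \<partial>\<kappa>) \<partial>lborel)"
    by (rule nn_integral_Phi[OF assms]) simp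
  also have "\<dots> = (\<integral>\<^sup>+u. 0 \<partial>(lborel :: real measure))"
  proof (rule nn_integral_cong)
    fix u :: real
    have "(\<integral>\<^sup>+\<theta>. indicator {0} (u powr (- 1 / \<alpha>) *\<^sub>R \<theta>) \<partial>\<kappa>) = (\<integral>\<^sup>+\<theta>. 0 \<partial>\<kappa>)" if "0 < u"
      using that f_angular[of 0] by (intro nn_integral_cong) (auto simp: indicator_def)
    then show "indicator {0<..} u * ennreal (s * exp (- (s * u))) *
      (\<integral>\<^sup>+\<theta>. indicator {0} (u powr (- 1 / \<alpha>) *\<^sub>R \<theta>) \<partial>\<kappa>) = 0"
      by (cases "0 < u") auto
  qed
  finally show ?thesis
    by (intro AE_I[where N = "{0}"]) auto
qed

text \<open>The probability of the unit ball of the loss already determines the scale.\<close>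

lemma Phi_inject:
  assumes "0 \<le> s" "0 \<le> t" "Phi s = Phi t"
  shows "s = t"
proof -
  have "emeasure (Phi s) {x. f x \<le> 1} = ennreal (exp (- s))"
    using emeasure_Phi_f_le[of s 1] assms(1) by simp
  moreover have "emeasure (Phi t) {x. f x \<le> 1} = ennreal (exp (- t))"
    using emeasure_Phi_f_le[of t 1] assms(2) by simp
  ultimately have "ennreal (exp (- s)) = ennreal (exp (- t))"
    unfolding assms(3) by simp
  then show ?thesis by simp
qed

end

locale loss_probability = loss_angular f \<kappa> \<alpha> + prob_space P
  for f :: "real ^ 'n \<Rightarrow> real" and \<kappa> :: "(real ^ 'n) measure" and \<alpha> :: real and P :: "'w measure"
begin

lemma has_law_measurable: "has_law P X N \<Longrightarrow> X \<in> borel_measurable P"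
  by (simp add: has_law_def)

lemma has_law_cong_AE:
  assumes "has_law P X N" "Y \<in> borel_measurable P" "AE \<omega> in P. Y \<omega> = X \<omega>"
  shows "has_law P Y N"
  using assms unfolding has_law_def by (auto intro!: distr_cong_AE)

lemma has_law_AE:
  assumes "has_law P X N" "AE x in N. Q x" "Measurable.pred borel Q"
  shows "AE \<omega> in P. Q (X \<omega>)"
  using assms unfolding has_law_def by (auto simp: AE_distr_iff)

lemma has_law_0_iff: "has_law P X (implicit_frechet \<alpha> \<kappa> 0) \<Longrightarrow> AE \<omega> in P. X \<omega> = 0"
  by (rule has_law_AE[where Q = "\<lambda>x. x = 0"]) (auto simp: Phi_0 AE_return)

lemma has_law_nonzero:
  assumes "has_law P X (Phi s)" "0 < s"
  shows "AE \<omega> in P. X \<omega> \<noteq> 0"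
  by (rule has_law_AE[OF assms(1) AE_Phi_nonzero[OF assms(2)]]) simp

lemma prob_f_le:
  assumes X: "has_law P X (Phi s)" and "0 \<le> s" "0 < r"
  shows "prob {\<omega> \<in> space P. f (X \<omega>) \<le> r} = exp (- (s * r powr (- \<alpha>)))"
proof -
  note [measurable] = has_law_measurable[OF X]
  have "emeasure P {\<omega> \<in> space P. f (X \<omega>) \<le> r} = emeasure (distr P borel X) {x. f x \<le> r}"
    by (subst emeasure_distr) (auto intro!: arg_cong[where f = "emeasure P"])
  also have "\<dots> = ennreal (exp (- (s * r powr (- \<alpha>))))"
    using X assms by (simp add: has_law_def emeasure_Phi_f_le)
  finally show ?thesis by (simp add: emeasure_eq_measure)
qed

text \<open>The bounded strictly decreasing function \<open>exp (- f x)\<close> has the same expectation under both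
  variables, so an almost sure inequality between the losses cannot be strict.\<close>

lemma AE_f_eq_if_le:
  assumes X: "has_law P X N" and Y: "has_law P Y N" and le: "AE \<omega> in P. f (X \<omega>) \<le> f (Y \<omega>)"
  shows "AE \<omega> in P. f (X \<omega>) = f (Y \<omega>)"
proof -
  note [measurable] = has_law_measurable[OF X] has_law_measurable[OF Y]
  let ?e = "\<lambda>x. exp (- f x)"
  have int: "integrable P (\<lambda>\<omega>. ?e (Z \<omega>))" if [measurable]: "Z \<in> borel_measurable P" for Z
    by (rule integrable_const_bound[where B = 1]) auto
  have "(\<integral>\<omega>. ?e (Z \<omega>) \<partial>P) = (\<integral>x. ?e x \<partial>N)" if "has_law P Z N" for Z
    using that integral_distr[of Z P borel ?e] by (auto simp: has_law_def)
  then have "(\<integral>\<omega>. ?e (X \<omega>) - ?e (Y \<omega>) \<partial>P) = 0"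
    using X Y by (simp add: int)
  moreover have "AE \<omega> in P. 0 \<le> ?e (X \<omega>) - ?e (Y \<omega>)"
    using le by eventually_elim simp
  ultimately have "AE \<omega> in P. ?e (X \<omega>) - ?e (Y \<omega>) = 0"
    by (subst (asm) integral_nonneg_eq_0_iff_AE) (auto simp: int)
  then show ?thesis by eventually_elim simp
qed

lemma has_law_AE_limit:
  assumes X': "\<And>n. has_law P (X' n) (Phi (s n))" and s: "s \<longlonglongrightarrow> t" "\<And>n. 0 \<le> s n"
    and [measurable]: "X \<in> borel_measurable P"
    and lim: "AE \<omega> in P. (\<lambda>n. X' n \<omega>) \<longlonglongrightarrow> X \<omega>"
  shows "has_law P X (Phi t)"
proof -
  note [measurable] = has_law_measurable[OF X']
  interpret F: prob_space "frechet \<alpha> 1" by (rule prob_space_frechet)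
  interpret FA: pair_prob_space "frechet \<alpha> 1" \<kappa> ..
  have \<sigma>: "(\<lambda>n. s n powr (1 / \<alpha>)) \<longlonglongrightarrow> t powr (1 / \<alpha>)"
    using s alpha_pos by (intro tendsto_powr') auto
  have "distr P borel X = Phi t"
  proof (rule distr_AE_limit_eqI[OF _ _ lim prob_space_Phi sets_Phi])
    fix \<phi> :: "real ^ 'n \<Rightarrow> real" assume \<phi>: "continuous_on UNIV \<phi>" "\<And>x. 0 \<le> \<phi> x" "\<And>x. \<phi> x \<le> 1"
    then have [measurable]: "\<phi> \<in> borel_measurable borel"
      by (intro borel_measurable_continuous_onI)
    have int: "(\<integral>x. \<phi> x \<partial>implicit_frechet \<alpha> \<kappa> \<sigma>) = (\<integral>p. \<phi> ((\<sigma> * fst p) *\<^sub>R snd p) \<partial>(frechet \<alpha> 1 \<Otimes>\<^sub>M \<kappa>))" for \<sigma>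
      unfolding implicit_frechet_def by (subst integral_distr) (auto simp: case_prod_beta')
    have "(\<integral>\<omega>. \<phi> (X' n \<omega>) \<partial>P) = (\<integral>x. \<phi> x \<partial>Phi (s n))" for n
      using X'[of n] integral_distr[of "X' n" P borel \<phi>] by (simp add: has_law_def)
    moreover have "(\<lambda>n. \<integral>x. \<phi> x \<partial>Phi (s n)) \<longlonglongrightarrow> (\<integral>x. \<phi> x \<partial>Phi t)"
      unfolding int
    proof (intro integral_dominated_convergence[where w = "\<lambda>_. 1"] AE_I2)
      fix p
      show "(\<lambda>n. \<phi> ((s n powr (1 / \<alpha>) * fst p) *\<^sub>R snd p)) \<longlonglongrightarrow> \<phi> ((t powr (1 / \<alpha>) * fst p) *\<^sub>R snd p)"
        by (rule continuous_on_tendsto_compose[OF \<phi>(1)]) (auto intro!: tendsto_intros \<sigma>)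
    qed (use \<phi> in auto)
    ultimately show "(\<lambda>n. \<integral>\<omega>. \<phi> (X' n \<omega>) \<partial>P) \<longlonglongrightarrow> (\<integral>x. \<phi> x \<partial>Phi t)"
      by simp
  qed simp_all
  then show ?thesis by (simp add: has_law_def)
qed

lemma has_law_scaleR:
  assumes X: "has_law P X (implicit_frechet \<alpha> \<kappa> \<sigma>)"
  shows "has_law P (\<lambda>\<omega>. c *\<^sub>R X \<omega>) (implicit_frechet \<alpha> \<kappa> (c * \<sigma>))"
proof -
  note [measurable] = has_law_measurable[OF X]
  have "distr P borel (\<lambda>\<omega>. c *\<^sub>R X \<omega>) = distr (distr P borel X) borel (\<lambda>x. c *\<^sub>R x)"
    by (subst distr_distr) (auto simp: comp_def)
  also have "\<dots> = implicit_frechet \<alpha> \<kappa> (c * \<sigma>)"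
    using X unfolding has_law_def implicit_frechet_def
    by (simp add: distr_distr comp_def case_prod_beta' mult.assoc)
  finally show ?thesis by (simp add: has_law_def)
qed

text \<open>Given that \<open>X\<close> has exponential coordinate \<open>u\<close>, the vector \<open>Y\<close> has the smaller loss with
  probability \<open>exp (- t * u)\<close>, independently of the direction of \<open>X\<close>.\<close>

lemma indep_joint_law:
  assumes ind: "indep_var borel X borel Y"
    and X: "has_law P X (Phi s)" and Y: "has_law P Y (Phi t)" and s: "0 < s" "0 \<le> t"
    and B [measurable]: "B \<in> sets borel"
  shows "emeasure P {\<omega> \<in> space P. X \<omega> \<in> B \<and> f (Y \<omega>) \<le> f (X \<omega>)} =
    (\<integral>\<^sup>+u. indicator {0<..} u * ennreal (s * exp (- ((s + t) * u))) *
       (\<integral>\<^sup>+\<theta>. indicator B (u powr (- 1 / \<alpha>) *\<^sub>R \<theta>) \<partial>\<kappa>) \<partial>lborel)"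
proof -
  note [measurable] = has_law_measurable[OF X] has_law_measurable[OF Y]
  interpret T: prob_space "Phi t" by (rule prob_space_Phi)
  have [measurable]: "{p. fst p \<in> B \<and> f (snd p) \<le> f (fst p)} \<in> sets (borel \<Otimes>\<^sub>M borel)"
  proof -
    have "{p \<in> space (borel \<Otimes>\<^sub>M borel). fst p \<in> B \<and> f (snd p) \<le> f (fst p)} \<in> sets (borel \<Otimes>\<^sub>M borel)"
      by measurable
    then show ?thesis by (simp add: space_pair_measure)
  qed
  have "emeasure P {\<omega> \<in> space P. X \<omega> \<in> B \<and> f (Y \<omega>) \<le> f (X \<omega>)} =
    emeasure (distr P (borel \<Otimes>\<^sub>M borel) (\<lambda>\<omega>. (X \<omega>, Y \<omega>))) {p. fst p \<in> B \<and> f (snd p) \<le> f (fst p)}"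
    by (subst emeasure_distr) (auto intro!: arg_cong[where f = "emeasure P"])
  also have "distr P (borel \<Otimes>\<^sub>M borel) (\<lambda>\<omega>. (X \<omega>, Y \<omega>)) = Phi s \<Otimes>\<^sub>M Phi t"
    using ind X Y by (simp add: indep_var_distribution_eq has_law_def)
  also have "emeasure (Phi s \<Otimes>\<^sub>M Phi t) {p. fst p \<in> B \<and> f (snd p) \<le> f (fst p)} =
    (\<integral>\<^sup>+x. indicator B x * emeasure (Phi t) {y. f y \<le> f x} \<partial>Phi s)"
    by (subst T.emeasure_pair_measure_alt)
       (auto intro!: nn_integral_cong simp: indicator_def vimage_def cong: sets_pair_measure_cong)
  also have "\<dots> = (\<integral>\<^sup>+u. indicator {0<..} u * ennreal (s * exp (- (s * u))) *
      (\<integral>\<^sup>+\<theta>. indicator B (u powr (- 1 / \<alpha>) *\<^sub>R \<theta>) * emeasure (Phi t) {y. f y \<le> f (u powr (- 1 / \<alpha>) *\<^sub>R \<theta>)} \<partial>\<kappa>) \<partial>lborel)"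
    by (rule nn_integral_Phi[OF s(1)]) measurable
  also have "\<dots> = (\<integral>\<^sup>+u. indicator {0<..} u * ennreal (s * exp (- ((s + t) * u))) *
       (\<integral>\<^sup>+\<theta>. indicator B (u powr (- 1 / \<alpha>) *\<^sub>R \<theta>) \<partial>\<kappa>) \<partial>lborel)"
  proof (rule nn_integral_cong)
    fix u :: real
    show "indicator {0<..} u * ennreal (s * exp (- (s * u))) *
      (\<integral>\<^sup>+\<theta>. indicator B (u powr (- 1 / \<alpha>) *\<^sub>R \<theta>) * emeasure (Phi t) {y. f y \<le> f (u powr (- 1 / \<alpha>) *\<^sub>R \<theta>)} \<partial>\<kappa>)
      = indicator {0<..} u * ennreal (s * exp (- ((s + t) * u))) *
       (\<integral>\<^sup>+\<theta>. indicator B (u powr (- 1 / \<alpha>) *\<^sub>R \<theta>) \<partial>\<kappa>)"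
    proof (cases "0 < u")
      case True
      have "(u powr (- 1 / \<alpha>)) powr (- \<alpha>) = u"
        using True alpha_pos by (simp add: powr_powr)
      then have "(\<integral>\<^sup>+\<theta>. indicator B (u powr (- 1 / \<alpha>) *\<^sub>R \<theta>) * emeasure (Phi t) {y. f y \<le> f (u powr (- 1 / \<alpha>) *\<^sub>R \<theta>)} \<partial>\<kappa>)
        = (\<integral>\<^sup>+\<theta>. indicator B (u powr (- 1 / \<alpha>) *\<^sub>R \<theta>) * ennreal (exp (- (t * u))) \<partial>\<kappa>)"
        using True s by (intro nn_integral_cong) (simp add: f_scaleR f_angular emeasure_Phi_f_le)
      also have "\<dots> = (\<integral>\<^sup>+\<theta>. indicator B (u powr (- 1 / \<alpha>) *\<^sub>R \<theta>) \<partial>\<kappa>) * ennreal (exp (- (t * u)))"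
        by (rule nn_integral_multc) measurable
      finally have inner: "(\<integral>\<^sup>+\<theta>. indicator B (u powr (- 1 / \<alpha>) *\<^sub>R \<theta>) * emeasure (Phi t) {y. f y \<le> f (u powr (- 1 / \<alpha>) *\<^sub>R \<theta>)} \<partial>\<kappa>)
        = (\<integral>\<^sup>+\<theta>. indicator B (u powr (- 1 / \<alpha>) *\<^sub>R \<theta>) \<partial>\<kappa>) * ennreal (exp (- (t * u)))" .
      have exp_split: "s * exp (- ((s + t) * u)) = s * exp (- (s * u)) * exp (- (t * u))"
        by (simp add: exp_add[symmetric] algebra_simps)
      have "ennreal (s * exp (- ((s + t) * u))) = ennreal (s * exp (- (s * u))) * ennreal (exp (- (t * u)))"
        unfolding exp_split using s by (intro ennreal_mult) auto
      then show ?thesis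
        by (simp only: inner mult_ac)
    qed simp
  qed
  finally show ?thesis .
qed

lemma indep_prob_f_le:
  assumes "indep_var borel X borel Y" "has_law P X (Phi s)" "has_law P Y (Phi t)" "0 < s" "0 \<le> t"
  shows "prob {\<omega> \<in> space P. f (Y \<omega>) \<le> f (X \<omega>)} = s / (s + t)"
proof -
  have "emeasure P {\<omega> \<in> space P. f (Y \<omega>) \<le> f (X \<omega>)} = ennreal (s / (s + t))"
    using indep_joint_law[OF assms, of UNIV] assms(4,5) nn_integral_exp_tail[of s "s + t" 0]
    by (simp add: ang.emeasure_space_1)
  then show ?thesis using assms(4,5) by (simp add: emeasure_eq_measure)
qed

lemma indep_var_sym:
  assumes "indep_var S X T Y"
  shows "indep_var T Y S X"
proof -
  have "prob (b \<inter> a) = prob b * prob a"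
    if "a \<in> sigma_sets (space P) {X -` A \<inter> space P |A. A \<in> sets S}"
      "b \<in> sigma_sets (space P) {Y -` A \<inter> space P |A. A \<in> sets T}" for a b
    using assms that unfolding indep_var_eq indep_sets2_eq by (simp add: Int_commute[of b a] mult.commute)
  then show ?thesis
    using assms unfolding indep_var_eq indep_sets2_eq by blast
qed

text \<open>For positive \<open>t\<close> the probabilities \<open>s / (s + t)\<close> and \<open>t / (s + t)\<close> of the two weak inequalities add up to one,
  which leaves no mass for equality.\<close>

lemma indep_no_ties:
  assumes ind: "indep_var borel X borel Y" and X: "has_law P X (Phi s)" and Y: "has_law P Y (Phi t)"
    and s: "0 < s" "0 \<le> t"
  shows "AE \<omega> in P. f (X \<omega>) \<noteq> f (Y \<omega>)"
proof (cases "t = 0")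
  case True
  with Y have "AE \<omega> in P. Y \<omega> = 0" using has_law_0_iff[of Y] by simp
  with has_law_nonzero[OF X s(1)] show ?thesis by eventually_elim auto
next
  case False
  with s have t: "0 < t" by simp
  note [measurable] = has_law_measurable[OF X] has_law_measurable[OF Y]
  let ?A = "{\<omega> \<in> space P. f (Y \<omega>) \<le> f (X \<omega>)}" and ?B = "{\<omega> \<in> space P. f (X \<omega>) \<le> f (Y \<omega>)}"
  have "prob ?A = s / (s + t)" "prob ?B = t / (t + s)"
    using indep_prob_f_le[OF ind X Y s] indep_prob_f_le[OF indep_var_sym[OF ind] Y X t] s by auto
  moreover have "s / (s + t) + t / (t + s) = 1"
    using s t by (simp add: add.commute[of t s] add_divide_distrib[symmetric])
  ultimately have "prob ?A + prob ?B = 1" by simp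
  moreover have "prob (?A \<union> ?B) = 1"
  proof -
    have "?A \<union> ?B = space P" by auto
    then show ?thesis by (simp add: prob_space)
  qed
  moreover have "prob (?A \<union> ?B) = prob ?A + prob ?B - prob (?A \<inter> ?B)"
    by (rule measure_Un3) (auto simp: fmeasurable_eq_sets)
  ultimately have "prob (?A \<inter> ?B) = 0" by simp
  then have "AE \<omega> in P. \<omega> \<notin> ?A \<inter> ?B"
    by (subst (asm) prob_eq_0) auto
  then show ?thesis using AE_space by eventually_elim auto
qed

lemma indep_prob_f_less:
  assumes ind: "indep_var borel X borel Y" and X: "has_law P X (Phi s)" and Y: "has_law P Y (Phi t)"
    and s: "0 < s" "0 \<le> t"
  shows "prob {\<omega> \<in> space P. f (Y \<omega>) < f (X \<omega>)} = s / (s + t)"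
proof -
  note [measurable] = has_law_measurable[OF X] has_law_measurable[OF Y]
  have "prob {\<omega> \<in> space P. f (Y \<omega>) < f (X \<omega>)} = prob {\<omega> \<in> space P. f (Y \<omega>) \<le> f (X \<omega>)}"
  proof (rule measure_eq_AE)
    show "AE \<omega> in P. (\<omega> \<in> {\<omega> \<in> space P. f (Y \<omega>) < f (X \<omega>)}) = (\<omega> \<in> {\<omega> \<in> space P. f (Y \<omega>) \<le> f (X \<omega>)})"
      using indep_no_ties[OF assms] by eventually_elim auto
  qed auto
  then show ?thesis using indep_prob_f_le[OF assms] by simp
qed

lemma indep_comparable:
  assumes ind: "indep_var borel X borel Y" and X: "has_law P X (Phi s)" and Y: "has_law P Y (Phi t)"
    and s: "0 \<le> s" "0 \<le> t"
  shows "AE \<omega> in P. le_loss f (X \<omega>) (Y \<omega>) \<or> le_loss f (Y \<omega>) (X \<omega>)"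
proof (cases "s = 0")
  case True
  then have "AE \<omega> in P. X \<omega> = 0" using X has_law_0_iff[of X] by simp
  then show ?thesis by eventually_elim auto
next
  case False
  with s have "0 < s" by simp
  from indep_no_ties[OF ind X Y this s(2)] show ?thesis
    by eventually_elim (auto simp: le_loss_def)
qed

text \<open>Up to a null set the join is \<open>X\<close> where \<open>X\<close> has the larger loss and \<open>Y\<close> elsewhere. The two
  contributions have densities proportional to \<open>s\<close> and \<open>t\<close>, with the same exponential factor and
  the same angular part, so they add up to the density for \<open>s + t\<close>.\<close>

lemma indep_vee_law:
  assumes ind: "indep_var borel X borel Y" and X: "has_law P X (Phi s)" and Y: "has_law P Y (Phi t)"
    and s: "0 \<le> s" "0 \<le> t"
  shows "has_law P (\<lambda>\<omega>. vee f (X \<omega>) (Y \<omega>)) (Phi (s + t))"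
proof -
  note [measurable] = has_law_measurable[OF X] has_law_measurable[OF Y]
  consider "s = 0" | "t = 0" | "0 < s" "0 < t" using s by linarith
  then show ?thesis
  proof cases
    case 1
    then have "AE \<omega> in P. X \<omega> = 0" using X has_law_0_iff[of X] by simp
    then have "AE \<omega> in P. vee f (X \<omega>) (Y \<omega>) = Y \<omega>"
      by eventually_elim (simp add: vee_eq_iff_le_loss)
    from has_law_cong_AE[OF Y _ this] 1 show ?thesis by simp
  next
    case 2
    then have "AE \<omega> in P. Y \<omega> = 0" using Y has_law_0_iff[of Y] by simp
    then have "AE \<omega> in P. vee f (X \<omega>) (Y \<omega>) = X \<omega>"
      by eventually_elim simp
    from has_law_cong_AE[OF X _ this] 2 show ?thesis by simp
  next
    case 3
    have "distr P borel (\<lambda>\<omega>. vee f (X \<omega>) (Y \<omega>)) = Phi (s + t)"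
    proof (rule measure_eqI)
      fix B assume "B \<in> sets (distr P borel (\<lambda>\<omega>. vee f (X \<omega>) (Y \<omega>)))"
      then have B [measurable]: "B \<in> sets borel" by simp
      let ?b = "\<lambda>u. \<integral>\<^sup>+\<theta>. indicator B (u powr (- 1 / \<alpha>) *\<^sub>R \<theta>) \<partial>\<kappa>"
      let ?S = "{\<omega> \<in> space P. X \<omega> \<in> B \<and> f (Y \<omega>) \<le> f (X \<omega>)}"
      let ?T = "{\<omega> \<in> space P. Y \<omega> \<in> B \<and> f (X \<omega>) \<le> f (Y \<omega>)}"
      have "emeasure (distr P borel (\<lambda>\<omega>. vee f (X \<omega>) (Y \<omega>))) B = emeasure P {\<omega> \<in> space P. vee f (X \<omega>) (Y \<omega>) \<in> B}"
        by (subst emeasure_distr) (auto intro!: arg_cong[where f = "emeasure P"])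
      also have "\<dots> = emeasure P (?S \<union> ?T)"
      proof (rule emeasure_eq_AE)
        show "AE \<omega> in P. (\<omega> \<in> {\<omega> \<in> space P. vee f (X \<omega>) (Y \<omega>) \<in> B}) = (\<omega> \<in> ?S \<union> ?T)"
          using indep_no_ties[OF ind X Y 3(1) s(2)] by eventually_elim (auto simp: vee_def)
      qed auto
      also have "\<dots> = emeasure P (?S \<union> (?T - ?S))"
        by simp
      also have "\<dots> = emeasure P ?S + emeasure P (?T - ?S)"
        by (rule plus_emeasure[symmetric]) auto
      also have "emeasure P (?T - ?S) = emeasure P ?T"
      proof (rule emeasure_eq_AE)
        show "AE \<omega> in P. (\<omega> \<in> ?T - ?S) = (\<omega> \<in> ?T)"
          using indep_no_ties[OF ind X Y 3(1) s(2)] by eventually_elim auto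
      qed auto
      also have "emeasure P ?S + emeasure P ?T = (\<integral>\<^sup>+u. indicator {0<..} u * ennreal (s * exp (- ((s + t) * u))) * ?b u +
          indicator {0<..} u * ennreal (t * exp (- ((t + s) * u))) * ?b u \<partial>lborel)"
        unfolding indep_joint_law[OF ind X Y 3(1) s(2) B] indep_joint_law[OF indep_var_sym[OF ind] Y X 3(2) s(1) B]
        by (rule nn_integral_add[symmetric]) measurable
      also have "\<dots> = (\<integral>\<^sup>+u. indicator {0<..} u * ennreal ((s + t) * exp (- ((s + t) * u))) * ?b u \<partial>lborel)"
      proof (rule nn_integral_cong)
        fix u :: real
        have "ennreal ((s + t) * exp (- ((s + t) * u))) =
          ennreal (s * exp (- ((s + t) * u))) + ennreal (t * exp (- ((t + s) * u)))"
          using 3 by (subst ennreal_plus[symmetric]) (auto simp: distrib_right add.commute)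
        then show "indicator {0<..} u * ennreal (s * exp (- ((s + t) * u))) * ?b u +
            indicator {0<..} u * ennreal (t * exp (- ((t + s) * u))) * ?b u =
          indicator {0<..} u * ennreal ((s + t) * exp (- ((s + t) * u))) * ?b u"
          by (simp only: distrib_left distrib_right)
      qed
      also have "\<dots> = emeasure (Phi (s + t)) B"
        using 3 nn_integral_Phi[of "s + t" "indicator B"] by simp
      finally show "emeasure (distr P borel (\<lambda>\<omega>. vee f (X \<omega>) (Y \<omega>))) B = emeasure (Phi (s + t)) B" .
    qed simp
    then show ?thesis by (simp add: has_law_def)
  qed
qed

end

section \<open>Sup-measures on finitely many disjoint sets\<close>

text \<open>Because \<open>vee f\<close> breaks ties by position, an iterated join depends on the order of its terms and on
  how a function is cut into pieces. A greatest element for \<open>le_loss f\<close> depends on neither, so simple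
  integrals are identified through this notion; it exists almost surely, since ties are null events.\<close>

definition greatest_in :: "(real ^ 'n \<Rightarrow> real) \<Rightarrow> (real ^ 'n) set \<Rightarrow> real ^ 'n \<Rightarrow> bool" where
  "greatest_in f S x \<longleftrightarrow> x \<in> S \<and> (\<forall>y\<in>S. le_loss f y x)"

context loss
begin

lemma greatest_in_unique: "greatest_in f S x \<Longrightarrow> greatest_in f S y \<Longrightarrow> x = y"
  by (auto simp: greatest_in_def intro: le_loss_antisym)

text \<open>This is how a coarse partition is compared with a finer one.\<close>

lemma greatest_in_cofinal:
  assumes "S \<subseteq> T" "\<And>y. y \<in> T \<Longrightarrow> \<exists>z\<in>S. le_loss f y z"
  shows "greatest_in f S x \<longleftrightarrow> greatest_in f T x"
proof
  assume "greatest_in f S x"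
  then show "greatest_in f T x"
    using assms unfolding greatest_in_def by (meson le_loss_trans subsetD)
next
  assume x: "greatest_in f T x"
  then obtain z where "z \<in> S" "le_loss f x z"
    using assms(2)[of x] by (auto simp: greatest_in_def)
  moreover from this have "x = z"
    using x assms(1) by (auto simp: greatest_in_def intro: le_loss_antisym)
  ultimately show "greatest_in f S x"
    using x assms(1) by (auto simp: greatest_in_def)
qed

lemma greatest_in_insert:
  assumes "greatest_in f S x" "le_loss f x y \<or> le_loss f y x"
  shows "greatest_in f (insert y S) (vee f x y)"
proof -
  have "le_loss f x (vee f x y)" "le_loss f y (vee f x y)"
    using assms(2) by (auto simp: vee_def le_loss_def)
  moreover have "vee f x y = x \<or> vee f x y = y"
    by (auto simp: vee_def)
  ultimately show ?thesis
    using assms(1) unfolding greatest_in_def by (metis insert_iff le_loss_trans)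
qed

lemma vee_upto_in: "vee_upto f x k \<in> x ` {..k}"
  by (induction k) (auto simp: vee_def image_iff intro: le_SucI)

lemma greatest_in_vee_upto:
  assumes "\<And>i j. i \<le> k \<Longrightarrow> j \<le> k \<Longrightarrow> i \<noteq> j \<Longrightarrow> le_loss f (x i) (x j) \<or> le_loss f (x j) (x i)"
  shows "greatest_in f (insert 0 (x ` {..k})) (vee_upto f x k)"
  using assms
proof (induction k)
  case 0
  then show ?case by (auto simp: greatest_in_def)
next
  case (Suc k)
  obtain j where j: "j \<le> k" "vee_upto f x k = x j"
    using vee_upto_in[of x k] by auto
  have "le_loss f (vee_upto f x k) (x (Suc k)) \<or> le_loss f (x (Suc k)) (vee_upto f x k)"
    using Suc.prems[of j "Suc k"] j by auto
  from greatest_in_insert[OF Suc.IH this] Suc.prems show ?case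
    by (simp add: atMost_Suc insert_commute)
qed

lemma vee_upto_measurable:
  assumes "\<And>j. j \<le> k \<Longrightarrow> X j \<in> borel_measurable N"
  shows "(\<lambda>\<omega>. vee_upto f (\<lambda>j. X j \<omega>) k) \<in> borel_measurable N"
  using assms by (induction k) auto

end

lemma vee_upto_cong: "(\<And>j. j \<le> k \<Longrightarrow> x j = y j) \<Longrightarrow> vee_upto f x k = vee_upto f y k"
  by (induction k) auto

locale sup_measure = loss_probability f \<kappa> \<alpha> P
  for f :: "real ^ 'n \<Rightarrow> real" and \<kappa> :: "(real ^ 'n) measure" and \<alpha> :: real and P :: "'w measure" +
  fixes m :: "'e measure" and M :: "'e set \<Rightarrow> 'w \<Rightarrow> real ^ 'n"
  assumes implicit_sup_measure: "implicit_sup_measure f \<alpha> \<kappa> m P M"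
begin

lemma M_measurable [measurable]: "A \<in> fmeasurable m \<Longrightarrow> M A \<in> borel_measurable P"
  and M_indep_vars: "disjoint_family_on (D :: nat \<Rightarrow> 'e set) {..<k} \<Longrightarrow> (\<And>j. j < k \<Longrightarrow> D j \<in> fmeasurable m) \<Longrightarrow>
    indep_vars (\<lambda>_. borel) (\<lambda>j. M (D j)) {..<k}"
  and M_law: "A \<in> fmeasurable m \<Longrightarrow> has_law P (M A) (Phi (measure m A))"
proof -
  note conj = implicit_sup_measure[unfolded implicit_sup_measure_def]
  show "A \<in> fmeasurable m \<Longrightarrow> M A \<in> borel_measurable P"
    using conj[THEN conjunct1] by simp
  show "disjoint_family_on D {..<k} \<Longrightarrow> (\<And>j. j < k \<Longrightarrow> D j \<in> fmeasurable m) \<Longrightarrow>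
    indep_vars (\<lambda>_. borel) (\<lambda>j. M (D j)) {..<k}"
    using conj[THEN conjunct2, THEN conjunct1] by simp
  show "A \<in> fmeasurable m \<Longrightarrow> has_law P (M A) (Phi (measure m A))"
    using conj[THEN conjunct2, THEN conjunct2, THEN conjunct2] by simp
qed

lemma M_countable_union:
  assumes "disjoint_family A" "\<And>j. A j \<in> fmeasurable m" "(\<Union>j. A j) \<in> fmeasurable m"
  shows "AE \<omega> in P. (\<lambda>k. vee_upto f (\<lambda>j. M (A j) \<omega>) k) \<longlonglongrightarrow> M (\<Union>j. A j) \<omega>"
proof -
  obtain j0 :: "'w \<Rightarrow> nat" where
    "AE \<omega> in P. (\<lambda>k. vee_upto f (\<lambda>j. M (A j) \<omega>) k) \<longlonglongrightarrow> M (\<Union>j. A j) \<omega> \<and>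
      M (\<Union>j. A j) \<omega> = M (A (j0 \<omega>)) \<omega>"
    using implicit_sup_measure[unfolded implicit_sup_measure_def, THEN conjunct2, THEN conjunct2, THEN conjunct1,
      rule_format, of A] assms by blast
  then show ?thesis by eventually_elim (rule conjunct1)
qed

lemma M_empty: "AE \<omega> in P. M {} \<omega> = 0"
  using M_law[of "{}"] by (intro has_law_0_iff) simp

text \<open>Pad the two sets with empty ones: as \<open>M {}\<close> vanishes almost surely, all later partial joins
  coincide with the join of the first two terms.\<close>

lemma M_Un:
  assumes AB: "A \<in> fmeasurable m" "B \<in> fmeasurable m" "A \<inter> B = {}"
  shows "AE \<omega> in P. M (A \<union> B) \<omega> = vee f (M A \<omega>) (M B \<omega>)"
proof -
  define C where "C j = (if j = 0 then A else if j = Suc 0 then B else {})" for j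
  have un: "(\<Union>j. C j) = A \<union> B"
    by (auto simp: C_def split: if_splits)
  have "disjoint_family C"
    using AB(3) by (auto simp: disjoint_family_on_def C_def)
  moreover have "C j \<in> fmeasurable m" for j
    using AB by (auto simp: C_def)
  ultimately have "AE \<omega> in P. (\<lambda>k. vee_upto f (\<lambda>j. M (C j) \<omega>) k) \<longlonglongrightarrow> M (A \<union> B) \<omega>"
    using M_countable_union[of C] AB un by (simp add: fmeasurable.Un)
  with M_empty show ?thesis
  proof eventually_elim
    case (elim \<omega>)
    have "vee_upto f (\<lambda>j. M (C j) \<omega>) (Suc k) = vee f (M A \<omega>) (M B \<omega>)" for k
      by (induction k) (use elim(1) in \<open>auto simp: C_def\<close>)
    then have "(\<lambda>k. vee_upto f (\<lambda>j. M (C j) \<omega>) (Suc k)) \<longlonglongrightarrow> vee f (M A \<omega>) (M B \<omega>)"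
      by simp
    with LIMSEQ_Suc[OF elim(2)] show ?case
      by (rule LIMSEQ_unique)
  qed
qed

text \<open>Each of the two joins is a function of its own block of the independent family \<open>M (D j)\<close>, because
  at every index at least one of the two weights is zero.\<close>

lemma indep_blocks:
  assumes D: "disjoint_family_on D {..k}" "\<And>j. j \<le> k \<Longrightarrow> D j \<in> fmeasurable m"
    and ab: "\<And>j. j \<le> k \<Longrightarrow> a j = 0 \<or> b j = 0"
  shows "indep_var borel (\<lambda>\<omega>. vee_upto f (\<lambda>j. a j *\<^sub>R M (D j) \<omega>) k)
    borel (\<lambda>\<omega>. vee_upto f (\<lambda>j. b j *\<^sub>R M (D j) \<omega>) k)"
proof -
  define J where "J = {j. j \<le> k \<and> a j \<noteq> 0}"
  define J' where "J' = {j. j \<le> k \<and> a j = 0}"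
  define G where "G K c = (\<lambda>y :: nat \<Rightarrow> real ^ 'n. vee_upto f (\<lambda>j. if j \<in> K then c j *\<^sub>R y j else 0) k)"
    for K :: "nat set" and c :: "nat \<Rightarrow> real"
  have "indep_vars (\<lambda>_. borel) (\<lambda>j. M (D j)) {..<Suc k}"
    using D by (intro M_indep_vars) (auto simp: lessThan_Suc_atMost)
  then have "indep_var (PiM J (\<lambda>_. borel)) (\<lambda>\<omega>. restrict (\<lambda>i. M (D i) \<omega>) J) (PiM J' (\<lambda>_. borel)) (\<lambda>\<omega>. restrict (\<lambda>i. M (D i) \<omega>) J')"
    by (rule indep_var_restrict) (auto simp: J_def J'_def)
  moreover have G: "G K c \<in> borel_measurable (PiM K (\<lambda>_. borel))" for K c
    unfolding G_def
  proof (rule vee_upto_measurable)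
    show "(\<lambda>y :: nat \<Rightarrow> real ^ 'n. if j \<in> K then c j *\<^sub>R y j else 0) \<in> borel_measurable (PiM K (\<lambda>_. borel))" for j
    proof (cases "j \<in> K")
      case True
      from measurable_component_singleton[OF this, of "\<lambda>_. borel"]
      have [measurable]: "(\<lambda>y :: nat \<Rightarrow> real ^ 'n. y j) \<in> borel_measurable (PiM K (\<lambda>_. borel))" .
      show ?thesis using True by simp
    qed simp
  qed
  ultimately have "indep_var borel (G J a \<circ> (\<lambda>\<omega>. restrict (\<lambda>i. M (D i) \<omega>) J)) borel (G J' b \<circ> (\<lambda>\<omega>. restrict (\<lambda>i. M (D i) \<omega>) J'))"
    by (intro indep_var_compose[OF _ G G])
  moreover have "G J a \<circ> (\<lambda>\<omega>. restrict (\<lambda>i. M (D i) \<omega>) J) = (\<lambda>\<omega>. vee_upto f (\<lambda>j. a j *\<^sub>R M (D j) \<omega>) k)"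
    unfolding G_def comp_def by (intro ext vee_upto_cong) (auto simp: J_def)
  moreover have "G J' b \<circ> (\<lambda>\<omega>. restrict (\<lambda>i. M (D i) \<omega>) J') = (\<lambda>\<omega>. vee_upto f (\<lambda>j. b j *\<^sub>R M (D j) \<omega>) k)"
    unfolding G_def comp_def using ab by (intro ext vee_upto_cong) (auto simp: J'_def)
  ultimately show ?thesis by simp
qed

lemma has_law_scaleR_Phi:
  assumes "has_law P X (Phi s)" "0 \<le> c" "0 \<le> s"
  shows "has_law P (\<lambda>\<omega>. c *\<^sub>R X \<omega>) (Phi (c powr \<alpha> * s))"
proof -
  have "(c powr \<alpha> * s) powr (1 / \<alpha>) = c * s powr (1 / \<alpha>)"
    using assms alpha_pos by (simp add: powr_mult powr_powr)
  then show ?thesis using has_law_scaleR[OF assms(1), of c] by simp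
qed

lemma M_comparable:
  assumes AB: "A \<in> fmeasurable m" "B \<in> fmeasurable m" "A \<inter> B = {}" and ab: "0 \<le> a" "0 \<le> b"
  shows "AE \<omega> in P. le_loss f (a *\<^sub>R M A \<omega>) (b *\<^sub>R M B \<omega>) \<or> le_loss f (b *\<^sub>R M B \<omega>) (a *\<^sub>R M A \<omega>)"
proof -
  have "indep_var borel (\<lambda>\<omega>. vee_upto f (\<lambda>j. (if j = 0 then a else 0) *\<^sub>R M (if j = 0 then A else B) \<omega>) (Suc 0))
    borel (\<lambda>\<omega>. vee_upto f (\<lambda>j. (if j = 0 then 0 else b) *\<^sub>R M (if j = 0 then A else B) \<omega>) (Suc 0))"
    using AB by (intro indep_blocks) (auto simp: disjoint_family_on_def le_Suc_eq)
  moreover have "vee f 0 x = x" for x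
    by (simp add: vee_eq_iff_le_loss)
  ultimately have "indep_var borel (\<lambda>\<omega>. a *\<^sub>R M A \<omega>) borel (\<lambda>\<omega>. b *\<^sub>R M B \<omega>)"
    by simp
  then show ?thesis
    using has_law_scaleR_Phi[OF M_law[OF AB(1)] ab(1)] has_law_scaleR_Phi[OF M_law[OF AB(2)] ab(2)]
    by (rule indep_comparable) auto
qed

lemma M_UN_greatest:
  assumes "finite T" "disjoint_family_on C T" "\<And>i. i \<in> T \<Longrightarrow> C i \<in> fmeasurable m"
  shows "AE \<omega> in P. greatest_in f (insert 0 ((\<lambda>i. M (C i) \<omega>) ` T)) (M (\<Union>i\<in>T. C i) \<omega>)"
  using assms
proof (induction T)
  case empty
  show ?case using M_empty by (simp add: greatest_in_def)
next
  case (insert i T)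
  let ?U = "\<Union>i\<in>T. C i"
  have dis: "?U \<inter> C i = {}"
    using insert.prems(1) insert.hyps by (auto simp: disjoint_family_on_def)
  have U: "?U \<in> fmeasurable m"
    using insert.prems(2) insert.hyps by (intro fmeasurable.finite_UN) auto
  have Ci: "C i \<in> fmeasurable m" using insert.prems by auto
  have "AE \<omega> in P. greatest_in f (insert 0 ((\<lambda>i. M (C i) \<omega>) ` T)) (M ?U \<omega>)"
    using insert.prems by (intro insert.IH) (auto simp: disjoint_family_on_def)
  with M_Un[OF U Ci dis] M_comparable[OF U Ci dis, of 1 1, simplified] show ?case
  proof eventually_elim
    case (elim \<omega>)
    then show ?case
      using greatest_in_insert[of _ "M ?U \<omega>" "M (C i) \<omega>"]
      by (simp add: Un_commute insert_commute[of 0])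
  qed
qed

section \<open>Simple functions and their integrals\<close>

lemma simple_repI:
  assumes "\<And>j. j \<le> k \<Longrightarrow> 0 \<le> a j" "\<And>j. j \<le> k \<Longrightarrow> A j \<in> fmeasurable m" "disjoint_family_on A {..k}"
    and "\<And>x j. x \<in> space m \<Longrightarrow> j \<le> k \<Longrightarrow> x \<in> A j \<Longrightarrow> g x = a j"
    and "\<And>x. x \<in> space m \<Longrightarrow> (\<And>j. j \<le> k \<Longrightarrow> x \<notin> A j) \<Longrightarrow> g x = 0"
  shows "simple_rep m g k a A"
  unfolding simple_rep_def
proof (intro conjI ballI allI impI)
  fix x assume x: "x \<in> space m"
  show "g x = (\<Sum>j\<le>k. a j * indicator (A j) x)"
  proof (cases "\<exists>j\<le>k. x \<in> A j")
    case True
    then obtain j where j: "j \<le> k" "x \<in> A j" by auto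
    then have "(\<Sum>j\<le>k. a j * indicator (A j) x) = a j"
      using assms(3) by (intro sum_indicator_disjoint_family) auto
    with assms(4)[OF x j] show ?thesis by simp
  next
    case False
    then have "(\<Sum>j\<le>k. a j * indicator (A j) x) = 0"
      by (intro sum.neutral) auto
    with assms(5)[OF x] False show ?thesis by auto
  qed
qed (use assms in auto)

lemma simple_repD:
  assumes "simple_rep m g k a A"
  shows "j \<le> k \<Longrightarrow> 0 \<le> a j" "j \<le> k \<Longrightarrow> A j \<in> fmeasurable m" "disjoint_family_on A {..k}"
    and "x \<in> space m \<Longrightarrow> j \<le> k \<Longrightarrow> x \<in> A j \<Longrightarrow> g x = a j"
    and "x \<in> space m \<Longrightarrow> (\<And>j. j \<le> k \<Longrightarrow> x \<notin> A j) \<Longrightarrow> g x = 0"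
proof -
  note r = assms[unfolded simple_rep_def]
  show "j \<le> k \<Longrightarrow> 0 \<le> a j" "j \<le> k \<Longrightarrow> A j \<in> fmeasurable m" "disjoint_family_on A {..k}"
    using r by auto
  show "g x = a j" if "x \<in> space m" "j \<le> k" "x \<in> A j"
    using r that sum_indicator_disjoint_family[of A "{..k}" x j a] by (simp add: simple_rep_def)
  show "g x = 0" if "x \<in> space m" "\<And>j. j \<le> k \<Longrightarrow> x \<notin> A j"
    using r that by (auto intro!: sum.neutral)
qed

lemma simple_rep_subset_space:
  assumes "simple_rep m g k a A" "j \<le> k" "x \<in> A j"
  shows "x \<in> space m"
  using sets.sets_into_space[OF fmeasurableD[OF simple_repD(2)[OF assms(1,2)]]] assms(3) by auto

text \<open>The nontrivial direction uses level sets. Applied to the pair of two functions, the same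
  construction represents both of them over one family of sets, the joint level sets.\<close>

lemma simple_fun_iff:
  "simple_fun m g \<longleftrightarrow> g \<in> borel_measurable m \<and> finite (g ` space m) \<and> (\<forall>x\<in>space m. 0 \<le> g x) \<and>
     {x \<in> space m. g x \<noteq> 0} \<in> fmeasurable m" (is "?L \<longleftrightarrow> ?R")
  and common_simple_rep:
  "simple_fun m g \<Longrightarrow> simple_fun m h \<Longrightarrow> \<exists>k a b A. simple_rep m g k a A \<and> simple_rep m h k b A"
proof -
  have conv: "\<exists>k a b A. simple_rep m g k a A \<and> simple_rep m h k b A"
    if g: "g \<in> borel_measurable m" "finite (g ` space m)" "\<forall>x\<in>space m. 0 \<le> g x" "{x \<in> space m. g x \<noteq> 0} \<in> fmeasurable m"
    and h: "h \<in> borel_measurable m" "finite (h ` space m)" "\<forall>x\<in>space m. 0 \<le> h x" "{x \<in> space m. h x \<noteq> 0} \<in> fmeasurable m"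
    for g h
  proof -
    note [measurable] = g(1) h(1)
    define V where "V = (\<lambda>x. (g x, h x)) ` space m - {(0, 0)}"
    have "V \<subseteq> g ` space m \<times> h ` space m" by (auto simp: V_def)
    then have "finite V" using g(2) h(2) by (auto intro: finite_subset)
    then obtain e where e: "bij_betw e {0..<card V} V"
      using ex_bij_betw_nat_finite by blast
    have eV: "e j \<in> V" if "j < card V" for j
      using e that by (auto simp: bij_betw_def)
    define A where "A j = (if j < card V then {x \<in> space m. g x = fst (e j) \<and> h x = snd (e j)} else {})" for j
    define a where "a j = (if j < card V then fst (e j) else 0)" for j
    define b where "b j = (if j < card V then snd (e j) else 0)" for j
    have pos: "0 \<le> a j" "0 \<le> b j" for j
      using g(3) h(3) eV[of j] by (auto simp: a_def b_def V_def)
    have fm: "A j \<in> fmeasurable m" for j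
    proof (cases "j < card V")
      case True
      have "A j \<subseteq> {x \<in> space m. g x \<noteq> 0} \<union> {x \<in> space m. h x \<noteq> 0}"
        using eV[OF True] True by (auto simp: A_def V_def prod_eq_iff)
      moreover have "A j \<in> sets m" using True unfolding A_def by simp
      ultimately show ?thesis
        using g(4) h(4) by (meson fmeasurableI2 fmeasurable.Un)
    qed (simp add: A_def)
    have dis: "disjoint_family_on A {..card V}"
    proof -
      have "i = j" if x: "x \<in> A i" "x \<in> A j" for i j x
      proof -
        have ij: "i < card V" "j < card V" using x by (auto simp: A_def split: if_splits)
        with x have "e i = e j" by (simp add: A_def prod_eq_iff)
        with ij show ?thesis
          using bij_betw_imp_inj_on[OF e] by (simp add: inj_on_eq_iff)
      qed
      then show ?thesis unfolding disjoint_family_on_def by blast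
    qed
    have cov: "g x = 0 \<and> h x = 0" if "x \<in> space m" "\<And>j. j \<le> card V \<Longrightarrow> x \<notin> A j" for x
    proof (rule ccontr)
      assume "\<not> (g x = 0 \<and> h x = 0)"
      with that(1) have "(g x, h x) \<in> V" by (auto simp: V_def)
      then have "(g x, h x) \<in> e ` {0..<card V}" using bij_betw_imp_surj_on[OF e] by simp
      then obtain j where "j < card V" "e j = (g x, h x)" by (elim imageE) simp
      with that(2)[of j] that(1) show False by (auto simp: A_def)
    qed
    have "simple_rep m g (card V) a A"
    proof (rule simple_repI[OF pos(1) fm dis])
      show "g x = a j" if "x \<in> A j" for x j
        using that by (auto simp: A_def a_def split: if_splits)
      show "g x = 0" if "x \<in> space m" "\<And>j. j \<le> card V \<Longrightarrow> x \<notin> A j" for x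
        using cov[OF that] by simp
    qed
    moreover have "simple_rep m h (card V) b A"
    proof (rule simple_repI[OF pos(2) fm dis])
      show "h x = b j" if "x \<in> A j" for x j
        using that by (auto simp: A_def b_def split: if_splits)
      show "h x = 0" if "x \<in> space m" "\<And>j. j \<le> card V \<Longrightarrow> x \<notin> A j" for x
        using cov[OF that] by simp
    qed
    ultimately show ?thesis by blast
  qed
  have sf: "g \<in> borel_measurable m \<and> finite (g ` space m) \<and> (\<forall>x\<in>space m. 0 \<le> g x) \<and>
     {x \<in> space m. g x \<noteq> 0} \<in> fmeasurable m" if "simple_fun m g" for g
  proof -
    from that obtain k a A where r: "simple_rep m g k a A" by (auto simp: simple_fun_def)
    note D = simple_repD[OF r]
    have "(\<lambda>x. \<Sum>j\<le>k. a j * indicator (A j) x) \<in> borel_measurable m"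
      using D(2) by (intro borel_measurable_sum borel_measurable_times borel_measurable_indicator) (auto simp: fmeasurable_def)
    moreover have "g x = (\<Sum>j\<le>k. a j * indicator (A j) x)" if "x \<in> space m" for x
      using r that by (simp add: simple_rep_def)
    ultimately have gm [measurable]: "g \<in> borel_measurable m"
      by (simp cong: measurable_cong)
    have val: "g x = 0 \<or> (\<exists>j\<le>k. x \<in> A j \<and> g x = a j)" if "x \<in> space m" for x
      using D(4,5)[OF that] by blast
    then have "g ` space m \<subseteq> insert 0 (a ` {..k})" by fastforce
    then have "finite (g ` space m)" by (rule finite_subset) simp
    moreover have "\<forall>x\<in>space m. 0 \<le> g x" using val D(1) by fastforce
    moreover have "{x \<in> space m. g x \<noteq> 0} \<in> fmeasurable m"
    proof (rule fmeasurableI2)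
      show "(\<Union>j\<le>k. A j) \<in> fmeasurable m" using D(2) by (intro fmeasurable.finite_UN) auto
      show "{x \<in> space m. g x \<noteq> 0} \<subseteq> (\<Union>j\<le>k. A j)" using D(5) by blast
    qed measurable
    ultimately show ?thesis using gm by simp
  qed
  show "?L \<longleftrightarrow> ?R"
  proof
    assume ?R
    then have "\<exists>k a b A. simple_rep m g k a A \<and> simple_rep m g k b A" by (intro conv) auto
    then show ?L by (auto simp: simple_fun_def)
  qed (rule sf)
  show "\<exists>k a b A. simple_rep m g k a A \<and> simple_rep m h k b A" if "simple_fun m g" "simple_fun m h"
    using sf[OF that(1)] sf[OF that(2)] by (intro conv) auto
qed

lemma simple_fun_nonneg: "simple_fun m g \<Longrightarrow> x \<in> space m \<Longrightarrow> 0 \<le> g x"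
  by (simp add: simple_fun_iff)

lemma simple_fun_measurable: "simple_fun m g \<Longrightarrow> g \<in> borel_measurable m"
  by (simp add: simple_fun_iff)

lemma simple_rep_combine:
  assumes "simple_rep m g k a A" "simple_rep m h k b A"
    and "\<phi> 0 0 = 0" "\<And>s t. 0 \<le> s \<Longrightarrow> 0 \<le> t \<Longrightarrow> 0 \<le> \<phi> s t"
  shows "simple_rep m (\<lambda>x. \<phi> (g x) (h x)) k (\<lambda>j. \<phi> (a j) (b j)) A"
  using simple_repD[OF assms(1)] simple_repD[OF assms(2)] assms(3,4)
  by (intro simple_repI) auto

lemma simple_fun_combine:
  assumes "simple_fun m g" "simple_fun m h"
    and "\<phi> 0 0 = 0" "\<And>s t. 0 \<le> s \<Longrightarrow> 0 \<le> t \<Longrightarrow> 0 \<le> \<phi> s t"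
  shows "simple_fun m (\<lambda>x. \<phi> (g x) (h x))"
  using common_simple_rep[OF assms(1,2)] simple_rep_combine[where \<phi> = \<phi>, OF _ _ assms(3,4)]
  unfolding simple_fun_def by blast

lemma simple_fun_max: "simple_fun m g \<Longrightarrow> simple_fun m h \<Longrightarrow> simple_fun m (\<lambda>x. max (g x) (h x))"
  by (rule simple_fun_combine) auto

lemma simple_fun_cmult: "simple_fun m g \<Longrightarrow> 0 \<le> c \<Longrightarrow> simple_fun m (\<lambda>x. c * g x)"
  by (rule simple_fun_combine[where \<phi> = "\<lambda>s t. c * s", of g g]) auto

lemma simple_rep_indicator: "A \<in> fmeasurable m \<Longrightarrow> 0 \<le> a \<Longrightarrow> simple_rep m (\<lambda>x. a * indicator A x) 0 (\<lambda>_. a) (\<lambda>_. A)"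
  by (intro simple_repI) (auto simp: disjoint_family_on_def)

lemma simple_fun_indicator: "A \<in> fmeasurable m \<Longrightarrow> 0 \<le> a \<Longrightarrow> simple_fun m (\<lambda>x. a * indicator A x)"
  using simple_rep_indicator unfolding simple_fun_def by blast

text \<open>On the pieces \<open>A i \<inter> B j\<close> of a set \<open>A i\<close> with positive weight, \<open>M (A i)\<close> is the greatest value. Hence
  the values over the \<open>A i\<close> are cofinal among the values over the pieces.\<close>

lemma AE_M_refine:
  assumes r: "simple_rep m g k a A" and r': "simple_rep m g l b B"
  shows "AE \<omega> in P. \<forall>x. greatest_in f (insert 0 ((\<lambda>i. a i *\<^sub>R M (A i) \<omega>) ` {..k})) x \<longleftrightarrow>
    greatest_in f (insert 0 ((\<lambda>(i, j). a i *\<^sub>R M (A i \<inter> B j) \<omega>) ` ({..k} \<times> {..l}))) x"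
proof -
  note D = simple_repD[OF r] and D' = simple_repD[OF r']
  have fm: "A i \<inter> B j \<in> fmeasurable m" if "i \<le> k" "j \<le> l" for i j
    using D(2) D'(2) that by (meson fmeasurable.Int)
  have "AE \<omega> in P. greatest_in f (insert 0 ((\<lambda>j. M (A i \<inter> B j) \<omega>) ` {..l})) (M (A i) \<omega>)"
    if i: "i \<le> k" "a i \<noteq> 0" for i
  proof -
    have "x \<in> (\<Union>j\<le>l. B j)" if "x \<in> A i" for x
      using D(4)[OF simple_rep_subset_space[OF r i(1) that] i(1) that] i(2)
        D'(5)[OF simple_rep_subset_space[OF r i(1) that]] by auto
    then have "(\<Union>j\<le>l. A i \<inter> B j) = A i" by auto
    moreover have "AE \<omega> in P. greatest_in f (insert 0 ((\<lambda>j. M (A i \<inter> B j) \<omega>) ` {..l})) (M (\<Union>j\<in>{..l}. A i \<inter> B j) \<omega>)"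
      using fm[OF i(1)] D'(3) by (intro M_UN_greatest) (auto simp: disjoint_family_on_def)
    ultimately show ?thesis by simp
  qed
  then have "AE \<omega> in P. a i \<noteq> 0 \<longrightarrow> greatest_in f (insert 0 ((\<lambda>j. M (A i \<inter> B j) \<omega>) ` {..l})) (M (A i) \<omega>)"
    if "i \<in> {..k}" for i
    using that by (cases "a i = 0") auto
  then have "AE \<omega> in P. \<forall>i\<in>{..k}. a i \<noteq> 0 \<longrightarrow> greatest_in f (insert 0 ((\<lambda>j. M (A i \<inter> B j) \<omega>) ` {..l})) (M (A i) \<omega>)"
    by (intro AE_finite_allI) auto
  then show ?thesis
  proof eventually_elim
    case (elim \<omega>)
    let ?S = "insert 0 ((\<lambda>i. a i *\<^sub>R M (A i) \<omega>) ` {..k})"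
    let ?T = "insert 0 ((\<lambda>(i, j). a i *\<^sub>R M (A i \<inter> B j) \<omega>) ` ({..k} \<times> {..l}))"
    have "?S \<subseteq> ?T"
    proof
      fix y assume "y \<in> ?S"
      then consider "y = 0" | i where "i \<le> k" "a i \<noteq> 0" "y = a i *\<^sub>R M (A i) \<omega>" by fastforce
      then show "y \<in> ?T"
      proof cases
        case (2 i)
        then have "M (A i) \<omega> \<in> insert 0 ((\<lambda>j. M (A i \<inter> B j) \<omega>) ` {..l})"
          using elim by (auto simp: greatest_in_def)
        then show ?thesis using 2 by force
      qed simp
    qed
    moreover have "\<exists>z\<in>?S. le_loss f y z" if y: "y \<in> ?T" for y
    proof -
      from y consider "y = 0" | i j where "i \<le> k" "j \<le> l" "a i \<noteq> 0" "y = a i *\<^sub>R M (A i \<inter> B j) \<omega>" by fastforce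
      then show ?thesis
      proof cases
        case (2 i j)
        then have "le_loss f (M (A i \<inter> B j) \<omega>) (M (A i) \<omega>)"
          using elim by (auto simp: greatest_in_def)
        then have "le_loss f y (a i *\<^sub>R M (A i) \<omega>)"
          using D(1)[of i] 2 by (simp add: le_loss_scaleR)
        then show ?thesis using 2 by auto
      qed auto
    qed
    ultimately show ?case using greatest_in_cofinal by blast
  qed
qed

abbreviation I0 :: "('e \<Rightarrow> real) \<Rightarrow> 'w \<Rightarrow> real ^ 'n" where
  "I0 \<equiv> simple_integral f m M"

lemma simple_integral_rep:
  assumes "simple_fun m g"
  obtains k a A where "simple_rep m g k a A" "I0 g = (\<lambda>\<omega>. vee_upto f (\<lambda>j. a j *\<^sub>R M (A j) \<omega>) k)"
proof -
  let ?P = "\<lambda>(k, a, A). simple_rep m g k a A"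
  obtain k a A where kaA: "(SOME p. ?P p) = (k, a, A)" by (metis prod_cases3)
  have "?P (SOME p. ?P p)"
    using assms unfolding simple_fun_def by (intro someI_ex[of ?P]) auto
  with kaA have "simple_rep m g k a A" by simp
  moreover have "I0 g = (\<lambda>\<omega>. vee_upto f (\<lambda>j. a j *\<^sub>R M (A j) \<omega>) k)"
    using kaA by (simp add: simple_integral_def)
  ultimately show ?thesis using that by blast
qed

lemma simple_integral_measurable [measurable]:
  assumes "simple_fun m g" shows "I0 g \<in> borel_measurable P"
proof -
  obtain k a A where r: "simple_rep m g k a A" "I0 g = (\<lambda>\<omega>. vee_upto f (\<lambda>j. a j *\<^sub>R M (A j) \<omega>) k)"
    using simple_integral_rep[OF assms] by blast
  show ?thesis
    unfolding r(2) using simple_repD(2)[OF r(1)] by (intro vee_upto_measurable) auto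
qed

lemma simple_integral_cong: "(\<And>x. x \<in> space m \<Longrightarrow> g x = h x) \<Longrightarrow> I0 g = I0 h"
  unfolding simple_integral_def simple_rep_def by (simp cong: ball_cong)

lemma AE_simple_rep_greatest:
  assumes r: "simple_rep m g k a A"
  shows "AE \<omega> in P. greatest_in f (insert 0 ((\<lambda>i. a i *\<^sub>R M (A i) \<omega>) ` {..k})) (vee_upto f (\<lambda>j. a j *\<^sub>R M (A j) \<omega>) k)"
proof -
  note D = simple_repD[OF r]
  have "AE \<omega> in P. i \<noteq> j \<longrightarrow> le_loss f (a i *\<^sub>R M (A i) \<omega>) (a j *\<^sub>R M (A j) \<omega>) \<or> le_loss f (a j *\<^sub>R M (A j) \<omega>) (a i *\<^sub>R M (A i) \<omega>)"
    if "i \<le> k" "j \<le> k" for i j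
  proof (cases "i = j")
    case False
    then have "A i \<inter> A j = {}" using D(3) that by (auto simp: disjoint_family_on_def)
    from M_comparable[OF D(2)[OF that(1)] D(2)[OF that(2)] this D(1)[OF that(1)] D(1)[OF that(2)]] show ?thesis
      by eventually_elim simp
  qed simp
  then have "AE \<omega> in P. \<forall>i\<in>{..k}. \<forall>j\<in>{..k}. i \<noteq> j \<longrightarrow> le_loss f (a i *\<^sub>R M (A i) \<omega>) (a j *\<^sub>R M (A j) \<omega>) \<or> le_loss f (a j *\<^sub>R M (A j) \<omega>) (a i *\<^sub>R M (A i) \<omega>)"
    by (intro AE_finite_allI) auto
  then show ?thesis
    by eventually_elim (rule greatest_in_vee_upto, auto)
qed

text \<open>Two representations of \<open>g\<close> have a common refinement, and on each nonempty piece of it their weights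
  agree. So both families of values have the same greatest element, and the representation chosen in
  the definition of the simple integral does not matter.\<close>

lemma AE_simple_integral_greatest:
  assumes r: "simple_rep m g k a A"
  shows "AE \<omega> in P. greatest_in f (insert 0 ((\<lambda>i. a i *\<^sub>R M (A i) \<omega>) ` {..k})) (I0 g \<omega>)"
proof -
  have "simple_fun m g" using r by (auto simp: simple_fun_def)
  then obtain l b B where r': "simple_rep m g l b B" and I: "I0 g = (\<lambda>\<omega>. vee_upto f (\<lambda>j. b j *\<^sub>R M (B j) \<omega>) l)"
    by (rule simple_integral_rep)
  show ?thesis
    using AE_simple_rep_greatest[OF r'] AE_M_refine[OF r r'] AE_M_refine[OF r' r] M_empty
  proof eventually_elim
    case (elim \<omega>)
    have eq: "a i *\<^sub>R M (A i \<inter> B j) \<omega> = b j *\<^sub>R M (B j \<inter> A i) \<omega>" if "i \<le> k" "j \<le> l" for i j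
    proof (cases "A i \<inter> B j = {}")
      case True
      then have "B j \<inter> A i = {}" by auto
      with True elim(4) show ?thesis by simp
    next
      case False
      then obtain x where x: "x \<in> A i" "x \<in> B j" by auto
      then have "x \<in> space m" using simple_rep_subset_space[OF r that(1)] by auto
      then have "a i = b j"
        using simple_repD(4)[OF r _ that(1) x(1)] simple_repD(4)[OF r' _ that(2) x(2)] by simp
      then show ?thesis by (simp add: Int_commute)
    qed
    have "(\<lambda>(i, j). a i *\<^sub>R M (A i \<inter> B j) \<omega>) ` ({..k} \<times> {..l}) = (\<lambda>(j, i). b j *\<^sub>R M (B j \<inter> A i) \<omega>) ` ({..l} \<times> {..k})"
      (is "?L = ?R")
    proof (intro equalityI subsetI)
      fix y assume "y \<in> ?L"
      then obtain i j where ij: "i \<le> k" "j \<le> l" "y = a i *\<^sub>R M (A i \<inter> B j) \<omega>" by auto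
      then show "y \<in> ?R" using eq[of i j] by (intro image_eqI[of _ _ "(j, i)"]) auto
    next
      fix y assume "y \<in> ?R"
      then obtain i j where ij: "i \<le> k" "j \<le> l" "y = b j *\<^sub>R M (B j \<inter> A i) \<omega>" by auto
      then show "y \<in> ?L" using eq[of i j] by (intro image_eqI[of _ _ "(i, j)"]) auto
    qed
    with elim show ?case by (simp add: I)
  qed
qed

lemma AE_simple_integral_vee_upto:
  assumes r: "simple_rep m g k a A"
  shows "AE \<omega> in P. I0 g \<omega> = vee_upto f (\<lambda>j. a j *\<^sub>R M (A j) \<omega>) k"
  using AE_simple_rep_greatest[OF r] AE_simple_integral_greatest[OF r]
  by eventually_elim (rule greatest_in_unique)

lemma simple_integral_indicator:
  assumes "A \<in> fmeasurable m" "0 \<le> a"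
  shows "AE \<omega> in P. I0 (\<lambda>x. a * indicator A x) \<omega> = a *\<^sub>R M A \<omega>"
  using AE_simple_integral_vee_upto[OF simple_rep_indicator[OF assms]] by simp

text \<open>Over a common family of sets the integral of the maximum dominates both integrals in the order
  \<open>le_loss f\<close>, and it is attained at a term that one of them dominates in turn.\<close>

lemma simple_integral_max:
  assumes "simple_fun m g" "simple_fun m h"
  shows "AE \<omega> in P. I0 (\<lambda>x. max (g x) (h x)) \<omega> = vee f (I0 g \<omega>) (I0 h \<omega>)"
proof -
  obtain k a b A where r: "simple_rep m g k a A" "simple_rep m h k b A"
    using common_simple_rep[OF assms] by blast
  have r': "simple_rep m (\<lambda>x. max (g x) (h x)) k (\<lambda>j. max (a j) (b j)) A"
    by (rule simple_rep_combine[OF r]) auto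
  show ?thesis
    using AE_simple_integral_greatest[OF r(1)] AE_simple_integral_greatest[OF r(2)] AE_simple_integral_greatest[OF r']
  proof eventually_elim
    case (elim \<omega>)
    let ?X = "I0 g \<omega>" and ?Y = "I0 h \<omega>" and ?W = "I0 (\<lambda>x. max (g x) (h x)) \<omega>"
    have up: "le_loss f (c *\<^sub>R M (A i) \<omega>) ?W" if "i \<le> k" "0 \<le> c" "c \<le> max (a i) (b i)" for i c
    proof -
      have "le_loss f (c *\<^sub>R M (A i) \<omega>) (max (a i) (b i) *\<^sub>R M (A i) \<omega>)"
        using that by (intro le_loss_scaleR_left) auto
      also have "le_loss f (max (a i) (b i) *\<^sub>R M (A i) \<omega>) ?W"
        using elim(3) that(1) by (auto simp: greatest_in_def)
      finally (le_loss_trans) show ?thesis .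
    qed
    have X: "le_loss f ?X ?W"
      using elim(1) up simple_repD(1)[OF r(1)] by (auto simp: greatest_in_def)
    have Y: "le_loss f ?Y ?W"
      using elim(2) up simple_repD(1)[OF r(2)] by (auto simp: greatest_in_def)
    have "f ?W \<le> max (f ?X) (f ?Y)"
    proof -
      have "?W \<in> insert 0 ((\<lambda>i. max (a i) (b i) *\<^sub>R M (A i) \<omega>) ` {..k})"
        using elim(3) by (simp add: greatest_in_def)
      then consider "?W = 0" | i where "i \<le> k" "?W = a i *\<^sub>R M (A i) \<omega>" | i where "i \<le> k" "?W = b i *\<^sub>R M (A i) \<omega>"
        by (auto simp: max_def split: if_splits)
      then show ?thesis
      proof cases
        case 1
        then show ?thesis by (simp add: le_max_iff_disj)
      next
        case (2 i)
        then have "le_loss f ?W ?X" using elim(1) by (auto simp: greatest_in_def)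
        then show ?thesis using le_loss_imp_le by (auto simp: le_max_iff_disj)
      next
        case (3 i)
        then have "le_loss f ?W ?Y" using elim(2) by (auto simp: greatest_in_def)
        then show ?thesis using le_loss_imp_le by (auto simp: le_max_iff_disj)
      qed
    qed
    with X Y show ?case by (intro vee_eqI[symmetric])
  qed
qed

lemma simple_integral_mono:
  assumes "simple_fun m g" "simple_fun m h" and le: "\<And>x. x \<in> space m \<Longrightarrow> g x \<le> h x"
  shows "AE \<omega> in P. le_loss f (I0 g \<omega>) (I0 h \<omega>)"
proof -
  have "I0 (\<lambda>x. max (g x) (h x)) = I0 h"
    using le by (intro simple_integral_cong) (simp add: max_absorb2)
  with simple_integral_max[OF assms(1,2)] show ?thesis
    by (auto elim!: eventually_mono simp: vee_eq_iff_le_loss[symmetric])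
qed

lemma simple_integral_cmult:
  assumes g: "simple_fun m g" and c: "0 \<le> c"
  shows "AE \<omega> in P. I0 (\<lambda>x. c * g x) \<omega> = c *\<^sub>R I0 g \<omega>"
proof -
  obtain k a A where r: "simple_rep m g k a A" using g by (auto simp: simple_fun_def)
  have r': "simple_rep m (\<lambda>x. c * g x) k (\<lambda>j. c * a j) A"
    using c by (intro simple_rep_combine[OF r r, where \<phi> = "\<lambda>s t. c * s"]) auto
  show ?thesis
    using AE_simple_integral_greatest[OF r] AE_simple_integral_greatest[OF r']
  proof eventually_elim
    case (elim \<omega>)
    have "greatest_in f (insert 0 ((\<lambda>i. (c * a i) *\<^sub>R M (A i) \<omega>) ` {..k})) (c *\<^sub>R I0 g \<omega>)"
      using elim(1) le_loss_scaleR[OF c] unfolding greatest_in_def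
      by (auto simp: scaleR_scaleR[symmetric] simp del: scaleR_scaleR)
    with elim(2) show ?case by (rule greatest_in_unique)
  qed
qed

lemma simple_integral_indep:
  assumes g: "simple_fun m g" and h: "simple_fun m h" and gh: "\<And>x. x \<in> space m \<Longrightarrow> g x * h x = 0"
  shows "indep_var borel (I0 g) borel (I0 h)"
proof -
  obtain k a b A where r: "simple_rep m g k a A" "simple_rep m h k b A"
    using common_simple_rep[OF g h] by blast
  \<comment> \<open>Where both weights are nonzero the set is empty, so the second one may be set to zero.\<close>
  define b' where "b' j = (if a j = 0 then b j else 0)" for j
  have r': "simple_rep m h k b' A"
  proof (rule simple_repI)
    fix x j assume x: "x \<in> space m" "j \<le> k" "x \<in> A j"
    then show "h x = b' j"
      using gh[of x] simple_repD(4)[OF r(1) x] simple_repD(4)[OF r(2) x] by (auto simp: b'_def)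
  qed (use simple_repD[OF r(2)] in \<open>auto simp: b'_def\<close>)
  show ?thesis
  proof (rule indep_var_cong_AE)
    show "indep_var borel (\<lambda>\<omega>. vee_upto f (\<lambda>j. a j *\<^sub>R M (A j) \<omega>) k) borel (\<lambda>\<omega>. vee_upto f (\<lambda>j. b' j *\<^sub>R M (A j) \<omega>) k)"
      using simple_repD[OF r(1)] by (intro indep_blocks) (auto simp: b'_def)
  qed (auto intro!: AE_simple_integral_vee_upto r(1) r' simple_integral_measurable g h)
qed

text \<open>The \<open>\<alpha>\<close>-th power of \<open>L_norm \<alpha> m g\<close>.\<close>

definition mass :: "('e \<Rightarrow> real) \<Rightarrow> real" where
  "mass g = enn2real (\<integral>\<^sup>+x. ennreal (g x powr \<alpha>) \<partial>m)"

lemma mass_nonneg [simp]: "0 \<le> mass g"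
  by (simp add: mass_def)

lemma nn_integral_simple_rep:
  assumes r: "simple_rep m g k a A"
  shows "(\<integral>\<^sup>+x. ennreal (g x powr \<alpha>) \<partial>m) = ennreal (\<Sum>j\<le>k. a j powr \<alpha> * measure m (A j))"
proof -
  note D = simple_repD[OF r]
  have r': "simple_rep m (\<lambda>x. g x powr \<alpha>) k (\<lambda>j. a j powr \<alpha>) A"
    using alpha_pos by (intro simple_rep_combine[OF r r, where \<phi> = "\<lambda>s t. s powr \<alpha>"]) auto
  have "(\<integral>\<^sup>+x. ennreal (g x powr \<alpha>) \<partial>m) = (\<integral>\<^sup>+x. (\<Sum>j\<le>k. ennreal (a j powr \<alpha>) * indicator (A j) x) \<partial>m)"
  proof (rule nn_integral_cong)
    fix x assume "x \<in> space m"
    then have "ennreal (g x powr \<alpha>) = ennreal (\<Sum>j\<le>k. a j powr \<alpha> * indicator (A j) x)"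
      using r' by (simp add: simple_rep_def)
    also have "\<dots> = (\<Sum>j\<le>k. ennreal (a j powr \<alpha> * indicator (A j) x))"
      by (rule sum_ennreal[symmetric]) simp
    also have "\<dots> = (\<Sum>j\<le>k. ennreal (a j powr \<alpha>) * indicator (A j) x)"
      by (intro sum.cong) (auto simp: indicator_def)
    finally show "ennreal (g x powr \<alpha>) = (\<Sum>j\<le>k. ennreal (a j powr \<alpha>) * indicator (A j) x)" .
  qed
  also have "\<dots> = (\<Sum>j\<le>k. ennreal (a j powr \<alpha>) * emeasure m (A j))"
  proof (subst nn_integral_sum)
    fix j assume "j \<in> {..k}"
    then have [measurable]: "A j \<in> sets m" using D(2) by (simp add: fmeasurableD)
    show "(\<lambda>x. ennreal (a j powr \<alpha>) * indicator (A j) x) \<in> borel_measurable m" by measurable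
  next
    show "(\<Sum>j\<le>k. \<integral>\<^sup>+x. ennreal (a j powr \<alpha>) * indicator (A j) x \<partial>m) = (\<Sum>j\<le>k. ennreal (a j powr \<alpha>) * emeasure m (A j))"
      using fmeasurableD[OF D(2)] by (intro sum.cong nn_integral_cmult_indicator refl) simp
  qed
  also have "\<dots> = (\<Sum>j\<le>k. ennreal (a j powr \<alpha> * measure m (A j)))"
  proof (intro sum.cong refl)
    fix j assume "j \<in> {..k}"
    then have "emeasure m (A j) = ennreal (measure m (A j))"
      using D(2) by (intro emeasure_eq_ennreal_measure) (simp add: fmeasurableD2)
    then show "ennreal (a j powr \<alpha>) * emeasure m (A j) = ennreal (a j powr \<alpha> * measure m (A j))"
      by (simp add: ennreal_mult)
  qed
  also have "\<dots> = ennreal (\<Sum>j\<le>k. a j powr \<alpha> * measure m (A j))"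
    by (subst sum_ennreal) auto
  finally show ?thesis .
qed

lemma mass_simple_rep:
  assumes r: "simple_rep m g k a A"
  shows "mass g = (\<Sum>j\<le>k. a j powr \<alpha> * measure m (A j))"
  unfolding mass_def nn_integral_simple_rep[OF r] by (simp add: sum_nonneg)

lemma nn_integral_simple_fun: "simple_fun m g \<Longrightarrow> (\<integral>\<^sup>+x. ennreal (g x powr \<alpha>) \<partial>m) = ennreal (mass g)"
  by (auto simp: simple_fun_def mass_simple_rep nn_integral_simple_rep)

text \<open>Split off one set at a time: the integrals over the earlier sets and over the last one are
  independent, so the powers of their scales add.\<close>

lemma simple_integral_law_rep:
  "simple_rep m g k a A \<Longrightarrow> has_law P (I0 g) (Phi (\<Sum>j\<le>k. a j powr \<alpha> * measure m (A j)))"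
proof (induction k arbitrary: g)
  case 0
  note D = simple_repD[OF 0]
  have "AE \<omega> in P. I0 g \<omega> = a 0 *\<^sub>R M (A 0) \<omega>"
    using AE_simple_integral_vee_upto[OF 0] by simp
  moreover have "has_law P (\<lambda>\<omega>. a 0 *\<^sub>R M (A 0) \<omega>) (Phi (a 0 powr \<alpha> * measure m (A 0)))"
    using D by (intro has_law_scaleR_Phi M_law) auto
  moreover have "simple_fun m g" using 0 by (auto simp: simple_fun_def)
  ultimately show ?case using simple_integral_measurable[of g] has_law_cong_AE[of "\<lambda>\<omega>. a 0 *\<^sub>R M (A 0) \<omega>" _ "I0 g"] by simp
next
  case (Suc k)
  note D = simple_repD[OF Suc.prems]
  define g' where "g' x = (\<Sum>j\<le>k. a j * indicator (A j) x)" for x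
  have r': "simple_rep m g' k a A"
    using D(1,2,3) unfolding simple_rep_def g'_def by (auto simp: disjoint_family_on_def)
  let ?h = "\<lambda>x. a (Suc k) * indicator (A (Suc k)) x"
  have g'0: "g' x = 0" if "x \<in> space m" "x \<in> A (Suc k)" for x
  proof -
    have "x \<notin> A j" if "j \<le> k" for j
      using disjoint_family_onD[OF D(3), of j "Suc k"] \<open>x \<in> A (Suc k)\<close> that by auto
    then show ?thesis using simple_repD(5)[OF r' that(1)] by simp
  qed
  have s: "simple_fun m g" "simple_fun m g'" "simple_fun m ?h"
    using Suc.prems r' D simple_fun_indicator[of "A (Suc k)" "a (Suc k)"] by (auto simp: simple_fun_def)
  have "I0 (\<lambda>x. max (g' x) (?h x)) = I0 g"
  proof (rule simple_integral_cong)
    fix x assume x: "x \<in> space m"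
    then have eq: "g x = g' x + ?h x"
      using Suc.prems by (simp add: simple_rep_def g'_def)
    show "max (g' x) (?h x) = g x"
    proof (cases "x \<in> A (Suc k)")
      case True
      with g'0[OF x True] D(1)[of "Suc k"] show ?thesis unfolding eq by simp
    next
      case False
      with simple_fun_nonneg[OF s(2) x] show ?thesis unfolding eq by simp
    qed
  qed
  with simple_integral_max[OF s(2,3)] have eq: "AE \<omega> in P. I0 g \<omega> = vee f (I0 g' \<omega>) (I0 ?h \<omega>)"
    by simp
  have "has_law P (\<lambda>\<omega>. vee f (I0 g' \<omega>) (I0 ?h \<omega>)) (Phi ((\<Sum>j\<le>k. a j powr \<alpha> * measure m (A j)) + a (Suc k) powr \<alpha> * measure m (A (Suc k))))"
  proof (rule indep_vee_law)
    show "indep_var borel (I0 g') borel (I0 ?h)"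
      using g'0 by (intro simple_integral_indep s) (auto simp: indicator_def)
    show "has_law P (I0 g') (Phi (\<Sum>j\<le>k. a j powr \<alpha> * measure m (A j)))"
      by (rule Suc.IH[OF r'])
    have "has_law P (\<lambda>\<omega>. a (Suc k) *\<^sub>R M (A (Suc k)) \<omega>) (Phi (a (Suc k) powr \<alpha> * measure m (A (Suc k))))"
      using D by (intro has_law_scaleR_Phi M_law) auto
    moreover have "AE \<omega> in P. I0 ?h \<omega> = a (Suc k) *\<^sub>R M (A (Suc k)) \<omega>"
      using D(1,2)[of "Suc k"] by (intro simple_integral_indicator) auto
    ultimately show "has_law P (I0 ?h) (Phi (a (Suc k) powr \<alpha> * measure m (A (Suc k))))"
      by (rule has_law_cong_AE[OF _ simple_integral_measurable[OF s(3)]])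
    show "0 \<le> (\<Sum>j\<le>k. a j powr \<alpha> * measure m (A j))" "0 \<le> a (Suc k) powr \<alpha> * measure m (A (Suc k))"
      by (simp_all add: sum_nonneg)
  qed
  from has_law_cong_AE[OF this simple_integral_measurable[OF s(1)] eq] show ?case
    by simp
qed

lemma simple_integral_law: "simple_fun m g \<Longrightarrow> has_law P (I0 g) (Phi (mass g))"
  by (auto simp: simple_fun_def mass_simple_rep intro: simple_integral_law_rep)

section \<open>The direction of the integral of a simple function\<close>

lemma L_plusD:
  assumes "g \<in> L_plus \<alpha> m"
  shows "g \<in> borel_measurable m" "\<And>x. x \<in> space m \<Longrightarrow> 0 \<le> g x"
    "(\<integral>\<^sup>+x. ennreal (g x powr \<alpha>) \<partial>m) = ennreal (mass g)"
    "integrable m (\<lambda>x. g x powr \<alpha>)" "mass g = (\<integral>x. g x powr \<alpha> \<partial>m)"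
proof -
  show [measurable]: "g \<in> borel_measurable m" and "\<And>x. x \<in> space m \<Longrightarrow> 0 \<le> g x"
    using assms by (auto simp: L_plus_def)
  show nn: "(\<integral>\<^sup>+x. ennreal (g x powr \<alpha>) \<partial>m) = ennreal (mass g)"
    using assms by (simp add: L_plus_def mass_def)
  show int: "integrable m (\<lambda>x. g x powr \<alpha>)"
    using nn by (intro integrableI_nn_integral_finite[where x = "mass g"]) auto
  show "mass g = (\<integral>x. g x powr \<alpha> \<partial>m)"
    using nn nn_integral_eq_integral[OF int] by (simp add: integral_nonneg_AE)
qed

lemma simple_fun_L_plus: "simple_fun m g \<Longrightarrow> g \<in> L_plus \<alpha> m"
  using nn_integral_simple_fun[of g] by (simp add: L_plus_def simple_fun_iff)

lemma mass_mono_AE: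
  assumes "h \<in> L_plus \<alpha> m" "AE x in m. g x powr \<alpha> \<le> h x powr \<alpha>"
  shows "mass g \<le> mass h"
  unfolding mass_def
  using assms by (intro enn2real_mono nn_integral_mono_AE) (auto simp: L_plus_def)

lemma mass_mono:
  assumes "h \<in> L_plus \<alpha> m" "\<And>x. x \<in> space m \<Longrightarrow> 0 \<le> g x" "\<And>x. x \<in> space m \<Longrightarrow> g x \<le> h x"
  shows "mass g \<le> mass h"
  using assms alpha_pos by (intro mass_mono_AE AE_I2 powr_mono2) auto

lemma mass_cong_AE: "AE x in m. g x = h x \<Longrightarrow> mass g = mass h"
  unfolding mass_def by (intro arg_cong[where f = enn2real] nn_integral_cong_AE) auto

lemma mass_add:
  assumes "g \<in> L_plus \<alpha> m" "h \<in> L_plus \<alpha> m" "k \<in> L_plus \<alpha> m"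
    and eq: "\<And>x. x \<in> space m \<Longrightarrow> k x powr \<alpha> = g x powr \<alpha> + h x powr \<alpha>"
  shows "mass k = mass g + mass h"
  using L_plusD[OF assms(1)] L_plusD[OF assms(2)] L_plusD[OF assms(3)] eq
  by (simp cong: Bochner_Integration.integral_cong)

lemma mass_cmult:
  assumes "g \<in> L_plus \<alpha> m" "0 \<le> c"
  shows "(\<lambda>x. c * g x) \<in> L_plus \<alpha> m" "mass (\<lambda>x. c * g x) = c powr \<alpha> * mass g"
proof -
  note D = L_plusD[OF assms(1)]
  note [measurable] = D(1)
  have "(\<integral>\<^sup>+x. ennreal ((c * g x) powr \<alpha>) \<partial>m) = (\<integral>\<^sup>+x. ennreal (c powr \<alpha>) * ennreal (g x powr \<alpha>) \<partial>m)"
    using assms(2) D(2) by (intro nn_integral_cong) (simp add: powr_mult ennreal_mult)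
  also have "\<dots> = ennreal (c powr \<alpha>) * (\<integral>\<^sup>+x. ennreal (g x powr \<alpha>) \<partial>m)"
    by (rule nn_integral_cmult) measurable
  also have "\<dots> = ennreal (c powr \<alpha> * mass g)"
    unfolding D(3) by (simp add: ennreal_mult)
  finally have eq: "(\<integral>\<^sup>+x. ennreal ((c * g x) powr \<alpha>) \<partial>m) = ennreal (c powr \<alpha> * mass g)" .
  then show "mass (\<lambda>x. c * g x) = c powr \<alpha> * mass g"
    by (simp add: mass_def[of "\<lambda>x. c * g x"])
  show "(\<lambda>x. c * g x) \<in> L_plus \<alpha> m"
    using eq D(2) assms(2) by (simp add: L_plus_def)
qed

lemma L_plus_max:
  assumes "g \<in> L_plus \<alpha> m" "h \<in> L_plus \<alpha> m"
  shows "(\<lambda>x. max (g x) (h x)) \<in> L_plus \<alpha> m"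
proof -
  note [measurable] = L_plusD(1)[OF assms(1)] L_plusD(1)[OF assms(2)]
  have "(\<integral>\<^sup>+x. ennreal (max (g x) (h x) powr \<alpha>) \<partial>m) \<le> (\<integral>\<^sup>+x. ennreal (g x powr \<alpha>) + ennreal (h x powr \<alpha>) \<partial>m)"
    by (intro nn_integral_mono) (auto simp: max_def)
  also have "\<dots> = ennreal (mass g) + ennreal (mass h)"
    by (subst nn_integral_add) (auto simp: L_plusD(3)[OF assms(1)] L_plusD(3)[OF assms(2)])
  also have "\<dots> < \<infinity>" by (simp add: ennreal_plus[symmetric] del: ennreal_plus)
  finally show ?thesis
    using L_plusD(2)[OF assms(1)] by (auto simp: L_plus_def le_max_iff_disj)
qed

lemma simple_fun_restrict:
  assumes "simple_fun m g" "A \<in> sets m"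
  shows "simple_fun m (\<lambda>x. g x * indicator A x)"
proof -
  from assms obtain k a B where r: "simple_rep m g k a B" by (auto simp: simple_fun_def)
  note D = simple_repD[OF r]
  have "simple_rep m (\<lambda>x. g x * indicator A x) k a (\<lambda>j. B j \<inter> A)"
  proof (rule simple_repI)
    show "B j \<inter> A \<in> fmeasurable m" if "j \<le> k" for j
      using fmeasurableI2[OF D(2)[OF that], of "B j \<inter> A"] fmeasurableD[OF D(2)[OF that]] assms(2) by auto
    show "disjoint_family_on (\<lambda>j. B j \<inter> A) {..k}"
      using D(3) by (auto simp: disjoint_family_on_def)
    show "g x * indicator A x = a j" if "x \<in> space m" "j \<le> k" "x \<in> B j \<inter> A" for x j
      using D(4)[of x j] that by simp
    show "g x * indicator A x = 0" if "x \<in> space m" "\<And>j. j \<le> k \<Longrightarrow> x \<notin> B j \<inter> A" for x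
      using D(5)[OF that(1)] that(2) by (cases "x \<in> A") auto
  qed (use D(1) in auto)
  then show ?thesis by (auto simp: simple_fun_def)
qed

text \<open>This is the quantitative heart of the proof. Let \<open>Q j\<close> be the event that the contribution of \<open>A j\<close>
  to the integral of the smaller function \<open>g\<close> already beats everything that \<open>h\<close> collects outside \<open>A j\<close>.
  On \<open>Q j\<close> both integrals are attained on \<open>A j\<close>, so they are multiples of the same vector \<open>M (A j)\<close>. By
  the comparison of independent vectors \<open>Q j\<close> has probability \<open>s / (s + t)\<close>, where \<open>s\<close> is the mass of
  \<open>g\<close> on \<open>A j\<close> and \<open>s + t\<close> is at most \<open>mass h\<close>. The events exclude each other, and summing over \<open>j\<close> gives
  at least \<open>mass g / mass h\<close>.\<close>

lemma same_dir_prob: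
  assumes g: "simple_fun m g" and h: "simple_fun m h" and le: "\<And>x. x \<in> space m \<Longrightarrow> g x \<le> h x"
  shows "mass g \<le> mass h * prob {\<omega> \<in> space P. same_dir f (I0 g \<omega>) (I0 h \<omega>)}"
proof -
  obtain k a b A where r: "simple_rep m g k a A" "simple_rep m h k b A"
    using common_simple_rep[OF g h] by blast
  note D = simple_repD[OF r(1)] and D' = simple_repD[OF r(2)]
  note [measurable] = simple_integral_measurable
  define gj where "gj j x = a j * indicator (A j) x" for j x
  define hj where "hj j x = b j * indicator (A j) x" for j x
  define gr where "gr j x = g x * indicator (space m - A j) x" for j x
  define hr where "hr j x = h x * indicator (space m - A j) x" for j x
  have s: "simple_fun m (gj j)" "simple_fun m (hj j)" "simple_fun m (gr j)" "simple_fun m (hr j)" if "j \<le> k" for j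
    unfolding gj_def hj_def gr_def hr_def
    using D(1,2)[OF that] D'(1)[OF that] fmeasurableD[OF D(2)[OF that]]
    by (intro simple_fun_indicator simple_fun_restrict g h; simp)+
  note [measurable] = simple_integral_measurable[OF g] simple_integral_measurable[OF h]
  define Q where "Q j = {\<omega> \<in> space P. f (I0 (hr j) \<omega>) < f (I0 (gj j) \<omega>)}" for j
  have Q [measurable]: "Q j \<in> sets P" if "j \<le> k" for j
  proof -
    note [measurable] = s[OF that, THEN simple_integral_measurable]
    show ?thesis unfolding Q_def by measurable
  qed
  have disj: "x \<notin> A j" if "i \<le> k" "j \<le> k" "i \<noteq> j" "x \<in> A i" for i j x
    using disjoint_family_onD[OF D(3), of i j] that by auto
  have pt: "g x = max (gj j x) (gr j x)" "h x = max (hj j x) (hr j x)" "gj j x \<le> hj j x" "gr j x \<le> hr j x" "gj j x * hr j x = 0"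
      "h x powr \<alpha> = hj j x powr \<alpha> + hr j x powr \<alpha>"
    if "j \<le> k" "x \<in> space m" for j x
    using D(4)[OF that(2,1)] D'(4)[OF that(2,1)] D(1)[OF that(1)] D'(1)[OF that(1)] le[OF that(2)]
      simple_fun_nonneg[OF g that(2)] simple_fun_nonneg[OF h that(2)] that(2)
    by (auto simp: gj_def hj_def gr_def hr_def indicator_def)
  have massQ: "mass (gj j) \<le> mass h * prob (Q j)" if j: "j \<le> k" for j
  proof (cases "mass (gj j) = 0")
    case False
    then have pos: "0 < mass (gj j)" using mass_nonneg[of "gj j"] by linarith
    have "prob (Q j) = mass (gj j) / (mass (gj j) + mass (hr j))"
      unfolding Q_def
      by (intro indep_prob_f_less simple_integral_indep simple_integral_law s j pos) (auto simp: pt(5)[OF j])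
    then have "mass (gj j) = (mass (gj j) + mass (hr j)) * prob (Q j)"
      using add_pos_nonneg[OF pos mass_nonneg[of "hr j"]] by simp
    moreover have "mass (gj j) \<le> mass (hj j)"
      using pt(3)[OF j] s[OF j] by (intro mass_mono simple_fun_L_plus) (auto simp: simple_fun_nonneg)
    moreover have "mass h = mass (hj j) + mass (hr j)"
      using s[OF j] h pt(6)[OF j] by (intro mass_add simple_fun_L_plus)
    ultimately show ?thesis
      using mult_right_mono[of "mass (gj j) + mass (hr j)" "mass h" "prob (Q j)"] by simp
  qed simp
  have onQ: "AE \<omega> in P. \<omega> \<in> Q j \<longrightarrow> same_dir f (I0 g \<omega>) (I0 h \<omega>)" if j: "j \<le> k" for j
  proof -
    have "I0 (\<lambda>x. max (gj j x) (gr j x)) = I0 g" "I0 (\<lambda>x. max (hj j x) (hr j x)) = I0 h"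
      using pt(1,2)[OF j] by (auto intro!: simple_integral_cong)
    with simple_integral_max[OF s(1,3)[OF j]] simple_integral_max[OF s(2,4)[OF j]]
    have ae: "AE \<omega> in P. I0 g \<omega> = vee f (I0 (gj j) \<omega>) (I0 (gr j) \<omega>)"
      "AE \<omega> in P. I0 h \<omega> = vee f (I0 (hj j) \<omega>) (I0 (hr j) \<omega>)"
      by simp_all
    have ae': "AE \<omega> in P. I0 (gj j) \<omega> = a j *\<^sub>R M (A j) \<omega>" "AE \<omega> in P. I0 (hj j) \<omega> = b j *\<^sub>R M (A j) \<omega>"
      unfolding gj_def hj_def using D(1,2)[OF j] D'(1)[OF j] by (auto intro!: simple_integral_indicator)
    have "AE \<omega> in P. le_loss f (I0 (gj j) \<omega>) (I0 (hj j) \<omega>)" "AE \<omega> in P. le_loss f (I0 (gr j) \<omega>) (I0 (hr j) \<omega>)"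
      by (rule simple_integral_mono[OF s(1,2)[OF j] pt(3)[OF j]], assumption)
        (rule simple_integral_mono[OF s(3,4)[OF j] pt(4)[OF j]], assumption)
    with ae ae' show ?thesis
    proof eventually_elim
      case (elim \<omega>)
      show ?case
      proof
        assume "\<omega> \<in> Q j"
        then have Q: "f (I0 (hr j) \<omega>) < f (I0 (gj j) \<omega>)" by (simp add: Q_def)
        from elim(5,6)[THEN le_loss_imp_le] Q have "f (I0 (gr j) \<omega>) < f (I0 (gj j) \<omega>)" "f (I0 (hr j) \<omega>) < f (I0 (hj j) \<omega>)"
          by linarith+
        then have "I0 g \<omega> = a j *\<^sub>R M (A j) \<omega>" "I0 h \<omega> = b j *\<^sub>R M (A j) \<omega>"
          using elim(1-4) by (simp_all add: vee_def)
        then show "same_dir f (I0 g \<omega>) (I0 h \<omega>)"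
          using D(1)[OF j] D'(1)[OF j] by (simp add: same_dir_scaleR)
      qed
    qed
  qed
  have disjQ: "AE \<omega> in P. i \<noteq> j \<longrightarrow> \<not> (\<omega> \<in> Q i \<and> \<omega> \<in> Q j)" if ij: "i \<le> k" "j \<le> k" for i j
  proof (cases "i = j")
    case False
    have le': "gj i x \<le> hr j x" if "i \<le> k" "j \<le> k" "i \<noteq> j" "x \<in> space m" for i j x
      using D(4)[of x i] le[of x] disj[of i j x] that simple_fun_nonneg[OF h, of x]
      by (auto simp: gj_def hr_def indicator_def)
    have "AE \<omega> in P. le_loss f (I0 (gj i) \<omega>) (I0 (hr j) \<omega>)" "AE \<omega> in P. le_loss f (I0 (gj j) \<omega>) (I0 (hr i) \<omega>)"
      by (rule simple_integral_mono[OF s(1)[OF ij(1)] s(4)[OF ij(2)] le'[OF ij False]], assumption)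
        (rule simple_integral_mono[OF s(1)[OF ij(2)] s(4)[OF ij(1)] le'[OF ij(2,1) False[symmetric]]], assumption)
    then show ?thesis
    proof eventually_elim
      case (elim \<omega>)
      from elim[THEN le_loss_imp_le] show ?case by (auto simp: Q_def)
    qed
  qed simp
  let ?S = "{\<omega> \<in> space P. same_dir f (I0 g \<omega>) (I0 h \<omega>)}"
  \<comment> \<open>The events \<open>Q j\<close> are disjoint up to null sets only, so their indicators are added instead of their measures.\<close>
  have "(\<Sum>j\<le>k. prob (Q j)) = (\<integral>\<omega>. (\<Sum>j\<le>k. indicator (Q j) \<omega>) \<partial>P)"
    using Q by (subst Bochner_Integration.integral_sum) (auto simp: emeasure_eq_measure)
  also have "\<dots> \<le> (\<integral>\<omega>. indicator ?S \<omega> \<partial>P)"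
  proof (rule integral_mono_AE)
    have "AE \<omega> in P. \<forall>j\<in>{..k}. \<omega> \<in> Q j \<longrightarrow> same_dir f (I0 g \<omega>) (I0 h \<omega>)"
      using onQ by (intro AE_finite_allI) auto
    moreover have "AE \<omega> in P. \<forall>i\<in>{..k}. \<forall>j\<in>{..k}. i \<noteq> j \<longrightarrow> \<not> (\<omega> \<in> Q i \<and> \<omega> \<in> Q j)"
      using disjQ by (intro AE_finite_allI) auto
    ultimately show "AE \<omega> in P. (\<Sum>j\<le>k. indicator (Q j) \<omega>) \<le> (indicator ?S \<omega> :: real)"
      using AE_space
    proof eventually_elim
      case (elim \<omega>)
      show ?case
      proof (cases "\<exists>i\<le>k. \<omega> \<in> Q i")
        case True
        then obtain i where i: "i \<le> k" "\<omega> \<in> Q i" by auto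
        have "(\<Sum>j\<le>k. indicator (Q j) \<omega> :: real) = indicator (Q i) \<omega> + (\<Sum>j\<in>{..k} - {i}. indicator (Q j) \<omega>)"
          using i by (intro sum.remove) auto
        also have "(\<Sum>j\<in>{..k} - {i}. indicator (Q j) \<omega> :: real) = 0"
          using elim(2) i by (intro sum.neutral) auto
        moreover have "\<omega> \<in> ?S" using i elim(1,3) by auto
        ultimately show ?thesis using i by simp
      next
        case False
        then have "(\<Sum>j\<le>k. indicator (Q j) \<omega> :: real) = 0" by (intro sum.neutral) auto
        then show ?thesis by simp
      qed
    qed
    show "integrable P (\<lambda>\<omega>. \<Sum>j\<le>k. indicator (Q j) \<omega> :: real)"
      using Q by (intro Bochner_Integration.integrable_sum) (auto simp: emeasure_eq_measure)
  qed (auto simp: emeasure_eq_measure)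
  also have "\<dots> = prob ?S" by simp
  finally have sumQ: "(\<Sum>j\<le>k. prob (Q j)) \<le> prob ?S" .
  have "mass (gj j) = a j powr \<alpha> * measure m (A j)" if "j \<le> k" for j
    unfolding gj_def using mass_simple_rep[OF simple_rep_indicator[OF D(2)[OF that] D(1)[OF that]]] by simp
  then have "mass g = (\<Sum>j\<le>k. mass (gj j))"
    unfolding mass_simple_rep[OF r(1)] by simp
  also have "\<dots> \<le> (\<Sum>j\<le>k. mass h * prob (Q j))"
    using massQ by (intro sum_mono) auto
  also have "\<dots> \<le> mass h * prob ?S"
    using sumQ by (simp add: sum_distrib_left[symmetric] mult_left_mono)
  finally show ?thesis .
qed

text \<open>Different directions with almost equal losses are unlikely. Apply the preceding bound to the maximum
  of \<open>g\<close> and \<open>c * h\<close>, whose mass is at least \<open>c powr \<alpha> * mass h\<close>: on the event in question its integral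
  is that of \<open>g\<close>, which points away from the integral of \<open>h\<close>.\<close>

lemma different_dir_gap_prob:
  assumes g: "simple_fun m g" and h: "simple_fun m h" and le: "\<And>x. x \<in> space m \<Longrightarrow> g x \<le> h x"
    and c: "0 < c" "c < 1"
  shows "prob {\<omega> \<in> space P. \<not> same_dir f (I0 g \<omega>) (I0 h \<omega>) \<and> c * f (I0 h \<omega>) < f (I0 g \<omega>)} \<le> 1 - c powr \<alpha>"
    (is "prob ?E \<le> _")
proof -
  note [measurable] = simple_integral_measurable[OF g] simple_integral_measurable[OF h]
  have c1: "c powr \<alpha> \<le> 1" using c alpha_pos powr_mono2[of \<alpha> c 1] by simp
  show ?thesis
  proof (cases "mass h = 0")
    case True
    then have "AE \<omega> in P. I0 h \<omega> = 0"
      using simple_integral_law[OF h] by (intro has_law_0_iff) simp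
    then have "AE \<omega> in P. \<omega> \<notin> ?E" by eventually_elim (simp add: same_dir_def)
    then have "prob ?E = 0" by (subst prob_eq_0) auto
    with c1 show ?thesis by simp
  next
    case False
    then have pos: "0 < mass h" using mass_nonneg[of h] by linarith
    let ?g = "\<lambda>x. max (g x) (c * h x)"
    have ch: "simple_fun m (\<lambda>x. c * h x)" using h c by (intro simple_fun_cmult) auto
    have g': "simple_fun m ?g" by (intro simple_fun_max g ch)
    note [measurable] = simple_integral_measurable[OF g']
    let ?S = "{\<omega> \<in> space P. same_dir f (I0 ?g \<omega>) (I0 h \<omega>)}"
    have "c powr \<alpha> * mass h = mass (\<lambda>x. c * h x)"
      using mass_cmult(2)[OF simple_fun_L_plus[OF h], of c] c by simp
    also have "\<dots> \<le> mass ?g"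
      using g' simple_fun_nonneg[OF ch] by (intro mass_mono simple_fun_L_plus) auto
    also have "\<dots> \<le> mass h * prob ?S"
    proof (rule same_dir_prob[OF g' h])
      fix x assume x: "x \<in> space m"
      have "c * h x \<le> 1 * h x" using c simple_fun_nonneg[OF h x] by (intro mult_right_mono) auto
      with le[OF x] show "max (g x) (c * h x) \<le> h x" by simp
    qed
    finally have S: "c powr \<alpha> \<le> prob ?S" using pos by (simp add: mult.commute)
    have "prob ?E \<le> prob (space P - ?S)"
    proof (rule finite_measure_mono_AE)
      show "AE \<omega> in P. \<omega> \<in> ?E \<longrightarrow> \<omega> \<in> space P - ?S"
        using simple_integral_max[OF g ch] simple_integral_cmult[OF h, of c, OF less_imp_le[OF c(1)]]
        by eventually_elim (use c in \<open>auto simp: vee_def f_scaleR\<close>)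
    qed measurable
    also have "\<dots> = 1 - prob ?S" by (rule prob_compl) measurable
    finally show ?thesis using S by simp
  qed
qed

section \<open>Monotone limits of simple functions\<close>

definition simple_approx :: "(nat \<Rightarrow> 'e \<Rightarrow> real) \<Rightarrow> ('e \<Rightarrow> real) \<Rightarrow> bool" where
  "simple_approx h g \<longleftrightarrow> (\<forall>n. simple_fun m (h n)) \<and>
     (\<forall>x\<in>space m. incseq (\<lambda>n. h n x) \<and> (\<lambda>n. h n x) \<longlonglongrightarrow> g x)"

lemma simple_approxD:
  assumes "simple_approx h g"
  shows "simple_fun m (h n)" "x \<in> space m \<Longrightarrow> incseq (\<lambda>n. h n x)" "x \<in> space m \<Longrightarrow> (\<lambda>n. h n x) \<longlonglongrightarrow> g x"
    "x \<in> space m \<Longrightarrow> h n x \<le> g x"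
  using assms by (auto simp: simple_approx_def intro: incseq_le)

lemma simple_approx_subseq: "simple_approx h g \<Longrightarrow> strict_mono r \<Longrightarrow> simple_approx (\<lambda>n. h (r n)) g"
  unfolding simple_approx_def using LIMSEQ_subseq_LIMSEQ[of _ _ r]
  by (auto simp: incseq_def comp_def strict_mono_less_eq)

lemma simple_approx_cong: "simple_approx h g \<Longrightarrow> (\<And>x. x \<in> space m \<Longrightarrow> g x = g' x) \<Longrightarrow> simple_approx h g'"
  by (simp add: simple_approx_def)

lemma simple_approx_max:
  "simple_approx h g \<Longrightarrow> simple_approx h' g' \<Longrightarrow> simple_approx (\<lambda>n x. max (h n x) (h' n x)) (\<lambda>x. max (g x) (g' x))"
  unfolding simple_approx_def incseq_def
  by (intro conjI allI ballI impI simple_fun_max tendsto_max max.mono) auto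

lemma simple_approx_cmult:
  "simple_approx h g \<Longrightarrow> 0 \<le> c \<Longrightarrow> simple_approx (\<lambda>n x. c * h n x) (\<lambda>x. c * g x)"
  unfolding simple_approx_def
  by (auto intro!: simple_fun_cmult tendsto_intros mult_left_mono simp: incseq_def)

text \<open>The usual dyadic approximation works: each approximant is bounded below by a positive constant on
  its support, so finiteness of the integral of \<open>g powr \<alpha>\<close> makes the support have finite measure.\<close>

lemma simple_approx_exists:
  assumes "g \<in> L_plus \<alpha> m"
  shows "\<exists>h. simple_approx h g"
proof -
  note D = L_plusD[OF assms]
  let ?u = "\<lambda>x. max 0 (g x)"
  have [measurable]: "?u \<in> borel_measurable m" using D(1) by simp
  obtain F where F: "incseq F" "\<And>i. simple_function m (F i)" "\<And>x. bdd_above (range (\<lambda>i. F i x))"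
     "\<And>i x. 0 \<le> F i x" "?u = (SUP i. F i)"
    using borel_measurable_implies_simple_function_sequence_real[of ?u m] by auto
  have inc: "incseq (\<lambda>n. F n x)" for x
    using F(1) by (auto simp: incseq_def le_fun_def)
  have lim: "(\<lambda>n. F n x) \<longlonglongrightarrow> ?u x" for x
    using LIMSEQ_incseq_SUP[OF F(3) inc, of x] fun_cong[OF F(5), of x] by (simp add: image_comp)
  have "simple_fun m (F n)" for n
  proof -
    have fin: "finite (F n ` space m)" and [measurable]: "F n \<in> borel_measurable m"
      using F(2)[of n] borel_measurable_simple_function[OF F(2)[of n]] by (auto simp: simple_function_def)
    let ?A = "{x \<in> space m. F n x \<noteq> 0}"
    have "?A \<in> fmeasurable m"
    proof (cases "?A = {}")
      case False
      define c where "c = Min (F n ` ?A)"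
      have finA: "finite (F n ` ?A)" using fin by (rule finite_subset[rotated]) auto
      then have "c \<in> F n ` ?A" unfolding c_def using False by (intro Min_in) auto
      then have c: "0 < c" using F(4)[of n] by (auto simp: less_le)
      have "ennreal (c powr \<alpha>) * emeasure m ?A = (\<integral>\<^sup>+x. ennreal (c powr \<alpha>) * indicator ?A x \<partial>m)"
        by (rule nn_integral_cmult_indicator[symmetric]) measurable
      also have "\<dots> \<le> (\<integral>\<^sup>+x. ennreal (g x powr \<alpha>) \<partial>m)"
      proof (rule nn_integral_mono)
        fix x assume x: "x \<in> space m"
        show "ennreal (c powr \<alpha>) * indicator ?A x \<le> ennreal (g x powr \<alpha>)"
        proof (cases "x \<in> ?A")
          case True
          then have "c \<le> F n x" unfolding c_def using finA by (intro Min_le) auto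
          also have "\<dots> \<le> g x" using incseq_le[OF inc lim, of n x] D(2)[OF x] by simp
          finally show ?thesis using True c alpha_pos by (auto intro!: ennreal_leI powr_mono2)
        qed simp
      qed
      also have "\<dots> < \<infinity>" unfolding D(3) by simp
      finally have "emeasure m ?A < \<infinity>" using c by (auto simp: ennreal_mult_less_top less_top[symmetric])
      then show ?thesis by (intro fmeasurableI) auto
    next
      case True
      show ?thesis unfolding True by simp
    qed
    then show ?thesis
      using fin F(4)[of n] by (simp add: simple_fun_iff)
  qed
  then have "simple_approx F ?u" using inc lim by (simp add: simple_approx_def)
  then have "simple_approx F g" by (rule simple_approx_cong) (simp add: D(2))
  then show ?thesis by blast
qed

lemma simple_approx_mass:
  assumes h: "simple_approx h g" and g: "g \<in> L_plus \<alpha> m"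
  shows "(\<lambda>n. mass (h n)) \<longlonglongrightarrow> mass g" "mass (h n) \<le> mass g" "i \<le> j \<Longrightarrow> mass (h i) \<le> mass (h j)"
proof -
  note D = simple_approxD[OF h] and G = L_plusD[OF g]
  note [measurable] = simple_fun_measurable[OF D(1)] G(1)
  have nn: "0 \<le> h n x" if "x \<in> space m" for n x using simple_fun_nonneg[OF D(1) that] .
  have "(\<lambda>n. \<integral>\<^sup>+x. ennreal (h n x powr \<alpha>) \<partial>m) \<longlonglongrightarrow> (\<integral>\<^sup>+x. ennreal (g x powr \<alpha>) \<partial>m)"
  proof (rule nn_integral_dominated_convergence[where w = "\<lambda>x. ennreal (g x powr \<alpha>)"])
    show "AE x in m. ennreal (h n x powr \<alpha>) \<le> ennreal (g x powr \<alpha>)" for n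
      using D(4) nn alpha_pos by (intro AE_I2 ennreal_leI powr_mono2) auto
    show "AE x in m. (\<lambda>n. ennreal (h n x powr \<alpha>)) \<longlonglongrightarrow> ennreal (g x powr \<alpha>)"
    proof (rule AE_I2)
      fix x assume x: "x \<in> space m"
      have "(\<lambda>n. h n x powr \<alpha>) \<longlonglongrightarrow> g x powr \<alpha>"
        using D(3)[OF x] nn[OF x] alpha_pos by (intro tendsto_powr' tendsto_const) auto
      then show "(\<lambda>n. ennreal (h n x powr \<alpha>)) \<longlonglongrightarrow> ennreal (g x powr \<alpha>)" by simp
    qed
    show "(\<integral>\<^sup>+x. ennreal (g x powr \<alpha>) \<partial>m) < \<infinity>" unfolding G(3) by simp
  qed measurable
  then show "(\<lambda>n. mass (h n)) \<longlonglongrightarrow> mass g"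
    unfolding G(3) nn_integral_simple_fun[OF D(1)] by simp
  show "mass (h n) \<le> mass g"
    using nn D(4) by (intro mass_mono g) auto
  show "mass (h i) \<le> mass (h j)" if "i \<le> j"
    using nn D(2) that by (intro mass_mono simple_fun_L_plus D(1)) (auto simp: incseq_def)
qed

text \<open>The losses increase, and they stay bounded because their laws are tight: the scales are bounded by
  that of \<open>g\<close>.\<close>

lemma AE_convergent_loss:
  assumes h: "simple_approx h g" and g: "g \<in> L_plus \<alpha> m"
  shows "AE \<omega> in P. convergent (\<lambda>n. f (I0 (h n) \<omega>)) \<and> incseq (\<lambda>n. f (I0 (h n) \<omega>))"
proof -
  note D = simple_approxD[OF h]
  note [measurable] = simple_integral_measurable[OF D(1)]
  have "AE \<omega> in P. f (I0 (h n) \<omega>) \<le> f (I0 (h (Suc n)) \<omega>)" for n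
    using simple_integral_mono[OF D(1) D(1), of n "Suc n"] D(2)
    by (auto simp: incseq_Suc_iff elim!: eventually_mono intro: le_loss_imp_le)
  then have inc: "AE \<omega> in P. incseq (\<lambda>n. f (I0 (h n) \<omega>))"
    by (auto simp: incseq_Suc_iff AE_all_countable)
  let ?B = "{\<omega> \<in> space P. \<forall>r::nat. \<exists>n. real r < f (I0 (h n) \<omega>)}"
  have bound: "prob ?B \<le> 1 - exp (- (mass g * real r powr (- \<alpha>)))" if r: "0 < r" for r :: nat
  proof -
    let ?E = "\<lambda>n. {\<omega> \<in> space P. \<exists>i\<le>n. real r < f (I0 (h i) \<omega>)}"
    have "prob (?E n) \<le> 1 - exp (- (mass g * real r powr (- \<alpha>)))" for n
    proof -
      let ?F = "{\<omega> \<in> space P. f (I0 (h n) \<omega>) \<le> real r}"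
      have "prob (?E n) \<le> prob (space P - ?F)"
      proof (rule finite_measure_mono_AE)
        show "AE \<omega> in P. \<omega> \<in> ?E n \<longrightarrow> \<omega> \<in> space P - ?F"
          using inc
        proof eventually_elim
          case (elim \<omega>)
          then have "f (I0 (h i) \<omega>) \<le> f (I0 (h n) \<omega>)" if "i \<le> n" for i
            using that by (simp add: incseq_def)
          then show ?case by force
        qed
      qed measurable
      also have "\<dots> = 1 - prob ?F" by (rule prob_compl) measurable
      also have "prob ?F = exp (- (mass (h n) * real r powr (- \<alpha>)))"
        using r by (intro prob_f_le simple_integral_law D(1)) auto
      also have "1 - \<dots> \<le> 1 - exp (- (mass g * real r powr (- \<alpha>)))"
        using simple_approx_mass(2)[OF h g, of n] by (simp add: mult_right_mono)
      finally show ?thesis .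
    qed
    moreover have "(\<lambda>n. prob (?E n)) \<longlonglongrightarrow> prob (\<Union>n. ?E n)"
    proof (rule finite_Lim_measure_incseq)
      show "incseq ?E" by (rule incseq_SucI) (auto intro: le_SucI)
    qed auto
    ultimately have "prob (\<Union>n. ?E n) \<le> 1 - exp (- (mass g * real r powr (- \<alpha>)))"
      by (intro LIMSEQ_le_const2) auto
    moreover have "prob ?B \<le> prob (\<Union>n. ?E n)"
    proof (rule finite_measure_mono)
      show "?B \<subseteq> (\<Union>n. ?E n)"
      proof
        fix \<omega> assume "\<omega> \<in> ?B"
        then obtain n where "\<omega> \<in> space P" "real r < f (I0 (h n) \<omega>)" by blast
        then show "\<omega> \<in> (\<Union>n. ?E n)" by blast
      qed
    qed auto
    ultimately show ?thesis by linarith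
  qed
  have "((\<lambda>r. 1 - exp (- (mass g * real r powr (- \<alpha>)))) \<longlongrightarrow> 1 - exp (- (mass g * 0))) sequentially"
    using alpha_pos by (intro tendsto_intros tendsto_neg_powr filterlim_real_sequentially) auto
  then have "prob ?B \<le> 1 - exp (- (mass g * 0))"
    using bound by (intro LIMSEQ_le_const) (auto intro!: exI[of _ 1])
  then have "prob ?B = 0" using measure_nonneg[of P ?B] by simp
  then have "AE \<omega> in P. \<omega> \<notin> ?B" by (subst (asm) prob_eq_0) measurable
  with inc show ?thesis using AE_space
  proof eventually_elim
    case (elim \<omega>)
    then obtain r :: nat where "\<And>n. f (I0 (h n) \<omega>) \<le> real r" by (auto simp: not_less)
    then have "bdd_above (range (\<lambda>n. f (I0 (h n) \<omega>)))" by (auto intro!: bdd_aboveI)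
    from LIMSEQ_incseq_SUP[OF this elim(1)] elim(1) show ?case
      by (auto simp: convergent_def)
  qed
qed

text \<open>Choose the subsequence so that its masses approach \<open>mass g\<close> geometrically fast. Then the bound on
  the direction and the Borel--Cantelli lemma show that the direction changes only finitely often. From
  then on the increments are controlled by those of the losses, which are summable.\<close>

lemma convergent_subseq_exists:
  assumes h: "simple_approx h g" and g: "g \<in> L_plus \<alpha> m"
  shows "\<exists>r X. strict_mono r \<and> X \<in> borel_measurable P \<and> (AE \<omega> in P. (\<lambda>n. I0 (h (r n)) \<omega>) \<longlonglongrightarrow> X \<omega>)"
proof -
  note D = simple_approxD[OF h]
  note [measurable] = simple_integral_measurable[OF D(1)]
  have "\<exists>r. strict_mono r \<and> (AE \<omega> in P. convergent (\<lambda>n. I0 (h (r n)) \<omega>))"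
  \<comment> \<open>The bound on the direction is void for vanishing mass, but then all integrals vanish.\<close>
  proof (cases "mass g = 0")
    case True
    have "AE \<omega> in P. I0 (h n) \<omega> = 0" for n
    proof -
      have "mass (h n) = 0"
        using simple_approx_mass(2)[OF h g, of n] True mass_nonneg[of "h n"] by linarith
      then show ?thesis using simple_integral_law[OF D(1), of n] by (intro has_law_0_iff) simp
    qed
    then have "AE \<omega> in P. \<forall>n. I0 (h n) \<omega> = 0" by (simp add: AE_all_countable)
    then have "AE \<omega> in P. convergent (\<lambda>n. I0 (h (id n)) \<omega>)"
      by eventually_elim (simp add: convergent_const)
    then show ?thesis by (intro exI[of _ id]) (auto simp: strict_mono_def)
  next
    case False
    then have pos: "0 < mass g" using mass_nonneg[of g] by linarith
    have ev: "\<exists>N. \<forall>n\<ge>N. (1 - (1/2)^Suc i) * mass g < mass (h n)" for i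
    proof -
      have "(1 - (1/2)^Suc i) * mass g < 1 * mass g" using pos by (intro mult_strict_right_mono) auto
      then show ?thesis
        using order_tendstoD(1)[OF simple_approx_mass(1)[OF h g]] by (simp add: eventually_sequentially)
    qed
    have "\<exists>r. \<forall>n. (1 - (1/2)^Suc n) * mass g < mass (h (r n)) \<and> r n < r (Suc n)"
    proof (rule dependent_nat_choice)
      show "\<exists>x. (1 - (1/2)^Suc 0) * mass g < mass (h x)" using ev[of 0] by blast
      fix x n
      obtain N where "\<forall>k\<ge>N. (1 - (1/2)^Suc (Suc n)) * mass g < mass (h k)" using ev by blast
      then show "\<exists>y. (1 - (1/2)^Suc (Suc n)) * mass g < mass (h y) \<and> x < y"
        by (intro exI[of _ "max N (Suc x)"]) auto
    qed
    then obtain r where r: "\<And>n. (1 - (1/2)^Suc n) * mass g < mass (h (r n))" "\<And>n. r n < r (Suc n)" by blast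
    have mono: "strict_mono r" using r(2) by (simp add: strict_mono_Suc_iff)
    let ?A = "\<lambda>n. {\<omega> \<in> space P. \<not> same_dir f (I0 (h (r n)) \<omega>) (I0 (h (r (Suc n))) \<omega>)}"
    have pA: "prob (?A n) \<le> (1/2)^Suc n" for n
    proof -
      let ?S = "{\<omega> \<in> space P. same_dir f (I0 (h (r n)) \<omega>) (I0 (h (r (Suc n))) \<omega>)}"
      have "?A n = space P - ?S" by auto
      then have pA: "prob (?A n) = 1 - prob ?S" by (simp add: prob_compl)
      have "(1 - (1/2)^Suc n) * mass g \<le> mass (h (r n))" using r(1)[of n] by simp
      also have "\<dots> \<le> mass (h (r (Suc n))) * prob ?S"
        using D(2) r(2)[of n] by (intro same_dir_prob D(1)) (auto simp: incseq_def)
      also have "\<dots> \<le> mass g * prob ?S"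
        by (intro mult_right_mono simple_approx_mass(2)[OF h g]) auto
      finally have "1 - (1/2)^Suc n \<le> prob ?S" using pos by (simp add: mult.commute)
      with pA show ?thesis by simp
    qed
    have "AE \<omega> in P. eventually (\<lambda>n. \<omega> \<in> space P - ?A n) sequentially"
    proof (rule borel_cantelli_AE1)
      have "summable (\<lambda>n. (1/2)^Suc n :: real)"
        by (subst summable_Suc_iff) (intro summable_geometric, simp)
      then show "summable (\<lambda>n. prob (?A n))"
      proof (rule summable_comparison_test[rotated], intro exI allI impI)
        fix n show "norm (prob (?A n)) \<le> (1/2)^Suc n"
          unfolding real_norm_def abs_of_nonneg[OF measure_nonneg] by (rule pA)
      qed
    qed (auto simp: emeasure_eq_measure)
    with AE_convergent_loss[OF simple_approx_subseq[OF h mono] g]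
    have "AE \<omega> in P. convergent (\<lambda>n. I0 (h (r n)) \<omega>)"
    proof eventually_elim
      case (elim \<omega>)
      obtain K where K: "0 < K" "\<And>x. norm x \<le> K * f x" using norm_le_mult_f by blast
      let ?X = "\<lambda>n. I0 (h (r n)) \<omega>"
      from elim(1) obtain l where l: "(\<lambda>n. f (?X n)) \<longlonglongrightarrow> l" by (auto simp: convergent_def)
      have inc: "f (?X n) \<le> f (?X (Suc n))" for n using elim(1) by (auto simp: incseq_Suc_iff)
      have "summable (\<lambda>n. K * (f (?X (Suc n)) - f (?X n)))"
        by (intro summable_mult telescope_summable[OF l])
      moreover have "eventually (\<lambda>n. norm (norm (?X (Suc n) - ?X n)) \<le> K * (f (?X (Suc n)) - f (?X n))) sequentially"
        using elim(2)
      proof eventually_elim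
        case (elim n)
        then have "same_dir f (?X (Suc n)) (?X n)" by (simp add: same_dir_sym)
        from same_dir_norm_diff_le[OF this K(2)] inc[of n] show ?case by simp
      qed
      ultimately have "summable (\<lambda>n. norm (?X (Suc n) - ?X n))"
        by (rule summable_comparison_test_ev[rotated])
      then have "summable (\<lambda>n. ?X (Suc n) - ?X n)"
        by (rule summable_norm_cancel)
      then have "(\<lambda>n. (\<Sum>i<n. ?X (Suc i) - ?X i) + ?X 0) \<longlonglongrightarrow> (\<Sum>i. ?X (Suc i) - ?X i) + ?X 0"
        by (intro tendsto_add tendsto_const summable_LIMSEQ)
      moreover have "(\<Sum>i<n. ?X (Suc i) - ?X i) + ?X 0 = ?X n" for n
        by (subst sum_lessThan_telescope) simp
      ultimately have "?X \<longlonglongrightarrow> (\<Sum>i. ?X (Suc i) - ?X i) + ?X 0" by (simp only:)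
      then show ?case by (rule convergentI)
    qed
    with mono show ?thesis by blast
  qed
  then obtain r where r: "strict_mono r" "AE \<omega> in P. convergent (\<lambda>n. I0 (h (r n)) \<omega>)" by blast
  have "(\<lambda>\<omega>. lim (\<lambda>n. I0 (h (r n)) \<omega>)) \<in> borel_measurable P"
    by (rule borel_measurable_lim_metric) measurable
  moreover have "AE \<omega> in P. (\<lambda>n. I0 (h (r n)) \<omega>) \<longlonglongrightarrow> lim (\<lambda>n. I0 (h (r n)) \<omega>)"
    using r(2) by eventually_elim (simp add: convergent_LIMSEQ_iff)
  ultimately show ?thesis using r(1) by blast
qed

end

section \<open>Convergence in probability\<close>

lemma (in prob_space) tendsto_in_prob_if_AE:
  assumes [measurable]: "\<And>n. X' n \<in> borel_measurable M" "X \<in> borel_measurable M"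
    and lim: "AE \<omega> in M. (\<lambda>n. X' n \<omega>) \<longlonglongrightarrow> X \<omega>"
  shows "tendsto_in_prob M X' X"
  unfolding tendsto_in_prob_def
proof (intro allI impI)
  fix e :: real assume e: "0 < e"
  let ?A = "\<lambda>n. {\<omega> \<in> space M. e < norm (X' n \<omega> - X \<omega>)}"
  have "(\<lambda>n. \<integral>\<omega>. indicator (?A n) \<omega> \<partial>M) \<longlonglongrightarrow> (\<integral>\<omega>. 0 \<partial>M :: real)"
  proof (rule integral_dominated_convergence[where w = "\<lambda>_. 1"])
    show "AE \<omega> in M. (\<lambda>n. indicator (?A n) \<omega>) \<longlonglongrightarrow> (0 :: real)"
      using lim
    proof eventually_elim
      case (elim \<omega>)
      from tendstoD[OF elim e] have "eventually (\<lambda>n. indicator (?A n) \<omega> = (0 :: real)) sequentially"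
        by eventually_elim (auto simp: dist_norm indicator_def)
      then show ?case by (rule tendsto_eventually)
    qed
  qed auto
  then show "(\<lambda>n. measure M (?A n)) \<longlonglongrightarrow> 0" by simp
qed

lemma (in prob_space) tendsto_in_prob_unique:
  assumes [measurable]: "\<And>n. X' n \<in> borel_measurable M" "X \<in> borel_measurable M" "Y \<in> borel_measurable M"
    and lim: "tendsto_in_prob M X' X" "tendsto_in_prob M X' Y"
  shows "AE \<omega> in M. X \<omega> = Y \<omega>"
proof -
  have "AE \<omega> in M. norm (X \<omega> - Y \<omega>) \<le> 2 * (1 / real (Suc k))" for k
  proof -
    let ?e = "1 / real (Suc k)"
    let ?A = "\<lambda>n. {\<omega> \<in> space M. ?e < norm (X' n \<omega> - X \<omega>)}" and ?B = "\<lambda>n. {\<omega> \<in> space M. ?e < norm (X' n \<omega> - Y \<omega>)}"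
    let ?C = "{\<omega> \<in> space M. 2 * ?e < norm (X \<omega> - Y \<omega>)}"
    have "0 < ?e" by simp
    then have "(\<lambda>n. prob (?A n) + prob (?B n)) \<longlonglongrightarrow> 0 + 0"
      using lim unfolding tendsto_in_prob_def by (intro tendsto_add) blast+
    moreover have "prob ?C \<le> prob (?A n) + prob (?B n)" for n
    proof -
      have "?C \<subseteq> ?A n \<union> ?B n"
      proof
        fix \<omega> assume "\<omega> \<in> ?C"
        moreover have "norm (X \<omega> - Y \<omega>) \<le> norm (X' n \<omega> - X \<omega>) + norm (X' n \<omega> - Y \<omega>)"
          using norm_triangle_ineq4[of "X' n \<omega> - Y \<omega>" "X' n \<omega> - X \<omega>"] by simp
        ultimately show "\<omega> \<in> ?A n \<union> ?B n" by auto
      qed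
      then have "prob ?C \<le> prob (?A n \<union> ?B n)" by (intro finite_measure_mono) auto
      also have "\<dots> \<le> prob (?A n) + prob (?B n)" by (rule measure_Un_le) auto
      finally show ?thesis .
    qed
    ultimately have "prob ?C \<le> 0 + 0" by (intro LIMSEQ_le_const) auto
    then have "prob ?C = 0" by (simp only: add_0 measure_le_0_iff)
    then have "AE \<omega> in M. \<omega> \<notin> ?C" by (subst (asm) prob_eq_0) auto
    then show ?thesis using AE_space by eventually_elim auto
  qed
  then have "AE \<omega> in M. \<forall>k. norm (X \<omega> - Y \<omega>) \<le> 2 * (1 / real (Suc k))"
    by (simp add: AE_all_countable)
  then show ?thesis
  proof eventually_elim
    case (elim \<omega>)
    have "(\<lambda>k. 2 * (1 / real (Suc k))) \<longlonglongrightarrow> 2 * 0"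
      using LIMSEQ_inverse_real_of_nat by (intro tendsto_mult tendsto_const) (simp add: inverse_eq_divide)
    from LIMSEQ_le_const[OF this] elim have "norm (X \<omega> - Y \<omega>) \<le> 2 * 0" by blast
    then show ?case by simp
  qed
qed

context sup_measure
begin

section \<open>The integral as an almost sure limit\<close>

text \<open>A candidate for the integral: an almost sure limit along some approximating sequence. By the existence
  of convergent subsequences it is as good as a limit in probability, and almost sure statements pass
  to it directly.\<close>

definition is_limit :: "('e \<Rightarrow> real) \<Rightarrow> ('w \<Rightarrow> real ^ 'n) \<Rightarrow> bool" where
  "is_limit g X \<longleftrightarrow> X \<in> borel_measurable P \<and>
     (\<exists>h. simple_approx h g \<and> (AE \<omega> in P. (\<lambda>n. I0 (h n) \<omega>) \<longlonglongrightarrow> X \<omega>))"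

lemma is_limitI:
  "X \<in> borel_measurable P \<Longrightarrow> simple_approx h g \<Longrightarrow> AE \<omega> in P. (\<lambda>n. I0 (h n) \<omega>) \<longlonglongrightarrow> X \<omega> \<Longrightarrow> is_limit g X"
  unfolding is_limit_def by blast

lemma is_limit_measurable: "is_limit g X \<Longrightarrow> X \<in> borel_measurable P"
  by (simp add: is_limit_def)

lemma is_limit_law:
  assumes "is_limit g X" "g \<in> L_plus \<alpha> m"
  shows "has_law P X (Phi (mass g))"
proof -
  obtain h where h: "simple_approx h g" "AE \<omega> in P. (\<lambda>n. I0 (h n) \<omega>) \<longlonglongrightarrow> X \<omega>"
    using assms(1) by (auto simp: is_limit_def)
  show ?thesis
    using simple_approx_mass(1)[OF h(1) assms(2)] is_limit_measurable[OF assms(1)] h(2)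
    by (intro has_law_AE_limit[OF simple_integral_law[OF simple_approxD(1)[OF h(1)]]]) auto
qed

text \<open>The delicate point is a tie in the limit, since a strict inequality between losses may become an
  equality while the vectors remain different. The event that the directions differ and the losses are
  within the factor \<open>c\<close> is open, so the bound \<open>1 - c powr \<alpha>\<close> survives the limit; let \<open>c\<close> tend to one.\<close>

lemma le_loss_limit:
  assumes g: "\<And>n. simple_fun m (g n)" and k: "\<And>n. simple_fun m (k n)"
    and le: "\<And>n x. x \<in> space m \<Longrightarrow> g n x \<le> k n x"
    and [measurable]: "X \<in> borel_measurable P" "W \<in> borel_measurable P"
    and lim: "AE \<omega> in P. (\<lambda>n. I0 (g n) \<omega>) \<longlonglongrightarrow> X \<omega>" "AE \<omega> in P. (\<lambda>n. I0 (k n) \<omega>) \<longlonglongrightarrow> W \<omega>"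
  shows "AE \<omega> in P. le_loss f (X \<omega>) (W \<omega>)"
proof -
  note [measurable] = simple_integral_measurable[OF g] simple_integral_measurable[OF k]
  have "AE \<omega> in P. \<forall>n. le_loss f (I0 (g n) \<omega>) (I0 (k n) \<omega>)"
    unfolding AE_all_countable using simple_integral_mono[OF g k le] by blast
  with lim have fle: "AE \<omega> in P. f (X \<omega>) \<le> f (W \<omega>)"
  proof eventually_elim
    case (elim \<omega>)
    show ?case
      by (rule tendsto_le[OF _ tendsto_f[OF elim(2)] tendsto_f[OF elim(1)]])
        (use elim(3) le_loss_imp_le in auto)
  qed
  let ?E = "{\<omega> \<in> space P. \<not> same_dir f (X \<omega>) (W \<omega>) \<and> f (W \<omega>) \<le> f (X \<omega>)}"
  have gap: "prob ?E \<le> 1 - c powr \<alpha>" if c: "0 < c" "c < 1" for c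
  proof -
    let ?U = "{p. \<not> same_dir f (fst p) (snd p) \<and> c * f (snd p) < f (fst p)}"
    have cf: "continuous_on UNIV (\<lambda>p. f (fst p))" "continuous_on UNIV (\<lambda>p. f (snd p))"
      by (auto intro!: continuous_on_compose2[OF continuous_f] continuous_intros)
    have "?U = {p. f (fst p) *\<^sub>R snd p \<noteq> f (snd p) *\<^sub>R fst p} \<inter> {p. c * f (snd p) < f (fst p)}"
      by (auto simp: same_dir_def)
    moreover have "open {p. f (fst p) *\<^sub>R snd p \<noteq> f (snd p) *\<^sub>R fst p}"
      by (intro open_Collect_neq continuous_intros cf)
    moreover have "open {p. c * f (snd p) < f (fst p)}"
      by (intro open_Collect_less continuous_intros cf)
    ultimately have U: "open ?U" by auto
    have "prob ?E \<le> prob {\<omega> \<in> space P. (X \<omega>, W \<omega>) \<in> ?U}"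
    proof (rule finite_measure_mono)
      show "?E \<subseteq> {\<omega> \<in> space P. (X \<omega>, W \<omega>) \<in> ?U}"
      proof
        fix \<omega> assume \<omega>: "\<omega> \<in> ?E"
        then have "X \<omega> \<noteq> 0" by (auto simp: same_dir_def)
        then have "c * f (X \<omega>) < 1 * f (X \<omega>)" using c by (intro mult_strict_right_mono) auto
        moreover have "c * f (W \<omega>) \<le> c * f (X \<omega>)" using \<omega> c by (intro mult_left_mono) auto
        ultimately show "\<omega> \<in> {\<omega> \<in> space P. (X \<omega>, W \<omega>) \<in> ?U}" using \<omega> by simp
      qed
      show "{\<omega> \<in> space P. (X \<omega>, W \<omega>) \<in> ?U} \<in> events" by simp
    qed
    also have "\<dots> \<le> 1 - c powr \<alpha>"
    proof (rule prob_liminf_open_le[OF _ _ _ U _ tendsto_const])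
      show "AE \<omega> in P. (\<lambda>n. (I0 (g n) \<omega>, I0 (k n) \<omega>)) \<longlonglongrightarrow> (X \<omega>, W \<omega>)"
        using lim by eventually_elim (rule tendsto_Pair)
      show "prob {\<omega> \<in> space P. (I0 (g n) \<omega>, I0 (k n) \<omega>) \<in> ?U} \<le> 1 - c powr \<alpha>" for n
        using different_dir_gap_prob[OF g[of n] k[of n] le c] by simp
    qed (simp_all add: borel_prod[symmetric])
    finally show ?thesis .
  qed
  have "prob ?E \<le> 1 - 1 powr \<alpha>"
  proof (rule tendsto_lowerbound)
    show "((\<lambda>c. 1 - c powr \<alpha>) \<longlongrightarrow> 1 - 1 powr \<alpha>) (at_left 1)"
      by (intro tendsto_intros) auto
    show "eventually (\<lambda>c. prob ?E \<le> 1 - c powr \<alpha>) (at_left (1::real))"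
      using eventually_at_left_real[of 0 "1::real"] by (auto elim!: eventually_mono intro: gap)
  qed simp
  then have "prob ?E = 0" using measure_nonneg[of P ?E] by simp
  then have "AE \<omega> in P. \<omega> \<notin> ?E" by (subst (asm) prob_eq_0) auto
  with fle show ?thesis using AE_space
  proof eventually_elim
    case (elim \<omega>)
    then consider "f (X \<omega>) < f (W \<omega>)" | "same_dir f (X \<omega>) (W \<omega>)" "f (X \<omega>) = f (W \<omega>)" by force
    then show ?case
      by cases (auto simp: le_loss_def dest: same_dir_eq)
  qed
qed

text \<open>The two approximating sequences need not be ordered, so compare both with their pointwise maximum,
  which also approximates the larger function \<open>k\<close>. Its limit has the same law as \<open>W\<close> and dominates \<open>W\<close>,
  hence equals it.\<close>

lemma is_limit_mono:
  assumes X: "is_limit g X" and W: "is_limit k W" and g: "g \<in> L_plus \<alpha> m" and k: "k \<in> L_plus \<alpha> m"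
    and le: "\<And>x. x \<in> space m \<Longrightarrow> g x \<le> k x"
  shows "AE \<omega> in P. le_loss f (X \<omega>) (W \<omega>)"
proof -
  note [measurable] = is_limit_measurable[OF X] is_limit_measurable[OF W]
  obtain h where h: "simple_approx h g" "AE \<omega> in P. (\<lambda>n. I0 (h n) \<omega>) \<longlonglongrightarrow> X \<omega>"
    using X by (auto simp: is_limit_def)
  obtain h' where h': "simple_approx h' k" "AE \<omega> in P. (\<lambda>n. I0 (h' n) \<omega>) \<longlonglongrightarrow> W \<omega>"
    using W by (auto simp: is_limit_def)
  define w where "w n x = max (h n x) (h' n x)" for n x
  have w: "simple_approx w k"
    unfolding w_def using le by (intro simple_approx_cong[OF simple_approx_max[OF h(1) h'(1)]]) (simp add: max_absorb2)
  obtain r W' where r: "strict_mono r" and [measurable]: "W' \<in> borel_measurable P"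
    and W': "AE \<omega> in P. (\<lambda>n. I0 (w (r n)) \<omega>) \<longlonglongrightarrow> W' \<omega>"
    using convergent_subseq_exists[OF w k] by blast
  have lim: "AE \<omega> in P. (\<lambda>n. I0 (h (r n)) \<omega>) \<longlonglongrightarrow> X \<omega>" "AE \<omega> in P. (\<lambda>n. I0 (h' (r n)) \<omega>) \<longlonglongrightarrow> W \<omega>"
    using h(2) h'(2) by (eventually_elim, use LIMSEQ_subseq_LIMSEQ[OF _ r] in \<open>auto simp: comp_def\<close>)+
  have XW': "AE \<omega> in P. le_loss f (X \<omega>) (W' \<omega>)"
    by (rule le_loss_limit[OF simple_approxD(1)[OF h(1)] simple_approxD(1)[OF w] _ _ _ lim(1) W']) (auto simp: w_def)
  have WW': "AE \<omega> in P. le_loss f (W \<omega>) (W' \<omega>)"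
    by (rule le_loss_limit[OF simple_approxD(1)[OF h'(1)] simple_approxD(1)[OF w] _ _ _ lim(2) W']) (auto simp: w_def)
  have "is_limit k W'"
    by (rule is_limitI[OF _ simple_approx_subseq[OF w r] W']) simp
  then have "has_law P W' (Phi (mass k))" using k by (rule is_limit_law)
  moreover have "has_law P W (Phi (mass k))" using W k by (rule is_limit_law)
  moreover have "AE \<omega> in P. f (W \<omega>) \<le> f (W' \<omega>)"
    using WW' by eventually_elim (rule le_loss_imp_le)
  ultimately have "AE \<omega> in P. f (W \<omega>) = f (W' \<omega>)" by (intro AE_f_eq_if_le)
  with XW' WW' show ?thesis
    by eventually_elim (auto simp: le_loss_def)
qed

lemma is_limit_unique:
  assumes X: "is_limit g X" "is_limit g Y" and g: "g \<in> L_plus \<alpha> m"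
  shows "AE \<omega> in P. X \<omega> = Y \<omega>"
  using is_limit_mono[OF X g g order_refl] is_limit_mono[OF X(2,1) g g order_refl]
  by eventually_elim (rule le_loss_antisym)

text \<open>Otherwise some subsequence stays away from \<open>X\<close> with a fixed probability; but it has a further
  subsequence that converges almost surely, and by uniqueness the limit is \<open>X\<close>.\<close>

lemma is_limit_tendsto_in_prob:
  assumes X: "is_limit g X" and h: "simple_approx h g" and g: "g \<in> L_plus \<alpha> m"
  shows "tendsto_in_prob P (\<lambda>n. I0 (h n)) X"
  unfolding tendsto_in_prob_def
proof (intro allI impI)
  fix e :: real assume e: "0 < e"
  note D = simple_approxD[OF h]
  note [measurable] = simple_integral_measurable[OF D(1)] is_limit_measurable[OF X]
  let ?p = "\<lambda>n. prob {\<omega> \<in> space P. e < norm (I0 (h n) \<omega> - X \<omega>)}"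
  show "?p \<longlonglongrightarrow> 0"
  proof (rule ccontr)
    assume "\<not> ?p \<longlonglongrightarrow> 0"
    then obtain d where d: "0 < d" "\<not> eventually (\<lambda>n. dist (?p n) 0 < d) sequentially"
      unfolding tendsto_iff by blast
    then have "infinite {n. d \<le> ?p n}"
      by (auto simp: eventually_sequentially infinite_nat_iff_unbounded_le not_less)
    from infinite_enumerate[OF this] obtain r :: "nat \<Rightarrow> nat" where r: "strict_mono r" "\<And>n. d \<le> ?p (r n)" by auto
    have hr: "simple_approx (\<lambda>n. h (r n)) g" using h r(1) by (rule simple_approx_subseq)
    obtain r' X' where r': "strict_mono r'" and [measurable]: "X' \<in> borel_measurable P"
      and X': "AE \<omega> in P. (\<lambda>n. I0 (h (r (r' n))) \<omega>) \<longlonglongrightarrow> X' \<omega>"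
      using convergent_subseq_exists[OF hr g] by blast
    have "is_limit g X'" by (rule is_limitI[OF _ simple_approx_subseq[OF hr r'] X']) simp
    from is_limit_unique[OF this X g] X' have "AE \<omega> in P. (\<lambda>n. I0 (h (r (r' n))) \<omega>) \<longlonglongrightarrow> X \<omega>"
      by eventually_elim simp
    then have "tendsto_in_prob P (\<lambda>n. I0 (h (r (r' n)))) X"
      by (intro tendsto_in_prob_if_AE) simp_all
    then have "(\<lambda>n. ?p (r (r' n))) \<longlonglongrightarrow> 0" using e by (simp add: tendsto_in_prob_def)
    then have "d \<le> 0" using r(2) by (intro LIMSEQ_le_const[where X = "\<lambda>n. ?p (r (r' n))"]) auto
    with d(1) show False by simp
  qed
qed

abbreviation Integral :: "('e \<Rightarrow> real) \<Rightarrow> 'w \<Rightarrow> real ^ 'n" where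
  "Integral \<equiv> implicit_integral f m P M"

lemma is_limit_implicit_integral:
  assumes g: "g \<in> L_plus \<alpha> m"
  shows "is_limit g (Integral g)"
proof -
  obtain h where h: "simple_approx h g" using simple_approx_exists[OF g] by blast
  obtain r X where r: "strict_mono r" and Xm: "X \<in> borel_measurable P"
    and lim: "AE \<omega> in P. (\<lambda>n. I0 (h (r n)) \<omega>) \<longlonglongrightarrow> X \<omega>"
    using convergent_subseq_exists[OF h g] by blast
  have hr: "simple_approx (\<lambda>n. h (r n)) g" using h r by (rule simple_approx_subseq)
  have X: "is_limit g X" by (rule is_limitI[OF Xm hr lim])
  let ?Q = "\<lambda>X. X \<in> borel_measurable P \<and> (\<forall>h. simple_approx h g \<longrightarrow> tendsto_in_prob P (\<lambda>n. I0 (h n)) X)"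
  have "?Q X" using is_limit_measurable[OF X] is_limit_tendsto_in_prob[OF X _ g] by blast
  then have "?Q (SOME X. ?Q X)" by (rule someI[of ?Q])
  then have Q: "?Q (Integral g)" unfolding implicit_integral_def simple_approx_def .
  have "AE \<omega> in P. X \<omega> = Integral g \<omega>"
    using Q Xm hr is_limit_tendsto_in_prob[OF X hr g] simple_integral_measurable[OF simple_approxD(1)[OF hr]]
    by (intro tendsto_in_prob_unique[of "\<lambda>n. I0 (h (r n))"]) auto
  with lim have "AE \<omega> in P. (\<lambda>n. I0 (h (r n)) \<omega>) \<longlonglongrightarrow> Integral g \<omega>"
    by eventually_elim simp
  then show ?thesis using Q hr by (intro is_limitI) auto
qed

section \<open>Properties of the integral\<close>

lemma integral_measurable: "g \<in> L_plus \<alpha> m \<Longrightarrow> Integral g \<in> borel_measurable P"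
  by (rule is_limit_measurable[OF is_limit_implicit_integral])

lemma integral_law: "g \<in> L_plus \<alpha> m \<Longrightarrow> has_law P (Integral g) (Phi (mass g))"
  by (rule is_limit_law[OF is_limit_implicit_integral])

text \<open>In the limit the maximum still dominates both scaled integrals, and its loss is the larger one of the
  two by continuity. These two properties determine the join, in either order of its arguments.\<close>

lemma integral_max:
  assumes g1: "g1 \<in> L_plus \<alpha> m" and g2: "g2 \<in> L_plus \<alpha> m" and ab: "0 \<le> a" "0 \<le> b"
  shows "AE \<omega> in P. Integral (\<lambda>x. max (a * g1 x) (b * g2 x)) \<omega> = vee f (a *\<^sub>R Integral g1 \<omega>) (b *\<^sub>R Integral g2 \<omega>)"
    and "AE \<omega> in P. vee f (a *\<^sub>R Integral g1 \<omega>) (b *\<^sub>R Integral g2 \<omega>) = vee f (b *\<^sub>R Integral g2 \<omega>) (a *\<^sub>R Integral g1 \<omega>)"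
proof -
  let ?k = "\<lambda>x. max (a * g1 x) (b * g2 x)"
  note L = mass_cmult(1)[OF g1 ab(1)] mass_cmult(1)[OF g2 ab(2)]
  have k: "?k \<in> L_plus \<alpha> m" by (rule L_plus_max[OF L])
  have scaled: "is_limit (\<lambda>x. c * g x) (\<lambda>\<omega>. c *\<^sub>R Integral g \<omega>) \<and> (\<exists>h. simple_approx h (\<lambda>x. c * g x) \<and> (AE \<omega> in P. (\<lambda>n. I0 (h n) \<omega>) \<longlonglongrightarrow> c *\<^sub>R Integral g \<omega>))"
    if g: "g \<in> L_plus \<alpha> m" and c: "0 \<le> c" for g c
  proof -
    note [measurable] = integral_measurable[OF g]
    obtain h where h: "simple_approx h g" "AE \<omega> in P. (\<lambda>n. I0 (h n) \<omega>) \<longlonglongrightarrow> Integral g \<omega>"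
      using is_limit_implicit_integral[OF g] by (auto simp: is_limit_def)
    have "AE \<omega> in P. \<forall>n. I0 (\<lambda>x. c * h n x) \<omega> = c *\<^sub>R I0 (h n) \<omega>"
      unfolding AE_all_countable using simple_integral_cmult[OF simple_approxD(1)[OF h(1)] c] by blast
    with h(2) have "AE \<omega> in P. (\<lambda>n. I0 (\<lambda>x. c * h n x) \<omega>) \<longlonglongrightarrow> c *\<^sub>R Integral g \<omega>"
      by eventually_elim (auto intro: tendsto_intros)
    moreover note simple_approx_cmult[OF h(1) c]
    ultimately show ?thesis using is_limitI[of "\<lambda>\<omega>. c *\<^sub>R Integral g \<omega>"] by auto
  qed
  from scaled[OF g1 ab(1)] obtain h1 where X: "is_limit (\<lambda>x. a * g1 x) (\<lambda>\<omega>. a *\<^sub>R Integral g1 \<omega>)"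
    and h1: "simple_approx h1 (\<lambda>x. a * g1 x)" "AE \<omega> in P. (\<lambda>n. I0 (h1 n) \<omega>) \<longlonglongrightarrow> a *\<^sub>R Integral g1 \<omega>" by blast
  from scaled[OF g2 ab(2)] obtain h2 where Y: "is_limit (\<lambda>x. b * g2 x) (\<lambda>\<omega>. b *\<^sub>R Integral g2 \<omega>)"
    and h2: "simple_approx h2 (\<lambda>x. b * g2 x)" "AE \<omega> in P. (\<lambda>n. I0 (h2 n) \<omega>) \<longlonglongrightarrow> b *\<^sub>R Integral g2 \<omega>" by blast
  define w where "w n x = max (h1 n x) (h2 n x)" for n x
  have w: "simple_approx w ?k" unfolding w_def by (rule simple_approx_max[OF h1(1) h2(1)])
  obtain r W where r: "strict_mono r" and Wm: "W \<in> borel_measurable P"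
    and W: "AE \<omega> in P. (\<lambda>n. I0 (w (r n)) \<omega>) \<longlonglongrightarrow> W \<omega>"
    using convergent_subseq_exists[OF w k] by blast
  have limW: "is_limit ?k W" by (rule is_limitI[OF Wm simple_approx_subseq[OF w r] W])
  have "AE \<omega> in P. \<forall>n. I0 (w n) \<omega> = vee f (I0 (h1 n) \<omega>) (I0 (h2 n) \<omega>)"
    unfolding AE_all_countable w_def
    using simple_integral_max[OF simple_approxD(1)[OF h1(1)] simple_approxD(1)[OF h2(1)]] by blast
  with W h1(2) h2(2) have fW: "AE \<omega> in P. f (W \<omega>) = max (f (a *\<^sub>R Integral g1 \<omega>)) (f (b *\<^sub>R Integral g2 \<omega>))"
  proof eventually_elim
    case (elim \<omega>)
    have "(\<lambda>n. f (I0 (w (r n)) \<omega>)) \<longlonglongrightarrow> max (f (a *\<^sub>R Integral g1 \<omega>)) (f (b *\<^sub>R Integral g2 \<omega>))"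
      using LIMSEQ_subseq_LIMSEQ[OF elim(2) r] LIMSEQ_subseq_LIMSEQ[OF elim(3) r]
      unfolding elim(4)[rule_format] f_vee comp_def by (intro tendsto_max tendsto_f)
    with tendsto_f[OF elim(1)] show ?case by (rule LIMSEQ_unique)
  qed
  have le1: "AE \<omega> in P. le_loss f (a *\<^sub>R Integral g1 \<omega>) (W \<omega>)"
    by (rule is_limit_mono[OF X limW L(1) k]) simp
  have le2: "AE \<omega> in P. le_loss f (b *\<^sub>R Integral g2 \<omega>) (W \<omega>)"
    by (rule is_limit_mono[OF Y limW L(2) k]) simp
  show "AE \<omega> in P. Integral ?k \<omega> = vee f (a *\<^sub>R Integral g1 \<omega>) (b *\<^sub>R Integral g2 \<omega>)"
    using is_limit_unique[OF is_limit_implicit_integral[OF k] limW k] fW le1 le2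
  proof eventually_elim
    case (elim \<omega>)
    from vee_eqI[OF elim(3,4)] elim(1,2) show ?case by simp
  qed
  show "AE \<omega> in P. vee f (a *\<^sub>R Integral g1 \<omega>) (b *\<^sub>R Integral g2 \<omega>) = vee f (b *\<^sub>R Integral g2 \<omega>) (a *\<^sub>R Integral g1 \<omega>)"
    using fW le1 le2
  proof eventually_elim
    case (elim \<omega>)
    from vee_commute_if_bounded[OF elim(2,3)] elim(1) show ?case by simp
  qed
qed

lemma integral_max_unscaled:
  assumes "g1 \<in> L_plus \<alpha> m" "g2 \<in> L_plus \<alpha> m"
  shows "AE \<omega> in P. Integral (\<lambda>x. max (g1 x) (g2 x)) \<omega> = vee f (Integral g1 \<omega>) (Integral g2 \<omega>)"
    and "AE \<omega> in P. vee f (Integral g1 \<omega>) (Integral g2 \<omega>) = vee f (Integral g2 \<omega>) (Integral g1 \<omega>)"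
  using integral_max[OF assms, of 1 1] by simp_all

text \<open>The defining sequences increase to the function everywhere, so a null set is not ignored by
  definition. Compare both functions with their maximum: all three integrals have the same law, hence
  the same loss, and commutativity of the join excludes different vectors with equal loss.\<close>

lemma integral_cong_AE:
  assumes g: "g \<in> L_plus \<alpha> m" and h: "h \<in> L_plus \<alpha> m" and eq: "AE x in m. g x = h x"
  shows "AE \<omega> in P. Integral g \<omega> = Integral h \<omega>"
proof -
  let ?k = "\<lambda>x. max (g x) (h x)"
  have k: "?k \<in> L_plus \<alpha> m" by (rule L_plus_max[OF g h])
  have "AE x in m. ?k x = g x" "AE x in m. ?k x = h x"
    using eq by (eventually_elim, simp)+
  then have mass: "mass ?k = mass g" "mass ?k = mass h"
    by (auto intro: mass_cong_AE)
  note K = integral_law[OF k] and G = integral_law[OF g] and H = integral_law[OF h]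
  have "AE \<omega> in P. f (Integral g \<omega>) = f (Integral ?k \<omega>)"
    using integral_max_unscaled(1)[OF g h]
    by (intro AE_f_eq_if_le[OF G K[unfolded mass(1)]]) (auto simp: f_vee elim!: eventually_mono)
  moreover have "AE \<omega> in P. f (Integral h \<omega>) = f (Integral ?k \<omega>)"
    using integral_max_unscaled(1)[OF g h]
    by (intro AE_f_eq_if_le[OF H K[unfolded mass(2)]]) (auto simp: f_vee elim!: eventually_mono)
  ultimately show ?thesis using integral_max_unscaled(2)[OF g h]
    by eventually_elim (simp add: vee_def)
qed

lemma has_law_eq_scale:
  assumes "has_law P X (Phi s)" "has_law P Y (Phi t)" "0 \<le> s" "0 \<le> t" "AE \<omega> in P. X \<omega> = Y \<omega>"
  shows "s = t"
proof -
  have "has_law P X (Phi t)"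
    using assms(2) has_law_measurable[OF assms(1)] assms(5) by (rule has_law_cong_AE)
  with assms(1) have "Phi s = Phi t" by (simp add: has_law_def)
  with assms(3,4) show ?thesis by (rule Phi_inject)
qed

text \<open>For the converse, domination of the first integral by the second makes the integral of the maximum equal to the integral of \<open>g2\<close>. The
  law determines the mass, so the maximum and \<open>g2\<close> have the same mass and agree almost everywhere.\<close>

lemma integral_le_iff:
  assumes g1: "g1 \<in> L_plus \<alpha> m" and g2: "g2 \<in> L_plus \<alpha> m"
  shows "(AE x in m. g1 x \<le> g2 x) \<longleftrightarrow> (AE \<omega> in P. le_loss f (Integral g1 \<omega>) (Integral g2 \<omega>))"
proof
  let ?k = "\<lambda>x. max (g1 x) (g2 x)"
  have k: "?k \<in> L_plus \<alpha> m" by (rule L_plus_max[OF g1 g2])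
  {
    assume "AE x in m. g1 x \<le> g2 x"
    then have "AE x in m. ?k x = g2 x" by eventually_elim simp
    from integral_cong_AE[OF k g2 this] integral_max_unscaled(1)[OF g1 g2]
    show "AE \<omega> in P. le_loss f (Integral g1 \<omega>) (Integral g2 \<omega>)"
      by eventually_elim (simp add: vee_eq_iff_le_loss[symmetric])
  next
    assume "AE \<omega> in P. le_loss f (Integral g1 \<omega>) (Integral g2 \<omega>)"
    with integral_max_unscaled(1)[OF g1 g2] have "AE \<omega> in P. Integral ?k \<omega> = Integral g2 \<omega>"
      by eventually_elim (simp add: vee_eq_iff_le_loss)
    then have "mass ?k = mass g2"
      by (intro has_law_eq_scale[OF integral_law[OF k] integral_law[OF g2]]) auto
    then have "(\<integral>x. ?k x powr \<alpha> - g2 x powr \<alpha> \<partial>m) = 0"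
      using L_plusD(4,5)[OF k] L_plusD(4,5)[OF g2] by simp
    moreover have "AE x in m. 0 \<le> ?k x powr \<alpha> - g2 x powr \<alpha>"
      using L_plusD(2)[OF g2] alpha_pos by (intro AE_I2) (simp add: powr_mono2)
    ultimately have "AE x in m. ?k x powr \<alpha> - g2 x powr \<alpha> = 0"
      using L_plusD(4)[OF k] L_plusD(4)[OF g2] by (subst (asm) integral_nonneg_eq_0_iff_AE) auto
    then show "AE x in m. g1 x \<le> g2 x"
      using AE_space
    proof eventually_elim
      case (elim x)
      show ?case
      proof (rule ccontr)
        assume "\<not> g1 x \<le> g2 x"
        with elim(1) L_plusD(2)[OF g2 elim(2)] powr_less_mono2[of \<alpha> "g2 x" "g1 x"] alpha_pos
        show False by (simp add: max_def)
      qed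
    qed
  }
qed

lemma integral_eq_iff:
  assumes g1: "g1 \<in> L_plus \<alpha> m" and g2: "g2 \<in> L_plus \<alpha> m"
  shows "(AE x in m. g1 x = g2 x) \<longleftrightarrow> (AE \<omega> in P. Integral g1 \<omega> = Integral g2 \<omega>)"
proof
  assume "AE \<omega> in P. Integral g1 \<omega> = Integral g2 \<omega>"
  then have "AE \<omega> in P. le_loss f (Integral g1 \<omega>) (Integral g2 \<omega>)" "AE \<omega> in P. le_loss f (Integral g2 \<omega>) (Integral g1 \<omega>)"
    by (eventually_elim, simp)+
  then have "AE x in m. g1 x \<le> g2 x" "AE x in m. g2 x \<le> g1 x"
    using integral_le_iff[OF g1 g2] integral_le_iff[OF g2 g1] by auto
  then show "AE x in m. g1 x = g2 x" by eventually_elim simp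
qed (rule integral_cong_AE[OF g1 g2])

text \<open>If the integrals are independent, the mass of the maximum is the sum of the masses, which forces the
  minimum of the two functions to vanish. Conversely, after changing \<open>g1\<close> on a null set the product is
  zero everywhere, the approximating simple functions have disjoint supports, and independence passes
  to the limit.\<close>

lemma integral_indep_iff:
  assumes g1: "g1 \<in> L_plus \<alpha> m" and g2: "g2 \<in> L_plus \<alpha> m"
  shows "indep_var borel (Integral g1) borel (Integral g2) \<longleftrightarrow> (AE x in m. g1 x * g2 x = 0)"
proof
  assume ind: "indep_var borel (Integral g1) borel (Integral g2)"
  let ?k = "\<lambda>x. max (g1 x) (g2 x)"
  have k: "?k \<in> L_plus \<alpha> m" by (rule L_plus_max[OF g1 g2])
  have "has_law P (\<lambda>\<omega>. vee f (Integral g1 \<omega>) (Integral g2 \<omega>)) (Phi (mass g1 + mass g2))"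
    by (rule indep_vee_law[OF ind integral_law[OF g1] integral_law[OF g2]]) auto
  then have "mass ?k = mass g1 + mass g2"
    using integral_max_unscaled(1)[OF g1 g2] by (intro has_law_eq_scale[OF integral_law[OF k]]) auto
  then have "(\<integral>x. g1 x powr \<alpha> + g2 x powr \<alpha> - ?k x powr \<alpha> \<partial>m) = 0"
    using L_plusD(4,5)[OF k] L_plusD(4,5)[OF g2] L_plusD(4,5)[OF g1] by simp
  moreover have "AE x in m. 0 \<le> g1 x powr \<alpha> + g2 x powr \<alpha> - ?k x powr \<alpha>"
    by (intro AE_I2) (simp add: max_def)
  ultimately have "AE x in m. g1 x powr \<alpha> + g2 x powr \<alpha> - ?k x powr \<alpha> = 0"
    using L_plusD(4)[OF k] L_plusD(4)[OF g1] L_plusD(4)[OF g2] by (subst (asm) integral_nonneg_eq_0_iff_AE) auto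
  then show "AE x in m. g1 x * g2 x = 0"
    by eventually_elim (auto simp: max_def split: if_splits)
next
  assume zero: "AE x in m. g1 x * g2 x = 0"
  define g where "g x = (if g2 x = 0 then g1 x else 0)" for x
  note [measurable] = L_plusD(1)[OF g1] L_plusD(1)[OF g2]
  have gL: "g \<in> L_plus \<alpha> m"
  proof -
    have "g \<in> borel_measurable m" unfolding g_def by measurable
    moreover have "(\<integral>\<^sup>+x. ennreal (g x powr \<alpha>) \<partial>m) \<le> (\<integral>\<^sup>+x. ennreal (g1 x powr \<alpha>) \<partial>m)"
      by (intro nn_integral_mono) (auto simp: g_def)
    ultimately show ?thesis
      using g1 by (auto simp: L_plus_def g_def intro: le_less_trans)
  qed
  obtain h where h: "simple_approx h g" "AE \<omega> in P. (\<lambda>n. I0 (h n) \<omega>) \<longlonglongrightarrow> Integral g \<omega>"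
    using is_limit_implicit_integral[OF gL] by (auto simp: is_limit_def)
  obtain h2 where h2: "simple_approx h2 g2" "AE \<omega> in P. (\<lambda>n. I0 (h2 n) \<omega>) \<longlonglongrightarrow> Integral g2 \<omega>"
    using is_limit_implicit_integral[OF g2] by (auto simp: is_limit_def)
  have "indep_var borel (Integral g) borel (Integral g2)"
  proof (rule indep_var_AE_limit[OF _ _ _ h(2) h2(2)])
    show "indep_var borel (I0 (h n)) borel (I0 (h2 n))" for n
    proof (rule simple_integral_indep[OF simple_approxD(1)[OF h(1)] simple_approxD(1)[OF h2(1)]])
      fix x assume x: "x \<in> space m"
      have "0 \<le> h n x" "h n x \<le> g x" "0 \<le> h2 n x" "h2 n x \<le> g2 x"
        using simple_approxD(1,4)[OF h(1)] simple_approxD(1,4)[OF h2(1)] x by (auto intro: simple_fun_nonneg)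
      then show "h n x * h2 n x = 0" by (auto simp: g_def split: if_splits)
    qed
  qed (auto intro: integral_measurable gL g2)
  moreover have "AE x in m. g1 x = g x"
    using zero by eventually_elim (auto simp: g_def)
  then have "AE \<omega> in P. Integral g1 \<omega> = Integral g \<omega>" by (rule integral_cong_AE[OF g1 gL])
  ultimately show "indep_var borel (Integral g1) borel (Integral g2)"
    by (intro indep_var_cong_AE[OF _ integral_measurable[OF g1] integral_measurable[OF g2]]) auto
qed

end

theorem proposition4p2:
  fixes f :: "real ^ 'n \<Rightarrow> real"
    and \<alpha> :: real
    and \<kappa> :: "(real ^ 'n) measure"
    and m :: "'e measure"
    and P :: "'w measure"
    and M :: "'e set \<Rightarrow> 'w \<Rightarrow> real ^ 'n"
    and g1 g2 :: "'e \<Rightarrow> real"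
  assumes "loss_function f"
    and "0 < \<alpha>"
    and "prob_space \<kappa>" and "sets \<kappa> = sets (restrict_space borel (unit_level f))"
    and "sigma_finite_measure m"
    and "prob_space P"
    and "implicit_sup_measure f \<alpha> \<kappa> m P M"
    and "g1 \<in> L_plus \<alpha> m" and "g2 \<in> L_plus \<alpha> m"
  shows "let I = implicit_integral f m P M in
     has_law P (I g1) (implicit_frechet \<alpha> \<kappa> (L_norm \<alpha> m g1)) \<and>
     ((\<forall>a\<ge>0. \<forall>b\<ge>0. AE \<omega> in P.
         I (\<lambda>x. max (a * g1 x) (b * g2 x)) \<omega> = vee f (a *\<^sub>R I g1 \<omega>) (b *\<^sub>R I g2 \<omega>)) \<and>
      (AE \<omega> in P. vee f (I g1 \<omega>) (I g2 \<omega>) = vee f (I g2 \<omega>) (I g1 \<omega>))) \<and>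
     (prob_space.indep_var P borel (I g1) borel (I g2) \<longleftrightarrow> (AE x in m. g1 x * g2 x = 0)) \<and>
     (((AE x in m. g1 x \<le> g2 x) \<longleftrightarrow> (AE \<omega> in P. le_loss f (I g1 \<omega>) (I g2 \<omega>))) \<and>
      ((AE x in m. g1 x = g2 x) \<longleftrightarrow> (AE \<omega> in P. I g1 \<omega> = I g2 \<omega>)))"
proof -
  interpret \<kappa>: prob_space \<kappa> by fact
  interpret P: prob_space P by fact
  interpret sup_measure f \<kappa> \<alpha> P m M
    using assms by unfold_locales auto
  note g = assms(8,9)
  have "has_law P (Integral g1) (implicit_frechet \<alpha> \<kappa> (L_norm \<alpha> m g1))"
    using integral_law[OF g(1)] by (simp add: L_norm_def mass_def)
  then show ?thesis
    using integral_max(1)[OF g] integral_max_unscaled(2)[OF g] integral_indep_iff[OF g] integral_le_iff[OF g] integral_eq_iff[OF g]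
    by (simp add: Let_def)
qed

end
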